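(* Let $1\le p<\infty$, $0<r<\infty$, $0<q\le\infty$, $\frac1s:=\left(\frac1r-\frac1p\right)_+$. Let $u,v,w\in\mathfrak M^+$ with $\int_0^t u<\infty$ for all $t>0$, and let $k$ be an Oinarov kernel with constant $D$. Let $C_S\in[0,\infty]$ be the least constant such that $\|Sf\|_{L^r_u}\le C_S\|f\|_{L^p_v}$ for all $f\in\mathfrak M^+$, where $$(Sf)(x)=\left(\int_x^\infty w(y)\left(\int_y^\infty k(z,y)f(z)\,dz\right)^q dy\right)^{1/q}\ (q<\infty),\qquad (Sf)(x)=\operatorname*{ess\,sup}_{y\ge x} w(y)\int_y^\infty k(z,y)f(z)\,dz\ (q=\infty).$$ If $q<\infty$, let $\mathbb A_0,\mathbb A_1\in[0,\infty]$ be the least constants such that for all $f\in\mathfrak M^+$ $$\left(\int_0^\infty u(x)\left(\int_x^{\sigma^2(x)} w\right)^{\frac rq}\left(\int_{\sigma^2(x)}^\infty k(z,\sigma^2(x))f(z)\,dz\right)^r dx\right)^{\frac1r}\le \mathbb A_0\|f\|_{L^p_v},$$ $$\left(\int_0^\infty u(x)\left(\int_x^{\sigma^2(x)} [k(\sigma^2(x),z)]^q w(z)\,dz\right)^{\frac rq}\left(\int_{\sigma^2(x)}^\infty f\right)^r dx\right)^{\frac1r}\le \mathbb A_1\|f\|_{L^p_v};$$ if $q=\infty$, let $\mathbb A_0,\mathbb A_1\in[0,\infty]$ be the least constants such that for all $f\in\mathfrak M^+$ $$\left(\int_0^\infty u(x)\left[\operatorname*{ess\,sup}_{y\in(x,\sigma^2(x))}w(y)\right]^r\left(\int_{\sigma^2(x)}^\infty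 k(z,\sigma^2(x))f(z)\,dz\right)^r dx\right)^{\frac1r}\le \mathbb A_0\|f\|_{L^p_v},$$ $$\left(\int_0^\infty u(x)\left[\operatorname*{ess\,sup}_{y\in(x,\sigma^2(x))}w(y)k(\sigma^2(x),y)\right]^r\left(\int_{\sigma^2(x)}^\infty f\right)^r dx\right)^{\frac1r}\le \mathbb A_1\|f\|_{L^p_v}.$$ Let $$\mathbb A_2:=\begin{cases}\displaystyle\sup_{t\in(0,\infty)}\left(\int_0^t u\right)^{\frac1r}\|H^*_t\|_{L^p_v\to L^q_w},& p\le r,\\[2mm] \displaystyle\left(\int_0^\infty u(x)\left(\int_0^x u\right)^{\frac sp}\|H^*_{\sigma^{-1}(x),\sigma(x)}\|^s_{L^p_v\to L^q_w}\,dx\right)^{\frac1s},& r<p.\end{cases}$$ Then $C_S<\infty$ if and only if $\mathbb A_0$, $\mathbb A_1$ and $\mathbb A_2$ are all finite. Moreover, $C_S\approx \mathbb A_0+\mathbb A_1+\mathbb A_2$, i.e. each side is bounded by the other times a positive constant depending only on $p,q,r,D$.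
   Context: $\mathfrak M$ is the set of measurable functions on $[0,\infty)$, $\mathfrak M^+\subset\mathfrak M$ the non-negative ones. For $0<p<\infty$, $v\in\mathfrak M^+$: $\|f\|_{L^p_v}:=\left(\int_0^\infty|f|^pv\right)^{1/p}$; for $p=\infty$: $\|f\|_{L^\infty_v}:=\operatorname{ess\,sup}_{x\ge0}v(x)|f(x)|$. For a positive operator $H$ on $\mathfrak M^+$, $\|H\|_{L^p_v\to L^q_w}\in[0,\infty]$ is the least $C$ with $\|Hf\|_{L^q_w}\le C\|f\|_{L^p_v}$ for all $f\in\mathfrak M^+$. Expressions $0\cdot\infty$, $\frac\infty\infty$, $\frac00$ are taken to be $0$. $(a)_+=\max(a,0)$ ($s$ is used only when $r<p$). Oinarov kernel with constant $D\ge1$: a Borel function $k(x,y)\ge0$ on $[0,\infty)^2$ with $k(x,y)=0$ if $x<y$ and $\frac1D(k(x,z)+k(z,y))\le k(x,y)\le D(k(x,z)+k(z,y))$ for all $x\ge z\ge y\ge0$. The functions $\sigma:[0,\infty)\to[0,\infty]$ and $\sigma^{-1}:[0,\infty)\to[0,\infty)$ are defined (with $\inf\varnothing=\infty$) by $$\sigma(x):=\inf\left\{y>0:\int_0^y u\ge2\int_0^x u\right\},\qquad \sigma^{-1}(x):=\inf\left\{y>0:\int_0^y u\ge\tfrac12\int_0^x u\right\}.$$ Put $\sigma(\infty):=\infty$; $\sigma^2=\sigma\circ\sigma$. At points $x$ with $\sigma^2(x)=\infty$ the integrals over $(\sigma^2(x),\infty)$ are $0$ and the corresponding integrands in the inequalities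 defining $\mathbb A_0,\mathbb A_1$ are $0$. For $0<c<d\le\infty$ and $f\in\mathfrak M^+$: $$(H^*_{c,d}f)(x):=\chi_{[c,d)}(x)\int_x^{\sigma(d)} k(z,x)f(z)\,dz,\qquad (H^*_cf)(x):=\chi_{[c,\infty)}(x)\int_x^\infty k(z,x)f(z)\,dz.$$ (In $\mathbb A_2$ with $r<p$, the integrand is $0$ at points $x$ with $\int_0^xu=0$.) *)

theory Defs
  imports "HOL-Probability.Essential_Supremum"
begin

text \<open>
  Non-negative measurable functions on \<open>[0, \<infinity>)\<close> are Lebesgue measurable and
  \<open>[0, \<infinity>]\<close>-valued. A function on \<open>[0, \<infinity>)\<close> is represented by a function on
  \<^typ>\<open>real\<close> whose values on the negative half-line play no role. The conventions
  \<open>0 * \<infinity> = 0\<close> and \<open>inf {} = \<infinity>\<close> are those of \<^typ>\<open>ennreal\<close>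
  (and, for the infimum, of \<^typ>\<open>ereal\<close>).
\<close>

definition Mplus :: "(real \<Rightarrow> ennreal) set" where
  "Mplus = borel_measurable (lebesgue_on {0..})"

text \<open>Real powers on \<open>[0, \<infinity>]\<close>; used for exponents \<open>a > 0\<close> only.\<close>

definition epow :: "ennreal \<Rightarrow> real \<Rightarrow> ennreal" where
  "epow x a = (if x = \<infinity> then \<infinity> else ennreal (enn2real x powr a))"

definition wnorm :: "ennreal \<Rightarrow> (real \<Rightarrow> ennreal) \<Rightarrow> (real \<Rightarrow> ennreal) \<Rightarrow> ennreal" where
  "wnorm p v f =
     (if p = \<infinity> then esssup (lebesgue_on {0..}) (\<lambda>x. v x * f x)
      else epow (\<integral>\<^sup>+x\<in>{0..}. epow (f x) (enn2real p) * v x \<partial>lebesgue) (1 / enn2real p))"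

text \<open>
  The least \<open>C \<in> [0, \<infinity>]\<close> with \<open>N f \<le> C * M f\<close> for all \<open>f\<close>. It is \<open>\<infinity>\<close> if no such \<open>C\<close>
  exists (for example, if \<open>M f = 0 < N f\<close> for some \<open>f\<close>, since \<open>\<infinity> * 0 = 0\<close>).
\<close>

definition least_const ::
    "((real \<Rightarrow> ennreal) \<Rightarrow> ennreal) \<Rightarrow> ((real \<Rightarrow> ennreal) \<Rightarrow> ennreal) \<Rightarrow> ennreal" where
  "least_const N M = Inf {C. \<forall>f\<in>Mplus. N f \<le> C * M f}"

definition opnorm :: "ennreal \<Rightarrow> (real \<Rightarrow> ennreal) \<Rightarrow> ennreal \<Rightarrow> (real \<Rightarrow> ennreal) \<Rightarrow>
    ((real \<Rightarrow> ennreal) \<Rightarrow> (real \<Rightarrow> ennreal)) \<Rightarrow> ennreal" where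
  "opnorm p v q w H = least_const (\<lambda>f. wnorm q w (H f)) (wnorm p v)"

definition oinarov_kernel :: "real \<Rightarrow> (real \<Rightarrow> real \<Rightarrow> ennreal) \<Rightarrow> bool" where
  "oinarov_kernel D k \<longleftrightarrow>
     (\<lambda>(x, y). k x y) \<in> borel_measurable (restrict_space borel ({0..} \<times> {0..})) \<and>
     (\<forall>x y. 0 \<le> x \<and> x < y \<longrightarrow> k x y = 0) \<and>
     (\<forall>x y z. 0 \<le> y \<and> y \<le> z \<and> z \<le> x \<longrightarrow>
        ennreal (1 / D) * (k x z + k z y) \<le> k x y \<and>
        k x y \<le> ennreal D * (k x z + k z y))"

definition cumul :: "(real \<Rightarrow> ennreal) \<Rightarrow> real \<Rightarrow> ennreal" where
  "cumul u x = (\<integral>\<^sup>+y\<in>{0..x}. u y \<partial>lebesgue)"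

text \<open>
  \<open>\<sigma>\<close> is a map on \<open>[0, \<infinity>]\<close>, so that it can be iterated. Where the integral of \<open>u\<close> over
  \<open>[0, x]\<close> vanishes, \<open>\<sigma>(x) = 0\<close>, possibly below \<open>x\<close>; but \<open>u = 0\<close> almost everywhere there.
\<close>

definition sigma :: "(real \<Rightarrow> ennreal) \<Rightarrow> ereal \<Rightarrow> ereal" where
  "sigma u x =
     (if x = \<infinity> then \<infinity>
      else Inf {ereal y | y. 0 < y \<and> cumul u y \<ge> 2 * cumul u (real_of_ereal x)})"

definition sigma2 :: "(real \<Rightarrow> ennreal) \<Rightarrow> real \<Rightarrow> ereal" where
  "sigma2 u x = sigma u (sigma u (ereal x))"

definition sigma_inv :: "(real \<Rightarrow> ennreal) \<Rightarrow> real \<Rightarrow> real" where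
  "sigma_inv u x = Inf {y. 0 < y \<and> cumul u y \<ge> cumul u x / 2}"

definition Hstar_between :: "(real \<Rightarrow> ennreal) \<Rightarrow> (real \<Rightarrow> real \<Rightarrow> ennreal) \<Rightarrow> real \<Rightarrow> ereal \<Rightarrow>
    (real \<Rightarrow> ennreal) \<Rightarrow> real \<Rightarrow> ennreal" where
  "Hstar_between u k c d f x =
     indicator {y. c \<le> y \<and> ereal y < d} x *
     (\<integral>\<^sup>+z\<in>{z. x \<le> z \<and> ereal z < sigma u d}. k z x * f z \<partial>lebesgue)"

definition Hstar_from :: "(real \<Rightarrow> real \<Rightarrow> ennreal) \<Rightarrow> real \<Rightarrow>
    (real \<Rightarrow> ennreal) \<Rightarrow> real \<Rightarrow> ennreal" where
  "Hstar_from k c f x = indicator {c..} x * (\<integral>\<^sup>+z\<in>{x..}. k z x * f z \<partial>lebesgue)"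

definition S_op :: "ennreal \<Rightarrow> (real \<Rightarrow> ennreal) \<Rightarrow> (real \<Rightarrow> real \<Rightarrow> ennreal) \<Rightarrow>
    (real \<Rightarrow> ennreal) \<Rightarrow> real \<Rightarrow> ennreal" where
  "S_op q w k f x =
     (if q = \<infinity>
      then esssup (lebesgue_on {x..}) (\<lambda>y. w y * (\<integral>\<^sup>+z\<in>{y..}. k z y * f z \<partial>lebesgue))
      else epow (\<integral>\<^sup>+y\<in>{x..}. w y * epow (\<integral>\<^sup>+z\<in>{y..}. k z y * f z \<partial>lebesgue) (enn2real q) \<partial>lebesgue)
             (1 / enn2real q))"

definition C_S :: "real \<Rightarrow> ennreal \<Rightarrow> real \<Rightarrow> (real \<Rightarrow> ennreal) \<Rightarrow> (real \<Rightarrow> ennreal) \<Rightarrow>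
    (real \<Rightarrow> ennreal) \<Rightarrow> (real \<Rightarrow> real \<Rightarrow> ennreal) \<Rightarrow> ennreal" where
  "C_S p q r u v w k =
     least_const (\<lambda>f. wnorm (ennreal r) u (S_op q w k f)) (wnorm (ennreal p) v)"

definition A0_lhs :: "ennreal \<Rightarrow> real \<Rightarrow> (real \<Rightarrow> ennreal) \<Rightarrow> (real \<Rightarrow> ennreal) \<Rightarrow>
    (real \<Rightarrow> real \<Rightarrow> ennreal) \<Rightarrow> (real \<Rightarrow> ennreal) \<Rightarrow> ennreal" where
  "A0_lhs q r u w k f =
     epow (\<integral>\<^sup>+x\<in>{0..}.
       (if sigma2 u x = \<infinity> then 0
        else let b = real_of_ereal (sigma2 u x) in
          u x *
          (if q = \<infinity> then epow (esssup (lebesgue_on {x<..<b}) w) r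
           else epow (\<integral>\<^sup>+y\<in>{x<..<b}. w y \<partial>lebesgue) (r / enn2real q)) *
          epow (\<integral>\<^sup>+z\<in>{b<..}. k z b * f z \<partial>lebesgue) r) \<partial>lebesgue) (1 / r)"

definition A1_lhs :: "ennreal \<Rightarrow> real \<Rightarrow> (real \<Rightarrow> ennreal) \<Rightarrow> (real \<Rightarrow> ennreal) \<Rightarrow>
    (real \<Rightarrow> real \<Rightarrow> ennreal) \<Rightarrow> (real \<Rightarrow> ennreal) \<Rightarrow> ennreal" where
  "A1_lhs q r u w k f =
     epow (\<integral>\<^sup>+x\<in>{0..}.
       (if sigma2 u x = \<infinity> then 0
        else let b = real_of_ereal (sigma2 u x) in
          u x *
          (if q = \<infinity> then epow (esssup (lebesgue_on {x<..<b}) (\<lambda>y. w y * k b y)) r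
           else epow (\<integral>\<^sup>+z\<in>{x<..<b}. epow (k b z) (enn2real q) * w z \<partial>lebesgue) (r / enn2real q)) *
          epow (\<integral>\<^sup>+z\<in>{b<..}. f z \<partial>lebesgue) r) \<partial>lebesgue) (1 / r)"

definition A0 :: "real \<Rightarrow> ennreal \<Rightarrow> real \<Rightarrow> (real \<Rightarrow> ennreal) \<Rightarrow> (real \<Rightarrow> ennreal) \<Rightarrow>
    (real \<Rightarrow> ennreal) \<Rightarrow> (real \<Rightarrow> real \<Rightarrow> ennreal) \<Rightarrow> ennreal" where
  "A0 p q r u v w k = least_const (A0_lhs q r u w k) (wnorm (ennreal p) v)"

definition A1 :: "real \<Rightarrow> ennreal \<Rightarrow> real \<Rightarrow> (real \<Rightarrow> ennreal) \<Rightarrow> (real \<Rightarrow> ennreal) \<Rightarrow>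
    (real \<Rightarrow> ennreal) \<Rightarrow> (real \<Rightarrow> real \<Rightarrow> ennreal) \<Rightarrow> ennreal" where
  "A1 p q r u v w k = least_const (A1_lhs q r u w k) (wnorm (ennreal p) v)"

text \<open>\<open>1/s = (1/r - 1/p)\<^sub>+\<close>; the value is meaningful for \<open>r < p\<close> only.\<close>

definition s_exp :: "real \<Rightarrow> real \<Rightarrow> real" where
  "s_exp p r = 1 / max (1 / r - 1 / p) 0"

definition A2 :: "real \<Rightarrow> ennreal \<Rightarrow> real \<Rightarrow> (real \<Rightarrow> ennreal) \<Rightarrow> (real \<Rightarrow> ennreal) \<Rightarrow>
    (real \<Rightarrow> ennreal) \<Rightarrow> (real \<Rightarrow> real \<Rightarrow> ennreal) \<Rightarrow> ennreal" where
  "A2 p q r u v w k =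
     (if p \<le> r then
        (SUP t\<in>{0<..}. epow (cumul u t) (1 / r) * opnorm (ennreal p) v q w (Hstar_from k t))
      else let s = s_exp p r in
        epow (\<integral>\<^sup>+x\<in>{0..}.
          (if cumul u x = 0 then 0
           else u x * epow (cumul u x) (s / p) *
             epow (opnorm (ennreal p) v q w
               (Hstar_between u k (sigma_inv u x) (sigma u (ereal x)))) s) \<partial>lebesgue) (1 / s))"

end

theory Submission
  imports Defs
begin

text \<open>
  Put \<open>U x = \<integral>\<^sub>0\<^sup>x u\<close> and cut the half-line along the level sets \<open>E\<^sub>j = {L\<^sub>j < U \<le> L\<^sub>j\<^sub>+\<^sub>1}\<close> with
  \<open>L\<^sub>j = M 2\<^bsup>j/2\<^esup>\<close>; in terms of levels, \<open>\<sigma>\<close> is a shift by two steps. Normalising \<open>M\<close> to be the total mass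
  of \<open>u\<close> when that is finite makes the last nonempty level set as heavy as all others.
  As \<open>Sf\<close> is nonincreasing and \<open>L\<^sub>j\<close> is geometric, \<open>\<parallel>Sf\<parallel>\<^sup>r\<close> is comparable to the sum of
  \<open>L\<^sub>j \<parallel>G\<parallel>\<^sup>r\<close>, where \<open>G y = \<integral>\<^sub>y\<^sup>\<infinity> k(z,y) f(z) dz\<close> and the norm is that of \<open>L\<^sup>q\<^sub>w(E\<^sub>j)\<close>.
  On \<open>E\<^sub>j\<close> the Oinarov condition splits \<open>G\<close> into a local part, an integral up to level \<open>L\<^sub>j\<^sub>+\<^sub>4\<close>, and two tails in which the
  variables are separated. The tails are controlled by \<open>A\<^sub>0\<close> and \<open>A\<^sub>1\<close>,
  and the local part by \<open>A\<^sub>2\<close>, using the embedding of \<open>\<ell>\<^sup>p\<close> in \<open>\<ell>\<^sup>r\<close> if \<open>p \<le> r\<close> and Hoelder's inequality if \<open>r < p\<close>.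
  Conversely, \<open>Sf\<close> dominates the integrands of \<open>A\<^sub>0\<close> and \<open>A\<^sub>1\<close> pointwise, its monotonicity gives \<open>A\<^sub>2\<close> if \<open>p \<le> r\<close>, and
  if \<open>r < p\<close> one tests with a maximum of near-extremal functions, one for each level.
\<close>

subsection \<open>Powers on \<open>[0, \<infinity>]\<close>\<close>

text \<open>The ratio sqrt 2 of the levels comes from the tails. A single point b splits the kernel
  on \<open>E j\<close> by k(z,y) <= D(k(z,b) + k(b,y)). The first term compares with
  \<open>A0\<close> if b is to the right of \<open>sigma2 u x\<close>, the second with
  \<open>A1\<close> if b is to its left, and both comparisons need \<open>E j\<close> between x and
  \<open>sigma2 u x\<close>. With b at level \<open>L (j + 3)\<close>, points x of
  \<open>E (j - 2)\<close> serve the first purpose and points of \<open>E (j - 1)\<close> the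
  second; half steps leave room for both. Since q and r may be less than 1, norms are only
  quasi-norms and duality is not at hand. Crude powers of 2 replace the triangle inequality, and
  near-extremal functions replace dual ones. The convention 0 * \<open>top\<close> = 0 makes
  products discontinuous, so estimates with least constants are confined to functions of finite
  norm, and vanishing or infinite factors are split off throughout. Two-sided series over levels are
  integrals for the counting measure on \<open>int\<close>, so that exchanging them with integrals
  is Tonelli's theorem.\<close>

lemma epow_top [simp]: "epow top a = top"
  by (simp add: epow_def infinity_ennreal_def)

lemma epow_0 [simp]: "epow 0 a = 0"
  by (simp add: epow_def)

lemma epow_1 [simp]: "epow 1 a = 1"
  by (simp add: epow_def)

lemma epow_ennreal: "0 \<le> x \<Longrightarrow> epow (ennreal x) a = ennreal (x powr a)"
  by (simp add: epow_def)

lemma epow_one [simp]: "epow x 1 = x"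
  by (cases x) (auto simp: epow_ennreal)

lemma epow_eq_0_iff [simp]: "epow x a = 0 \<longleftrightarrow> x = 0"
  by (cases x) (auto simp: epow_ennreal ennreal_eq_0_iff)

lemma epow_eq_top_iff [simp]: "epow x a = top \<longleftrightarrow> x = top"
  by (cases x) (auto simp: epow_ennreal)

lemma epow_less_top_iff [simp]: "epow x a < top \<longleftrightarrow> x < top"
  by (simp add: less_top[symmetric])

lemma epow_mono: "0 < a \<Longrightarrow> x \<le> y \<Longrightarrow> epow x a \<le> epow y a"
  by (cases x; cases y) (auto simp: epow_ennreal powr_mono2 top_unique)

lemma epow_mult: "epow (x * y) a = epow x a * epow y a"
proof (cases "x = top \<or> y = top")
  case True
  then show ?thesis by (auto simp: ennreal_top_mult ennreal_mult_top)
next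
  case False
  then show ?thesis
    by (cases x; cases y) (auto simp: epow_ennreal powr_mult simp flip: ennreal_mult)
qed

lemma epow_epow: "epow (epow x a) b = epow x (a * b)"
  by (cases x) (auto simp: epow_ennreal powr_powr)

lemma epow_inverse [simp]: "0 < a \<Longrightarrow> epow (epow x a) (1 / a) = x" "0 < a \<Longrightarrow> epow (epow x (1 / a)) a = x"
  by (simp_all add: epow_epow)

text \<open>Exponents of either sign are allowed because \<open>epow\<close> fixes 0 and
  \<open>top\<close> whatever the exponent.\<close>

lemma epow_add_exp: "epow x (a + b) = epow x a * epow x b"
  by (cases x) (auto simp: epow_ennreal powr_add ennreal_top_mult simp flip: ennreal_mult)

lemma epow_le_iff: "0 < a \<Longrightarrow> epow x a \<le> y \<longleftrightarrow> x \<le> epow y (1 / a)"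
  using epow_mono[of a x "epow y (1 / a)"] epow_mono[of "1 / a" "epow x a" y] by auto

lemma epow_le_cancel: "0 < a \<Longrightarrow> epow x a \<le> epow y a \<longleftrightarrow> x \<le> y"
  by (simp add: epow_le_iff)

lemma epow_max: "0 < a \<Longrightarrow> epow (max x y) a = max (epow x a) (epow y a)"
  by (auto simp: max_def epow_le_cancel)

text \<open>Follows from x + y \<le> 2 max x y, so one constant serves a < 1 and a > 1
  alike.\<close>

lemma epow_add_le: 
  assumes "0 < a" 
  shows "epow (x + y) a \<le> ennreal (2 powr a) * (epow x a + epow y a)"
proof -
  have "epow (x + y) a \<le> epow (2 * max x y) a"
    using assms by (intro epow_mono) (auto simp: mult_2 intro!: add_mono)
  also have "\<dots> = ennreal (2 powr a) * max (epow x a) (epow y a)"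
    using epow_ennreal[of 2 a] by (simp add: epow_mult epow_max assms)
  also have "\<dots> \<le> ennreal (2 powr a) * (epow x a + epow y a)"
    by (intro mult_left_mono) (auto simp: max_def)
  finally show ?thesis .
qed

lemma epow_measurable [measurable]: "(\<lambda>x. epow x a) \<in> borel_measurable borel"
  unfolding epow_def by measurable

lemma epow_SUP:
  assumes "0 < a"
  shows "epow (SUP i\<in>I. f i) a = (SUP i\<in>I. epow (f i) a)"
proof (rule antisym)
  have "f i \<le> epow (SUP i\<in>I. epow (f i) a) (1 / a)" if "i \<in> I" for i
    using that assms by (subst epow_le_iff[symmetric]) (auto intro: SUP_upper)
  then show "epow (SUP i\<in>I. f i) a \<le> (SUP i\<in>I. epow (f i) a)"
    using assms by (simp add: epow_le_iff SUP_least)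
qed (use assms in \<open>auto intro!: SUP_least epow_mono SUP_upper\<close>)

subsection \<open>Least constants\<close>

text \<open>Passes to the limit C -> y. Finiteness of z and y excludes the jumps of the product
  caused by 0 * \<open>top\<close> = 0, where the limit inequality fails.\<close>

lemma ennreal_le_all_gt:
  fixes x y z :: ennreal
  assumes "\<And>C. y < C \<Longrightarrow> x \<le> C * z" "z < top" "y < top"
  shows "x \<le> y * z"
proof -
  obtain z' y' where z: "z = ennreal z'" "0 \<le> z'" and y: "y = ennreal y'" "0 \<le> y'"
    using assms by (cases z; cases y) auto
  show ?thesis
  proof (rule ennreal_le_epsilon)
    fix e :: real assume e: "0 < e"
    \<comment> \<open>The shift by 1 keeps the quotient meaningful for z' = 0 and still gives d * z'
      \<le> e.\<close>
    define d where "d = e / (z' + 1)"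
    have "0 < d" using e z by (auto simp: d_def)
    have "x \<le> ennreal (y' + d) * z"
      using \<open>0 < d\<close> y by (intro assms) (auto simp: ennreal_less_iff)
    also have "\<dots> = ennreal (y' * z' + d * z')"
      using y z \<open>0 < d\<close> by (simp add: distrib_right flip: ennreal_mult)
    also have "\<dots> \<le> ennreal (y' * z' + e)"
      using e z by (intro ennreal_leI) (auto simp: d_def field_simps)
    also have "\<dots> = y * z + ennreal e"
      using y z e by (simp add: ennreal_mult)
    finally show "x \<le> y * z + ennreal e" .
  qed
qed

text \<open>The infimum is attained on functions of finite norm. At M f = \<open>top\<close> this
  can fail: a least constant 0 would give 0 * \<open>top\<close> = 0 on the right.\<close>

lemma least_constD:
  assumes "least_const N M < top" "f \<in> Mplus" "M f < top"
  shows "N f \<le> least_const N M * M f"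
proof (rule ennreal_le_all_gt)
  fix C assume "least_const N M < C"
  then obtain C' where "C' < C" "\<forall>f\<in>Mplus. N f \<le> C' * M f"
    unfolding least_const_def Inf_less_iff by auto
  then have "N f \<le> C' * M f" using assms by auto
  also have "\<dots> \<le> C * M f" using \<open>C' < C\<close> by (intro mult_right_mono) auto
  finally show "N f \<le> C * M f" .
qed (use assms in auto)

text \<open>Any C' > C is positive, so C' * \<open>top\<close> = \<open>top\<close> takes care of
  the functions of infinite norm.\<close>

lemma least_constI:
  assumes "\<And>f. f \<in> Mplus \<Longrightarrow> M f < top \<Longrightarrow> N f \<le> C * M f"
  shows "least_const N M \<le> C"
proof (rule dense_ge)
  fix C' assume "C < C'"
  then have "0 < C'" by (meson le_less_trans zero_le)
  have "N f \<le> C' * M f" if "f \<in> Mplus" for f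
  proof (cases "M f < top")
    case True
    then have "N f \<le> C * M f" using assms that by auto
    also have "\<dots> \<le> C' * M f" using \<open>C < C'\<close> by (intro mult_right_mono) auto
    finally show ?thesis .
  next
    case False
    then show ?thesis using \<open>0 < C'\<close> by (simp add: not_less top_unique ennreal_mult_top)
  qed
  then show "least_const N M \<le> C'"
    unfolding least_const_def by (intro Inf_lower) auto
qed

lemma least_const_mono:
  assumes "\<And>f. f \<in> Mplus \<Longrightarrow> N f \<le> N' f"
  shows "least_const N M \<le> least_const N' M"
  unfolding least_const_def using assms by (intro Inf_superset_mono) (auto intro: order_trans)

lemma less_least_constE:
  assumes "c < least_const N M"
  obtains f where "f \<in> Mplus" "c * M f < N f"
proof -
  have "c \<notin> {C. \<forall>f\<in>Mplus. N f \<le> C * M f}"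
  proof
    assume "c \<in> {C. \<forall>f\<in>Mplus. N f \<le> C * M f}"
    then have "least_const N M \<le> c" unfolding least_const_def by (rule Inf_lower)
    with assms show False by simp
  qed
  then show ?thesis using that by (auto simp: not_le)
qed

subsection \<open>Sums over the integers\<close>

lemma nn_integral_count_space_shift:
  fixes g :: "int \<Rightarrow> ennreal"
  shows "(\<integral>\<^sup>+k. g (k + i) \<partial>count_space UNIV) = (\<integral>\<^sup>+k. g k \<partial>count_space UNIV)"
  by (rule nn_integral_bij_count_space) (rule bij_betwI[where g="\<lambda>k. k - i"], auto)

text \<open>Countable additivity of the measure with density f.\<close>

lemma nn_integral_count_space_disjoint:
  fixes S :: "int \<Rightarrow> 'a set"
  assumes "\<And>k. S k \<in> sets M" "disjoint_family S" "f \<in> borel_measurable M"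
  shows "(\<integral>\<^sup>+k. (\<integral>\<^sup>+x\<in>S k. f x \<partial>M) \<partial>count_space UNIV) = (\<integral>\<^sup>+x\<in>(\<Union>k. S k). f x \<partial>M)"
proof -
  have "(\<integral>\<^sup>+k. (\<integral>\<^sup>+x\<in>S k. f x \<partial>M) \<partial>count_space UNIV) = (\<integral>\<^sup>+k. emeasure (density M f) (S k) \<partial>count_space UNIV)"
    using assms by (intro nn_integral_cong) (auto simp: emeasure_density)
  also have "\<dots> = emeasure (density M f) (\<Union>k. S k)"
    using assms by (intro emeasure_UN_countable[symmetric]) auto
  also have "\<dots> = (\<integral>\<^sup>+x\<in>(\<Union>k. S k). f x \<partial>M)"
    using assms by (auto simp: emeasure_density)
  finally show ?thesis .
qed

text \<open>Each \<open>epow (f k) p\<close> is at most the whole sum S, so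
  \<open>epow (f k) r\<close> is at most \<open>epow (f k) p\<close> times S to the power r / p - 1.
  The case p = r is apart because \<open>epow_mono\<close> needs a positive exponent.\<close>

lemma nn_integral_epow_le:
  assumes "0 < p" "p \<le> r"
  shows "(\<integral>\<^sup>+k. epow (f k) r \<partial>count_space UNIV) \<le> epow (\<integral>\<^sup>+k. epow (f k) p \<partial>count_space UNIV) (r / p)"
proof (cases "p = r")
  case True
  then show ?thesis using assms by simp
next
  case False
  define S where "S = (\<integral>\<^sup>+k. epow (f k) p \<partial>count_space UNIV)"
  have S: "epow (f k) p \<le> S" for k
    unfolding S_def by (rule nn_integral_ge_point) simp
  define e where "e = (r - p) / p"
  have e: "0 < e" "r / p = 1 + e" "p * e = r - p" using assms False by (auto simp: e_def field_simps)
  have "epow (f k) r \<le> epow (f k) p * epow S e" for k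
  proof -
    have "epow (f k) r = epow (f k) p * epow (epow (f k) p) e"
      using epow_add_exp[of "f k" p "r - p"] by (simp add: epow_epow e)
    also have "\<dots> \<le> epow (f k) p * epow S e"
      using S e by (intro mult_left_mono epow_mono) auto
    finally show ?thesis .
  qed
  then have "(\<integral>\<^sup>+k. epow (f k) r \<partial>count_space UNIV) \<le> (\<integral>\<^sup>+k. epow (f k) p * epow S e \<partial>count_space UNIV)"
    by (intro nn_integral_mono) auto
  also have "\<dots> = epow S (r / p)"
    unfolding e by (subst nn_integral_multc) (simp_all add: epow_add_exp S_def[symmetric])
  finally show ?thesis unfolding S_def .
qed

text \<open>The constant 2 is not optimal, but it allows for the crude form \<open>a b \<le> a\<^sup>\<alpha> + b\<^sup>\<beta>\<close>
  of Young's inequality.\<close>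

lemma Young_crude:
  assumes "0 < \<alpha>" "0 < \<beta>" "1 / \<alpha> + 1 / \<beta> = 1"
  shows "a * b \<le> epow a \<alpha> + epow b \<beta>"
proof -
  \<comment> \<open>The factor with the larger power dominates: y is at most x to the power \<alpha>
    / \<beta>, and 1 + \<alpha> / \<beta> = \<alpha>.\<close>
  have *: "x * y \<le> epow x \<alpha>" if "epow y \<beta> \<le> epow x \<alpha>" "0 < \<alpha>" "0 < \<beta>" "1 / \<alpha> + 1 / \<beta> = 1" for x y \<alpha> \<beta>
  proof -
    have "x * y \<le> x * epow x (\<alpha> / \<beta>)"
      using that epow_le_iff[of \<beta> y "epow x \<alpha>"] by (intro mult_left_mono) (auto simp: epow_epow)
    also have "\<dots> = epow x (1 + \<alpha> / \<beta>)" by (simp add: epow_add_exp)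
    also have "1 + \<alpha> / \<beta> = \<alpha> * (1 / \<alpha> + 1 / \<beta>)" using that by (simp add: field_simps)
    finally show ?thesis using that by simp
  qed
  show ?thesis
  proof (cases "epow b \<beta> \<le> epow a \<alpha>")
    case True
    then show ?thesis using *[of b \<beta> a \<alpha>] assms by (simp add: add_increasing2)
  next
    case False
    then show ?thesis using *[of a \<alpha> b \<beta>] assms
      by (simp add: add_increasing mult.commute add.commute)
  qed
qed

text \<open>Young's inequality is applied to the sequences divided by their norms s and t. Their
  power sums are then 1 each, which gives the constant 1 + 1 = 2.\<close>

lemma Hoelder_crude:
  fixes a b :: "'k \<Rightarrow> ennreal"
  assumes "0 < \<alpha>" "0 < \<beta>" "1 / \<alpha> + 1 / \<beta> = 1"
  shows "(\<integral>\<^sup>+k. a k * b k \<partial>count_space UNIV) \<le>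
    2 * epow (\<integral>\<^sup>+k. epow (a k) \<alpha> \<partial>count_space UNIV) (1 / \<alpha>) * epow (\<integral>\<^sup>+k. epow (b k) \<beta> \<partial>count_space UNIV) (1 / \<beta>)"
    (is "_ \<le> 2 * epow ?A _ * epow ?B _")
proof -
  have pt: "epow (a k) \<alpha> \<le> ?A" "epow (b k) \<beta> \<le> ?B" for k
    by (rule nn_integral_ge_point, simp)+
  consider "?A = 0 \<or> ?B = 0" | "?A \<noteq> 0" "?B \<noteq> 0" "?A = top \<or> ?B = top" 
    | "?A \<noteq> 0" "?B \<noteq> 0" "?A \<noteq> top" "?B \<noteq> top" by blast
  then show ?thesis
  proof cases
    case 1
    \<comment> \<open>Counting measure has no null points, so a vanishing power sum kills every
      term.\<close>
    then have "(\<forall>k. a k = 0) \<or> (\<forall>k. b k = 0)"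
      using pt by (metis epow_eq_0_iff le_zero_eq)
    then have "(\<integral>\<^sup>+k. a k * b k \<partial>count_space UNIV) = 0" by auto
    then show ?thesis by simp
  next
    case 2
    then have "2 * epow ?A (1 / \<alpha>) * epow ?B (1 / \<beta>) = top"
      by (auto simp: ennreal_top_mult ennreal_mult_top)
    then show ?thesis by simp
  next
    case 3
    then obtain A B where A: "?A = ennreal A" "0 < A" and B: "?B = ennreal B" "0 < B"
      by (cases ?A; cases ?B) (auto simp: less_le)
    define s where "s = A powr (1 / \<alpha>)"
    define t where "t = B powr (1 / \<beta>)"
    have st: "0 < s" "0 < t" using A B by (auto simp: s_def t_def)
    have *: "a k * b k \<le> ennreal (s * t) * (ennreal (1 / A) * epow (a k) \<alpha> + ennreal (1 / B) * epow (b k) \<beta>)" for k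
    proof -
      have "ennreal (s * t) * (ennreal (1 / s) * ennreal (1 / t)) = 1"
        using st by (simp flip: ennreal_mult)
      then have "a k * b k = (ennreal (s * t) * (ennreal (1 / s) * ennreal (1 / t))) * (a k * b k)"
        by simp
      also have "\<dots> = ennreal (s * t) * ((ennreal (1 / s) * a k) * (ennreal (1 / t) * b k))"
        by (simp only: mult_ac)
      also have "\<dots> \<le> ennreal (s * t) * (epow (ennreal (1 / s) * a k) \<alpha> + epow (ennreal (1 / t) * b k) \<beta>)"
        by (intro mult_left_mono Young_crude assms) auto
      also have "epow (ennreal (1 / s) * a k) \<alpha> = ennreal (1 / A) * epow (a k) \<alpha>"
        using st A assms by (simp add: epow_mult epow_ennreal s_def powr_powr powr_divide)
      also have "epow (ennreal (1 / t) * b k) \<beta> = ennreal (1 / B) * epow (b k) \<beta>"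
        using st B assms by (simp add: epow_mult epow_ennreal t_def powr_powr powr_divide)
      finally show ?thesis .
    qed
    then have "(\<integral>\<^sup>+k. a k * b k \<partial>count_space UNIV) \<le> 
      (\<integral>\<^sup>+k. ennreal (s * t) * (ennreal (1 / A) * epow (a k) \<alpha> + ennreal (1 / B) * epow (b k) \<beta>) \<partial>count_space UNIV)"
      by (intro nn_integral_mono) auto
    also have "\<dots> = ennreal (s * t) * (ennreal (1 / A) * ?A + ennreal (1 / B) * ?B)"
      by (simp add: nn_integral_cmult nn_integral_add)
    also have "ennreal (1 / A) * ?A + ennreal (1 / B) * ?B = 2"
      using A B by (simp flip: ennreal_mult)
    also have "ennreal (s * t) * 2 = 2 * epow ?A (1 / \<alpha>) * epow ?B (1 / \<beta>)"
      using A B st by (simp add: epow_ennreal s_def t_def ennreal_mult mult_ac)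
    finally show ?thesis .
  qed
qed

subsection \<open>Measurable functions on the half-line\<close>

lemma halfline_restrict: "A \<subseteq> {0..} \<Longrightarrow> f \<in> Mplus \<Longrightarrow> f \<in> borel_measurable (lebesgue_on A)"
  unfolding Mplus_def by (rule measurable_restrict_mono)

lemma Mplus_indicator:
  assumes "f \<in> Mplus" "A \<in> sets lebesgue" "A \<subseteq> {0..}"
  shows "(\<lambda>x. f x * indicator A x) \<in> borel_measurable lebesgue"
  using halfline_restrict[OF assms(3,1)] assms(2)
  by (subst (asm) borel_measurable_restrict_space_iff_ennreal) auto

lemma Mplus_mult: "f \<in> Mplus \<Longrightarrow> g \<in> Mplus \<Longrightarrow> (\<lambda>x. f x * g x) \<in> Mplus"
  and Mplus_add: "f \<in> Mplus \<Longrightarrow> g \<in> Mplus \<Longrightarrow> (\<lambda>x. f x + g x) \<in> Mplus"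
  and Mplus_const: "(\<lambda>x. c) \<in> Mplus"
  unfolding Mplus_def by simp_all

lemma Mplus_epow: "f \<in> Mplus \<Longrightarrow> (\<lambda>x. epow (f x) a) \<in> Mplus"
  unfolding Mplus_def by measurable

lemma Mplus_ind: "A \<in> sets lebesgue \<Longrightarrow> (\<lambda>x. indicator A x) \<in> Mplus"
  unfolding Mplus_def by (intro measurable_restrict_space1 borel_measurable_indicator)

lemma Mplus_SUP: "finite I \<Longrightarrow> (\<And>i. i \<in> I \<Longrightarrow> f i \<in> Mplus) \<Longrightarrow> (\<lambda>x. SUP i\<in>I. f i x) \<in> Mplus"
  unfolding Mplus_def by (intro borel_measurable_SUP) (auto intro: countable_finite)

lemma lebesgue_borelI [intro]: "A \<in> sets borel \<Longrightarrow> A \<in> sets lebesgue"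
  by auto

lemma AE_lebesgue_on: 
  "A \<in> sets lebesgue \<Longrightarrow> (AE x in lebesgue_on A. P x) \<longleftrightarrow> (AE x in lebesgue. x \<in> A \<longrightarrow> P x)"
  by (simp add: AE_restrict_space_iff)

subsection \<open>Weighted norms on subsets of the half-line\<close>

definition wnorm_on :: "ennreal \<Rightarrow> (real \<Rightarrow> ennreal) \<Rightarrow> real set \<Rightarrow> (real \<Rightarrow> ennreal) \<Rightarrow> ennreal" where
  "wnorm_on q w A g = (if q = top then esssup (lebesgue_on A) (\<lambda>y. w y * g y)
     else epow (\<integral>\<^sup>+y\<in>A. w y * epow (g y) (enn2real q) \<partial>lebesgue) (1 / enn2real q))"

lemma enn2real_pos: "0 < q \<Longrightarrow> q \<noteq> top \<Longrightarrow> 0 < enn2real q"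
  by (cases q) (auto simp: infinity_ennreal_def)

lemma wnorm_on_AE:
  assumes "A \<in> sets lebesgue"
  shows "AE y in lebesgue. y \<in> A \<longrightarrow> w y * g y \<le> wnorm_on top w A g"
  using esssup_AE[of "\<lambda>y. w y * g y" "lebesgue_on A"] assms by (simp add: AE_lebesgue_on wnorm_on_def)

lemma wnorm_on_infinityI:
  assumes "A \<in> sets lebesgue" "A \<subseteq> {0..}" "w \<in> Mplus" "g \<in> Mplus"
    and "AE y in lebesgue. y \<in> A \<longrightarrow> w y * g y \<le> c"
  shows "wnorm_on top w A g \<le> c"
  unfolding wnorm_on_def using assms
  by (auto intro!: esssup_I halfline_restrict Mplus_mult simp: AE_lebesgue_on)

text \<open>Measurability is asked of the smaller function: \<open>esssup\<close> of a
  non-measurable function is \<open>top\<close>, which is harmless on the right.\<close>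

lemma wnorm_on_mono:
  assumes q: "0 < q" and AB: "A \<in> sets lebesgue" "B \<in> sets lebesgue" "A \<subseteq> B" "A \<subseteq> {0..}"
    and wf: "w \<in> Mplus" "f \<in> Mplus" and le: "\<And>y. y \<in> A \<Longrightarrow> f y \<le> g y"
  shows "wnorm_on q w A f \<le> wnorm_on q w B g"
proof (cases "q = top")
  case True
  have "AE y in lebesgue. y \<in> A \<longrightarrow> w y * f y \<le> wnorm_on top w B g"
    using wnorm_on_AE[OF AB(2), of w g]
  proof eventually_elim
    case (elim y)
    then show ?case using AB(3) le[of y] mult_left_mono[of "f y" "g y" "w y"] by (auto intro: order_trans)
  qed
  then show ?thesis using True AB wf by (auto intro!: wnorm_on_infinityI)
next
  case False
  then show ?thesis unfolding wnorm_on_def using AB le enn2real_pos[OF q False]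
    by (auto intro!: epow_mono nn_integral_mono mult_left_mono simp: indicator_def)
qed

text \<open>The factor may be \<open>top\<close>: it will be an integral over a tail, which can
  diverge.\<close>

lemma wnorm_on_cmult:
  assumes q: "0 < q" and A: "A \<in> sets lebesgue" "A \<subseteq> {0..}" and wf: "w \<in> Mplus" "g \<in> Mplus"
  shows "wnorm_on q w A (\<lambda>y. c * g y) = c * wnorm_on q w A g"
proof (cases "q = top")
  case True
  have le: "wnorm_on top w A (\<lambda>y. c * g y) \<le> c * wnorm_on top w A g" if "g \<in> Mplus" for c g
    using wnorm_on_AE[OF A(1), of w g] A wf that
    by (intro wnorm_on_infinityI Mplus_mult Mplus_const)
       (auto elim!: eventually_mono simp: mult.left_commute intro!: mult_left_mono)
  have "c * wnorm_on top w A g \<le> wnorm_on top w A (\<lambda>y. c * g y)"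
  proof (cases "c = 0 \<or> wnorm_on top w A (\<lambda>y. c * g y) = top")
    case True then show ?thesis by auto
  next
    case False
    show ?thesis
    proof (cases c)
      case (real c')
      with False have c': "0 < c'" by (cases "c' = 0") auto
      have "(\<lambda>y. ennreal (1 / c') * (c * g y)) = g"
        using real c' by (simp add: mult.assoc[symmetric] flip: ennreal_mult)
      \<comment> \<open>The reverse inequality is \<open>le\<close> for the function c * g and the
        factor 1 / c'.\<close>
      then have "wnorm_on top w A g \<le> ennreal (1 / c') * wnorm_on top w A (\<lambda>y. c * g y)"
        using le[OF Mplus_mult[OF Mplus_const wf(2)], of "ennreal (1 / c')" c] by simp
      then have "c * wnorm_on top w A g \<le> c * (ennreal (1 / c') * wnorm_on top w A (\<lambda>y. c * g y))"
        by (rule mult_left_mono) auto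
      also have "\<dots> = wnorm_on top w A (\<lambda>y. c * g y)"
        using real c' by (simp add: mult.assoc[symmetric] flip: ennreal_mult)
      finally show ?thesis .
    next
      case top
      \<comment> \<open>A finite norm of \<open>top\<close> * g forces w * g = 0 almost everywhere,
        so the left-hand side is \<open>top\<close> * 0 = 0.\<close>
      have "AE y in lebesgue. y \<in> A \<longrightarrow> w y * g y \<le> 0"
        using wnorm_on_AE[OF A(1), of w "\<lambda>y. c * g y"]
      proof eventually_elim
        case (elim y)
        show ?case
        proof
          assume "y \<in> A"
          with elim have "top * (w y * g y) \<le> wnorm_on top w A (\<lambda>y. c * g y)"
            by (simp add: top mult.left_commute)
          with False have "top * (w y * g y) < top"
            by (simp add: le_less_trans less_top)
          then show "w y * g y \<le> 0"
            by (cases "w y * g y = 0") (auto simp: ennreal_top_mult)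
        qed
      qed
      then have "wnorm_on top w A g = 0"
        using wnorm_on_infinityI[OF A wf, of 0] by simp
      then show ?thesis by simp
    qed
  qed
  with le[OF wf(2), of c] show ?thesis using True by auto
next
  case False
  have q': "0 < enn2real q" by (rule enn2real_pos[OF q False])
  have "(\<integral>\<^sup>+y\<in>A. w y * epow (c * g y) (enn2real q) \<partial>lebesgue) =
    (\<integral>\<^sup>+y. epow c (enn2real q) * (w y * epow (g y) (enn2real q) * indicator A y) \<partial>lebesgue)"
    by (simp add: epow_mult mult_ac)
  also have "\<dots> = epow c (enn2real q) * (\<integral>\<^sup>+y\<in>A. w y * epow (g y) (enn2real q) \<partial>lebesgue)"
    by (intro nn_integral_cmult Mplus_indicator Mplus_mult Mplus_epow wf A)
  finally show ?thesis using False q' by (simp add: wnorm_on_def epow_mult)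
qed

text \<open>Quasi-triangle constant: \<open>epow_add_le\<close> with exponent q contributes
  (2^q)^(1/q) = 2, and with exponent 1/q it contributes 2^(1/q). For q = \<open>top\<close> the
  value is 2, because \<open>enn2real top\<close> = 0 and 1 / 0 = 0.\<close>

definition cq :: "ennreal \<Rightarrow> real" where
  "cq q = 2 * 2 powr (1 / enn2real q)"

lemma cq_ge_1: "1 \<le> cq q"
proof -
  have "1 \<le> 2 powr (1 / enn2real q)" by (rule ge_one_powr_ge_zero) auto
  then show ?thesis by (simp add: cq_def)
qed

lemma wnorm_on_add:
  assumes q: "0 < q" and A: "A \<in> sets lebesgue" "A \<subseteq> {0..}" and wf: "w \<in> Mplus" "f \<in> Mplus" "g \<in> Mplus"
  shows "wnorm_on q w A (\<lambda>y. f y + g y) \<le> ennreal (cq q) * (wnorm_on q w A f + wnorm_on q w A g)"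
proof (cases "q = top")
  case True
  have "wnorm_on q w A (\<lambda>y. f y + g y) \<le> 1 * (wnorm_on q w A f + wnorm_on q w A g)"
    using wnorm_on_AE[OF A(1), of w f] wnorm_on_AE[OF A(1), of w g] A wf
    unfolding True by (intro wnorm_on_infinityI Mplus_add)
       (auto elim!: eventually_elim2 simp: distrib_left intro!: add_mono)
  also have "\<dots> \<le> ennreal (cq q) * (wnorm_on q w A f + wnorm_on q w A g)"
    by (rule mult_right_mono) (use cq_ge_1 in auto)
  finally show ?thesis .
next
  case False
  have q': "0 < enn2real q" by (rule enn2real_pos[OF q False])
  let ?I = "\<lambda>f. \<integral>\<^sup>+y\<in>A. w y * epow (f y) (enn2real q) \<partial>lebesgue"
  have "?I (\<lambda>y. f y + g y) \<le> (\<integral>\<^sup>+y. ennreal (2 powr enn2real q) * (w y * epow (f y) (enn2real q) * indicator A y + w y * epow (g y) (enn2real q) * indicator A y) \<partial>lebesgue)"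
  proof (rule nn_integral_mono)
    fix y
    have "w y * epow (f y + g y) (enn2real q) * indicator A y \<le> 
       w y * (ennreal (2 powr enn2real q) * (epow (f y) (enn2real q) + epow (g y) (enn2real q))) * indicator A y"
      by (intro mult_right_mono mult_left_mono epow_add_le q') auto
    then show "w y * epow (f y + g y) (enn2real q) * indicator A y \<le> ennreal (2 powr enn2real q) * (w y * epow (f y) (enn2real q) * indicator A y + w y * epow (g y) (enn2real q) * indicator A y)"
      by (simp add: distrib_left distrib_right mult_ac)
  qed
  also have "\<dots> = ennreal (2 powr enn2real q) * (?I f + ?I g)"
    by (subst nn_integral_cmult, intro borel_measurable_add Mplus_indicator Mplus_mult Mplus_epow wf A)
       (subst nn_integral_add, auto intro!: Mplus_indicator Mplus_mult Mplus_epow wf A)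
  finally have "epow (?I (\<lambda>y. f y + g y)) (1 / enn2real q) \<le> epow (ennreal (2 powr enn2real q) * (?I f + ?I g)) (1 / enn2real q)"
    by (rule epow_mono[rotated]) (use q' in auto)
  also have "\<dots> = 2 * epow (?I f + ?I g) (1 / enn2real q)"
    using q' by (simp add: epow_mult epow_ennreal powr_powr)
  also have "\<dots> \<le> 2 * (ennreal (2 powr (1 / enn2real q)) * (epow (?I f) (1 / enn2real q) + epow (?I g) (1 / enn2real q)))"
    by (intro mult_left_mono epow_add_le) (use q' in auto)
  finally show ?thesis
    using False by (simp add: wnorm_on_def cq_def ennreal_mult mult.assoc)
qed

text \<open>For finite q, the geometric series with ratio 2^(-q/(4r)), raised to r/q: a decay
  2^(-i/4) of r-th powers becomes this ratio for q-th powers.\<close>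

definition hc :: "ennreal \<Rightarrow> real \<Rightarrow> real" where
  "hc q r = (if q = top then 1 else (1 / (1 - 2 powr (- (enn2real q / (4 * r))))) powr (r / enn2real q))"

lemma hc_nonneg: "0 \<le> hc q r"
  by (simp add: hc_def)

text \<open>The geometric weights make it possible to pass from the quasi-norm on the union of the
  pieces to a sum of \<open>r\<close>-th powers, without regard to whether \<open>r \<le> q\<close>.\<close>

lemma wnorm_on_UN_le:
  fixes A :: "nat \<Rightarrow> real set"
  assumes q: "0 < q" and r: "0 < r" and A: "\<And>i. A i \<in> sets lebesgue" "B \<in> sets lebesgue" "B \<subseteq> {0..}" "\<And>i. A i \<subseteq> {0..}"
    and B: "B \<subseteq> (\<Union>i. A i)" and wg: "w \<in> Mplus" "g \<in> Mplus"
  shows "epow (wnorm_on q w B g) r \<le> ennreal (hc q r) * (\<Sum>i. ennreal (2 powr (real i / 4)) * epow (wnorm_on q w (A i) g) r)"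
    (is "_ \<le> _ * ?Q")
proof -
  \<comment> \<open>A single term is at most the whole sum \<open>?Q\<close>, which turns the weight
    into decay in i.\<close>
  have a: "epow (wnorm_on q w (A i) g) r \<le> ennreal (2 powr (- (real i / 4))) * ?Q" for i
  proof -
    have "ennreal (2 powr (real i / 4)) * epow (wnorm_on q w (A i) g) r \<le> ?Q"
      using sum_le_suminf[of "\<lambda>i. ennreal (2 powr (real i / 4)) * epow (wnorm_on q w (A i) g) r" "{i}"]
      by simp
    then have "ennreal (2 powr (- (real i / 4))) * (ennreal (2 powr (real i / 4)) * epow (wnorm_on q w (A i) g) r) \<le> ennreal (2 powr (- (real i / 4))) * ?Q"
      by (rule mult_left_mono) auto
    moreover have "2 powr (- (real i / 4)) * 2 powr (real i / 4) = (1::real)"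
      by (subst powr_add[symmetric]) simp
    ultimately show ?thesis
      by (simp add: mult.assoc[symmetric] flip: ennreal_mult)
  qed
  show ?thesis
  proof (cases "q = top")
    case True
    have "wnorm_on q w (A i) g \<le> epow ?Q (1 / r)" for i
    proof -
      have "epow (wnorm_on q w (A i) g) r \<le> 1 * ?Q"
        using powr_mono[of "- (real i / 4)" 0 "2::real"]
        by (intro order_trans[OF a] mult_right_mono) (auto simp: ennreal_le_1)
      then show ?thesis using r by (simp add: epow_le_iff)
    qed
    moreover have "AE y in lebesgue. \<forall>i. y \<in> A i \<longrightarrow> w y * g y \<le> wnorm_on q w (A i) g"
      unfolding True AE_all_countable using wnorm_on_AE A by blast
    ultimately have "AE y in lebesgue. y \<in> B \<longrightarrow> w y * g y \<le> epow ?Q (1 / r)"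
      using B by (elim eventually_mono) (blast intro: order_trans)
    then have "wnorm_on q w B g \<le> epow ?Q (1 / r)"
      unfolding True using A wg by (intro wnorm_on_infinityI) auto
    then show ?thesis using r True by (simp add: epow_le_iff hc_def)
  next
    case False
    have q': "0 < enn2real q" by (rule enn2real_pos[OF q False])
    let ?I = "\<lambda>A. \<integral>\<^sup>+y\<in>A. w y * epow (g y) (enn2real q) \<partial>lebesgue"
    define t where "t = 2 powr (- (enn2real q / (4 * r)))"
    have t: "0 < t" "t < 1" using q' r by (auto simp: t_def powr_less_one)
    have I: "?I (A i) \<le> ennreal (t ^ i) * epow ?Q (enn2real q / r)" for i
    proof -
      have "?I (A i) = epow (epow (wnorm_on q w (A i) g) r) (enn2real q / r)"
        using False q' r by (simp add: wnorm_on_def epow_epow)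
      also have "\<dots> \<le> epow (ennreal (2 powr (- (real i / 4))) * ?Q) (enn2real q / r)"
        by (rule epow_mono[OF _ a]) (use q' r in auto)
      also have "\<dots> = ennreal ((2 powr (- (real i / 4))) powr (enn2real q / r)) * epow ?Q (enn2real q / r)"
        by (simp add: epow_mult epow_ennreal)
      also have "(2 powr (- (real i / 4))) powr (enn2real q / r) = t ^ i"
        using r by (simp add: t_def powr_powr powr_power field_simps)
      finally show ?thesis .
    qed
    have "?I B \<le> (\<integral>\<^sup>+y. (\<Sum>i. w y * epow (g y) (enn2real q) * indicator (A i) y) \<partial>lebesgue)"
    proof (rule nn_integral_mono)
      fix y
      show "w y * epow (g y) (enn2real q) * indicator B y \<le> (\<Sum>i. w y * epow (g y) (enn2real q) * indicator (A i) y)"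
      proof (cases "y \<in> B")
        case True
        then obtain i where "y \<in> A i" using B by auto
        then show ?thesis
          using True sum_le_suminf[of "\<lambda>i. w y * epow (g y) (enn2real q) * indicator (A i) y" "{i}"] by simp
      qed simp
    qed
    also have "\<dots> = (\<Sum>i. ?I (A i))"
      by (intro nn_integral_suminf Mplus_indicator Mplus_mult Mplus_epow wg A)
    also have "\<dots> \<le> (\<Sum>i. ennreal (t ^ i) * epow ?Q (enn2real q / r))"
      by (intro suminf_le I) auto
    also have "\<dots> = (\<Sum>i. ennreal (t ^ i)) * epow ?Q (enn2real q / r)"
      by simp
    also have "(\<Sum>i. ennreal (t ^ i)) = ennreal (1 / (1 - t))"
      by (rule suminf_ennreal_eq) (use t in \<open>auto intro!: geometric_sums\<close>)
    finally have IB: "?I B \<le> ennreal (1 / (1 - t)) * epow ?Q (enn2real q / r)" .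
    have "epow (wnorm_on q w B g) r = epow (?I B) (r / enn2real q)"
      using False by (simp add: wnorm_on_def epow_epow)
    also have "\<dots> \<le> epow (ennreal (1 / (1 - t)) * epow ?Q (enn2real q / r)) (r / enn2real q)"
      by (rule epow_mono[OF _ IB]) (use q' r in auto)
    also have "\<dots> = ennreal ((1 / (1 - t)) powr (r / enn2real q)) * ?Q"
      using t q' r by (simp add: epow_mult epow_epow epow_ennreal)
    finally show ?thesis using False by (simp add: hc_def t_def)
  qed
qed

lemma wnorm_ennreal: "0 < p \<Longrightarrow> wnorm (ennreal p) v f = epow (\<integral>\<^sup>+x\<in>{0..}. epow (f x) p * v x \<partial>lebesgue) (1 / p)"
  by (simp add: wnorm_def)

lemma wnorm_indicator:
  assumes "B \<in> sets lebesgue" "B \<subseteq> {0..}" "w \<in> Mplus" "g \<in> Mplus"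
  shows "wnorm q w (\<lambda>x. indicator B x * g x) = wnorm_on q w B g"
proof (cases "q = top")
  case True
  have ig: "(\<lambda>x. indicator B x * g x) \<in> Mplus"
    by (intro Mplus_mult Mplus_ind assms)
  have "wnorm q w (\<lambda>x. indicator B x * g x) = wnorm_on top w {0..} (\<lambda>x. indicator B x * g x)"
    using True by (simp add: wnorm_def wnorm_on_def)
  also have "\<dots> = wnorm_on top w B g"
  proof (rule antisym)
    show "wnorm_on top w {0..} (\<lambda>x. indicator B x * g x) \<le> wnorm_on top w B g"
      using wnorm_on_AE[OF assms(1), of w g] ig assms
      by (intro wnorm_on_infinityI) (auto elim!: eventually_mono simp: indicator_def)
    show "wnorm_on top w B g \<le> wnorm_on top w {0..} (\<lambda>x. indicator B x * g x)"
      using assms by (intro wnorm_on_mono) auto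
  qed
  finally show ?thesis using True by simp
next
  case False
  have "(\<integral>\<^sup>+x\<in>{0..}. epow (indicator B x * g x) (enn2real q) * w x \<partial>lebesgue) = 
    (\<integral>\<^sup>+y\<in>B. w y * epow (g y) (enn2real q) \<partial>lebesgue)"
    using assms(2) by (intro nn_integral_cong) (auto simp: indicator_def mult.commute)
  then show ?thesis using False by (simp add: wnorm_def wnorm_on_def)
qed

subsection \<open>The kernel operator\<close>

definition kernel_op :: "(real \<Rightarrow> real \<Rightarrow> ennreal) \<Rightarrow> (real \<Rightarrow> ennreal) \<Rightarrow> real \<Rightarrow> ennreal" where
  "kernel_op k f y = (\<integral>\<^sup>+z\<in>{y..}. k z y * f z \<partial>lebesgue)"

lemma S_op_eq: "S_op q w k f x = wnorm_on q w {x..} (kernel_op k f)"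
  by (simp add: S_op_def wnorm_on_def kernel_op_def)

lemma Hstar_from_eq: "Hstar_from k c f = (\<lambda>x. indicator {c..} x * kernel_op k f x)"
  by (simp add: Hstar_from_def kernel_op_def fun_eq_iff)

lemma kernel_op_mono: "(\<And>z. y \<le> z \<Longrightarrow> f z \<le> g z) \<Longrightarrow> kernel_op k f y \<le> kernel_op k g y"
  unfolding kernel_op_def by (auto intro!: nn_integral_mono mult_left_mono simp: indicator_def)

text \<open>The kernel is Borel on the closed quadrant only; its extension by zero is accessible to
  the theorems on product measures.\<close>

lemma kernel_measurable:
  assumes "oinarov_kernel D k"
  shows "(\<lambda>(x, y). k x y * indicator {0..} x * indicator {0..} y) \<in> borel_measurable (borel \<Otimes>\<^sub>M borel)"
proof -
  have "(\<lambda>z. (case z of (x, y) \<Rightarrow> k x y) * indicator ({0..} \<times> {0..}) z) \<in> borel_measurable (borel :: (real \<times> real) measure)"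
    using assms unfolding oinarov_kernel_def
    by (subst borel_measurable_restrict_space_iff_ennreal[symmetric]) (auto intro!: borel_closed closed_Times)
  then show ?thesis
    by (simp add: borel_prod case_prod_beta' indicator_times mult.assoc)
qed

lemma kernel_Mplus_left:
  assumes "oinarov_kernel D k" "0 \<le> b"
  shows "(\<lambda>y. k b y) \<in> Mplus"
proof -
  have "(\<lambda>y. k b y * indicator {0..} b * indicator {0..} y) \<in> borel_measurable borel"
    using measurable_Pair2[OF kernel_measurable[OF assms(1)], of b] by simp
  then have "(\<lambda>y. k b y * indicator {0..} y) \<in> borel_measurable lebesgue"
    using assms(2) by (simp add: measurable_completion)
  then show ?thesis unfolding Mplus_def
    by (subst borel_measurable_restrict_space_iff_ennreal) auto
qed

lemma kernel_Mplus_right: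
  assumes "oinarov_kernel D k" "0 \<le> b"
  shows "(\<lambda>z. k z b) \<in> Mplus"
proof -
  have "(\<lambda>y. k y b * indicator {0..} y * indicator {0..} b) \<in> borel_measurable borel"
    using measurable_Pair1[OF kernel_measurable[OF assms(1)], of b] by simp
  then have "(\<lambda>y. k y b * indicator {0..} y) \<in> borel_measurable lebesgue"
    using assms(2) by (simp add: measurable_completion)
  then show ?thesis unfolding Mplus_def
    by (subst borel_measurable_restrict_space_iff_ennreal) auto
qed

text \<open>The kernel is jointly Borel but f only Lebesgue measurable. So f is replaced by a Borel
  function equal to it almost everywhere, and the integral with parameter is measurable by the
  theorem for \<open>lborel\<close>.\<close>

lemma kernel_op_Mplus:
  assumes k: "oinarov_kernel D k" and f: "f \<in> Mplus"
  shows "kernel_op k f \<in> Mplus"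
proof -
  have "(\<lambda>x. f x * indicator {0..} x) \<in> borel_measurable lebesgue"
    by (rule Mplus_indicator[OF f]) auto
  then obtain f' where f' [measurable]: "f' \<in> borel_measurable lborel"
    and AE: "AE x in lborel. f x * indicator {0..} x = f' x"
    using completion_ex_borel_measurable by blast
  define k' where "k' = (\<lambda>(x, y). k x y * indicator {0..} x * indicator {0..} y)"
  have k' [measurable]: "k' \<in> borel_measurable (borel \<Otimes>\<^sub>M borel)"
    unfolding k'_def by (rule kernel_measurable[OF k])
  have [measurable]: "(\<lambda>(y, z). k' (z, y) * f' z * indicator {(y, z). y \<le> z} (y, z)) \<in> borel_measurable (borel \<Otimes>\<^sub>M lborel)"
    by measurable
  have "(\<lambda>y. \<integral>\<^sup>+z. k' (z, y) * f' z * indicator {(y, z). y \<le> z} (y, z) \<partial>lborel) \<in> borel_measurable borel"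
    using lborel.borel_measurable_nn_integral[of "\<lambda>y z. k' (z, y) * f' z * indicator {(y, z). y \<le> z} (y, z)" borel] by simp
  then have "(\<lambda>y. \<integral>\<^sup>+z. k' (z, y) * f' z * indicator {(y, z). y \<le> z} (y, z) \<partial>lborel) \<in> Mplus"
    unfolding Mplus_def by (auto intro!: measurable_restrict_space1 measurable_completion)
  moreover have "kernel_op k f y = (\<integral>\<^sup>+z. k' (z, y) * f' z * indicator {(y, z). y \<le> z} (y, z) \<partial>lborel)"
    if "0 \<le> y" for y
    unfolding kernel_op_def nn_integral_completion using AE that
    by (intro nn_integral_cong_AE) (auto elim!: eventually_mono simp: k'_def indicator_def split: if_splits)
  ultimately show ?thesis
    unfolding Mplus_def by (subst measurable_cong) auto
qed

text \<open>Dropping one summand of the lower Oinarov bound shows that, up to the factor D, the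
  kernel decreases in its second argument and increases in its first.\<close>

lemma
  assumes "oinarov_kernel D k" "1 \<le> D" "0 \<le> y" "y \<le> z" "z \<le> x"
  shows kernel_upper: "k x y \<le> ennreal D * (k x z + k z y)"
    and kernel_lower1: "k x z \<le> ennreal D * k x y"
    and kernel_lower2: "k z y \<le> ennreal D * k x y"
proof -
  show "k x y \<le> ennreal D * (k x z + k z y)"
    using assms unfolding oinarov_kernel_def by auto
  have "ennreal (1 / D) * (k x z + k z y) \<le> k x y"
    using assms unfolding oinarov_kernel_def by auto
  then have "ennreal D * (ennreal (1 / D) * (k x z + k z y)) \<le> ennreal D * k x y"
    by (rule mult_left_mono) auto
  then have *: "k x z + k z y \<le> ennreal D * k x y"
    using assms(2) by (simp add: mult.assoc[symmetric] flip: ennreal_mult)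
  then show "k x z \<le> ennreal D * k x y" "k z y \<le> ennreal D * k x y"
    by (auto intro: order_trans[rotated])
qed

subsection \<open>Level sets of the primitive of the weight\<close>

locale weight =
  fixes u :: "real \<Rightarrow> ennreal"
  assumes u: "u \<in> Mplus" and fin: "0 < t \<Longrightarrow> cumul u t < \<infinity>"
begin

definition U :: "real \<Rightarrow> real" where "U x = enn2real (cumul u x)"

lemma cumul_nonpos: "x \<le> 0 \<Longrightarrow> cumul u x = 0"
proof -
  assume "x \<le> 0"
  then have "cumul u x \<le> (\<integral>\<^sup>+y. u y * indicator {0} y \<partial>lebesgue)"
    unfolding cumul_def by (intro nn_integral_mono) (auto simp: indicator_def)
  also have "\<dots> = 0"
    by (intro nn_integral_null_set null_sets_completionI finite_imp_null_set_lborel) simp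
  finally show ?thesis by simp
qed

lemma cumul_eq: "cumul u x = ennreal (U x)"
  using fin[of x] cumul_nonpos[of x] by (cases "0 < x") (auto simp: U_def not_less)

lemma U_nonneg [simp]: "0 \<le> U x"
  by (simp add: U_def)

lemma U_nonpos: "x \<le> 0 \<Longrightarrow> U x = 0"
  by (simp add: U_def cumul_nonpos)

lemma U_pos: "0 < U x \<Longrightarrow> 0 < x"
  using U_nonpos[of x] by (cases "x \<le> 0") auto

lemma U_mono: "x \<le> y \<Longrightarrow> U x \<le> U y"
proof -
  assume "x \<le> y"
  then have "cumul u x \<le> cumul u y"
    unfolding cumul_def by (intro nn_integral_mono) (auto simp: indicator_def)
  then show ?thesis by (simp add: cumul_eq)
qed

lemma U_less: "U x < U y \<Longrightarrow> x < y"
  using U_mono[of y x] by (cases "x < y") auto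

text \<open>On {0..t}, u is infinite at most on a null set, so U is the indefinite integral of
  \<open>enn2real (u y)\<close>, and indefinite Henstock-Kurzweil integrals are continuous.\<close>

lemma U_continuous: "continuous_on {0..t} U"
proof (cases "0 < t")
  case True
  have m: "(\<lambda>x. u x * indicator {0..t} x) \<in> borel_measurable lebesgue"
    by (intro Mplus_indicator u) auto
  have AE: "AE x in lebesgue. u x * indicator {0..t} x \<noteq> \<infinity>"
    using fin[OF True] m by (intro nn_integral_noteq_infinite) (auto simp: cumul_def)
  have eq: "AE y in lebesgue. ennreal (enn2real (u y) * indicator {0..x} y) = u y * indicator {0..x} y" if "x \<le> t" for x
    using AE
  proof eventually_elim
    case (elim y)
    then show ?case using that by (auto simp: indicator_def less_top split: if_splits)
  qed
  have meas: "(\<lambda>y. enn2real (u y) * indicator {0..x} y) \<in> borel_measurable lebesgue" for x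
  proof -
    have "(\<lambda>y. enn2real (u y * indicator {0..x} y)) \<in> borel_measurable lebesgue"
      by (intro borel_measurable_enn2real Mplus_indicator u) auto
    also have "(\<lambda>y. enn2real (u y * indicator {0..x} y)) = (\<lambda>y. enn2real (u y) * indicator {0..x} y)"
      by (auto simp: indicator_def)
    finally show ?thesis .
  qed
  have nn: "(\<integral>\<^sup>+y. ennreal (enn2real (u y) * indicator {0..x} y) \<partial>lebesgue) = cumul u x" if "x \<le> t" for x
    unfolding cumul_def by (rule nn_integral_cong_AE[OF eq[OF that]])
  have int: "integrable lebesgue (\<lambda>y. enn2real (u y) * indicator {0..x} y)" if "x \<le> t" for x
    using nn[OF that] meas by (intro integrableI_nonneg) (auto simp: cumul_eq)
  have "U x = integral {0..x} (\<lambda>y. enn2real (u y))" if "x \<le> t" for x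
  proof -
    have "U x = integral\<^sup>L lebesgue (\<lambda>y. enn2real (u y) * indicator {0..x} y)"
      using nn[OF that] meas by (subst integral_eq_nn_integral) (auto simp: U_def)
    also have "\<dots> = (LINT y:{0..x}|lebesgue. enn2real (u y))"
      by (simp add: set_lebesgue_integral_def mult.commute)
    also have "\<dots> = integral {0..x} (\<lambda>y. enn2real (u y))"
      by (rule set_lebesgue_integral_eq_integral) (use int[OF that] in \<open>simp add: set_integrable_def mult.commute\<close>)
    finally show ?thesis .
  qed
  moreover have "(\<lambda>y. enn2real (u y)) integrable_on {0..t}"
    by (rule set_lebesgue_integral_eq_integral) (use int[of t] in \<open>simp add: set_integrable_def mult.commute\<close>)
  ultimately show ?thesis
    using indefinite_integral_continuous_1[of "\<lambda>y. enn2real (u y)" 0 t]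
    by (auto intro: continuous_on_eq)
next
  case False
  then have "\<And>x. x \<in> {0..t} \<Longrightarrow> 0 = U x" by (auto intro: U_nonpos)
  then show ?thesis by (rule continuous_on_eq[OF continuous_on_const])
qed

lemma U_limit:
  assumes "0 \<le> x" "(X \<longlongrightarrow> x) sequentially" "\<And>n. 0 \<le> X n"
  shows "(\<lambda>n. U (X n)) \<longlonglongrightarrow> U x"
proof -
  obtain B where B: "\<And>n. X n \<le> B"
    using convergent_imp_bounded[OF assms(2)] by (auto simp: bounded_iff dest: abs_le_D1)
  then have "x \<le> B" using LIMSEQ_le_const2[OF assms(2)] by blast
  then show ?thesis
    using U_continuous[of B] B assms by (auto simp: continuous_on_sequentially o_def)
qed

lemma U_right_le:
  assumes "0 \<le> x" "\<And>y. x < y \<Longrightarrow> L \<le> U y"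
  shows "L \<le> U x"
proof (rule LIMSEQ_le_const)
  have "(\<lambda>n. x + inverse (real (Suc n))) \<longlonglongrightarrow> x + 0"
    by (intro tendsto_intros LIMSEQ_inverse_real_of_nat)
  then show "(\<lambda>n. U (x + inverse (real (Suc n)))) \<longlonglongrightarrow> U x"
    using assms by (intro U_limit) auto
  show "\<exists>N. \<forall>n\<ge>N. L \<le> U (x + inverse (real (Suc n)))"
    using assms by auto
qed

lemma U_left_le:
  assumes "0 < x" "\<And>y. 0 < y \<Longrightarrow> y < x \<Longrightarrow> U y \<le> L"
  shows "U x \<le> L"
proof (rule LIMSEQ_le_const2)
  \<comment> \<open>The multiplicative form and the index shifted by two keep all points strictly
    between 0 and x.\<close>
  have "(\<lambda>n. x * (1 - inverse (real (Suc (Suc n))))) \<longlonglongrightarrow> x * (1 - 0)"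
    by (intro tendsto_intros LIMSEQ_Suc[OF LIMSEQ_inverse_real_of_nat])
  moreover have s: "0 < x * (1 - inverse (real (Suc (Suc n))))" "x * (1 - inverse (real (Suc (Suc n)))) < x" for n
  proof -
    have "0 < 1 - inverse (real (Suc (Suc n)))" "1 - inverse (real (Suc (Suc n))) < 1"
      by (simp_all add: field_simps)
    then show "0 < x * (1 - inverse (real (Suc (Suc n))))" "x * (1 - inverse (real (Suc (Suc n)))) < x"
      using assms(1) mult_strict_left_mono[of "1 - inverse (real (Suc (Suc n)))" 1 x] by simp_all
  qed
  ultimately show "(\<lambda>n. U (x * (1 - inverse (real (Suc (Suc n)))))) \<longlonglongrightarrow> U x"
    using assms less_imp_le[OF s(1)] by (intro U_limit) auto
  show "\<exists>N. \<forall>n\<ge>N. U (x * (1 - inverse (real (Suc (Suc n))))) \<le> L"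
    using assms(2)[OF s] by blast
qed

text \<open>The largest point at which \<open>U\<close> does not exceed the level \<open>L\<close>; it is infinite if
  \<open>L\<close> bounds \<open>U\<close>, also when \<open>U\<close> attains the value \<open>L\<close>.\<close>

definition X :: "real \<Rightarrow> ereal" where "X L = Sup (ereal ` {y. U y \<le> L})"

text \<open>Left continuity of U makes a finite supremum attained; positions relative to
  \<open>X L\<close> thereby become inequalities for U.\<close>

lemma le_X_iff:
  assumes "0 \<le> L"
  shows "ereal y \<le> X L \<longleftrightarrow> U y \<le> L"
proof
  assume "U y \<le> L"
  then show "ereal y \<le> X L" unfolding X_def by (intro Sup_upper) auto
next
  assume y: "ereal y \<le> X L"
  show "U y \<le> L"
  proof (rule ccontr)
    assume "\<not> U y \<le> L"
    then have "0 < y" using assms U_pos[of y] by linarith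
    moreover have "U y' \<le> L" if "y' < y" for y'
    proof (rule ccontr)
      assume "\<not> U y' \<le> L"
      have "z \<le> ereal y'" if z: "z \<in> ereal ` {y. U y \<le> L}" for z
      proof -
        obtain z' where "z = ereal z'" "U z' \<le> L" using z by auto
        then show ?thesis using U_less[of z' y'] \<open>\<not> U y' \<le> L\<close> by simp
      qed
      then have "X L \<le> ereal y'"
        unfolding X_def by (rule Sup_least)
      with y that show False by (meson ereal_less_eq(3) leD order_trans)
    qed
    ultimately have "U y \<le> L" by (rule U_left_le) auto
    with \<open>\<not> U y \<le> L\<close> show False by simp
  qed
qed

lemma X_less_iff: "0 \<le> L \<Longrightarrow> X L < ereal y \<longleftrightarrow> L < U y"
  using le_X_iff[of L y] by (auto simp: not_le[symmetric])

lemma X_nonneg: "0 \<le> L \<Longrightarrow> 0 \<le> X L"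
  using le_X_iff[of L 0] U_nonpos[of 0] by (simp add: zero_ereal_def)

lemma X_mono: "L \<le> L' \<Longrightarrow> X L \<le> X L'"
  unfolding X_def by (intro Sup_subset_mono) auto

lemma U_X:
  assumes "0 \<le> L" "X L = ereal x"
  shows "U x = L" "0 \<le> x"
proof -
  show x: "0 \<le> x" using X_nonneg[OF assms(1)] assms by (simp add: zero_ereal_def)
  have "U x \<le> L" using assms le_X_iff[of L x] by simp
  moreover have "L \<le> U x"
    using X_less_iff[OF assms(1)] assms(2) by (intro U_right_le[OF x]) (auto intro: less_imp_le)
  ultimately show "U x = L" by simp
qed

lemma X_cases:
  assumes "0 < L"
  obtains x where "X L = ereal x" "U x = L" "0 < x" | "X L = \<infinity>"
  using X_nonneg[of L] U_X[of L] U_pos assms by (cases "X L") auto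

lemma X_strict_mono:
  assumes "0 < L" "L < L'" "X L \<noteq> \<infinity>"
  shows "X L < X L'"
proof -
  obtain x where x: "X L = ereal x" "U x = L" using assms by (auto elim: X_cases)
  have "X L' \<noteq> ereal x" using U_X[of L' x] x assms by auto
  then show ?thesis using X_mono[of L L'] x assms by auto
qed

text \<open>If the total mass is positive and finite, it equals \<open>L 0\<close>; then
  \<open>E (- 1)\<close> is the last nonempty level set and \<open>X (L k)\<close> is infinite
  exactly for k \<ge> 0. A weight without mass gives M = 0, which is excluded in
  \<open>pos_weight\<close>.\<close>

definition M :: real where
  "M = (if bdd_above (range U) then Sup (range U) else 1)"

definition L :: "int \<Rightarrow> real" where "L k = M * 2 powr (real_of_int k / 2)"

definition E :: "int \<Rightarrow> real set" where "E k = {x. L k < U x \<and> U x \<le> L (k + 1)}"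

lemma L_add: "L (k + i) = 2 powr (real_of_int i / 2) * L k"
  by (simp add: L_def add_divide_distrib powr_add)

lemma L_add2: "L (k + 2) = 2 * L k"
  by (simp add: L_add)

lemma sets_U [measurable]: "{x. U x \<le> a} \<in> sets borel" "{x. a < U x} \<in> sets borel"
proof -
  have "U \<in> borel_measurable borel"
    by (rule borel_measurable_mono) (auto intro!: monoI U_mono)
  then have [measurable]: "U \<in> borel_measurable borel" .
  show "{x. U x \<le> a} \<in> sets borel" "{x. a < U x} \<in> sets borel" by measurable
qed

lemma E_sets: "E k \<in> sets borel"
proof -
  have "E k = {x. L k < U x} \<inter> {x. U x \<le> L (k + 1)}" by (auto simp: E_def)
  then show ?thesis by auto
qed

text \<open>The set ends at \<open>X a\<close>, which may be infinite; therefore it is exhausted by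
  its parts in [0, n], each contained in some {0..y} with U y \<le> a.\<close>

lemma u_U_le: 
  assumes "0 \<le> a"
  shows "(\<integral>\<^sup>+x\<in>{x. 0 \<le> x \<and> U x \<le> a}. u x \<partial>lebesgue) \<le> ennreal a"
proof -
  let ?S = "\<lambda>n. {x. 0 \<le> x \<and> x \<le> real n \<and> U x \<le> a}"
  have S: "?S n \<in> sets lebesgue" for n
  proof -
    have "?S n = {0..real n} \<inter> {x. U x \<le> a}" by auto
    then show ?thesis by auto
  qed
  have n: "(\<integral>\<^sup>+x\<in>?S n. u x \<partial>lebesgue) \<le> ennreal a" for n
  proof -
    obtain y where y: "ereal y = min (ereal (real n)) (X a)"
      using X_nonneg[OF assms] by (cases "min (ereal (real n)) (X a)") (auto simp: min_def split: if_splits)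
    then have Uy: "U y \<le> a" using le_X_iff[OF assms, of y] by simp
    have "(\<integral>\<^sup>+x\<in>?S n. u x \<partial>lebesgue) \<le> cumul u y"
      unfolding cumul_def
    proof (intro nn_integral_mono mult_left_mono)
      fix x
      have "x \<le> y" if "x \<in> ?S n"
        using that y le_X_iff[OF assms, of x] by (metis (mono_tags, lifting) ereal_less_eq(3) mem_Collect_eq min.bounded_iff)
      then show "indicator (?S n) x \<le> (indicator {0..y} x :: ennreal)" by (auto simp: indicator_def)
    qed auto
    also have "\<dots> \<le> ennreal a" unfolding cumul_eq by (rule ennreal_leI[OF Uy])
    finally show ?thesis .
  qed
  have "(\<integral>\<^sup>+x\<in>{x. 0 \<le> x \<and> U x \<le> a}. u x \<partial>lebesgue) = (\<integral>\<^sup>+x. (SUP n. u x * indicator (?S n) x) \<partial>lebesgue)"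
  proof (intro nn_integral_cong antisym SUP_least)
    fix x
    show "u x * indicator {x. 0 \<le> x \<and> U x \<le> a} x \<le> (SUP n. u x * indicator (?S n) x)"
    proof (cases "0 \<le> x \<and> U x \<le> a")
      case True
      obtain n where "x \<le> real n" using real_arch_simple by blast
      then show ?thesis using True by (intro SUP_upper2[of n]) auto
    qed simp
    show "u x * indicator (?S n) x \<le> u x * indicator {x. 0 \<le> x \<and> U x \<le> a} x" for n
      by (auto simp: indicator_def)
  qed
  also have "\<dots> = (SUP n. \<integral>\<^sup>+x\<in>?S n. u x \<partial>lebesgue)"
  proof (rule nn_integral_monotone_convergence_SUP)
    show "(\<lambda>x. u x * indicator (?S n) x) \<in> borel_measurable lebesgue" for n
      by (intro Mplus_indicator u S) auto
    show "incseq (\<lambda>n x. u x * indicator (?S n) x)"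
      by (auto simp: incseq_def le_fun_def indicator_def)
  qed
  also have "\<dots> \<le> ennreal a" using n by (auto intro: SUP_least)
  finally show ?thesis .
qed

end

section \<open>Geometric levels of a weight with positive mass, and the position of sigma among
  them\<close>

locale pos_weight = weight + fixes y0 assumes y0: "0 < U y0"
begin

lemma M_pos: "0 < M"
  using y0 cSup_upper[of "U y0" "range U"] by (auto simp: M_def)

lemma L_pos [simp]: "0 < L k"
  by (simp add: L_def M_pos)

lemma L_nonneg [simp]: "0 \<le> L k"
  by (rule less_imp_le[OF L_pos])

lemma L_less_iff [simp]: "L k < L j \<longleftrightarrow> k < j"
  by (simp add: L_def M_pos)

lemma L_le_iff [simp]: "L k \<le> L j \<longleftrightarrow> k \<le> j"
  by (simp add: L_def M_pos)

lemma L_exists: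
  assumes "0 < a"
  obtains k where "L k < a" "a \<le> L (k + 1)"
proof
  \<comment> \<open>The real index at which the formula for the levels gives a.\<close>
  define t where "t = 2 * log 2 (a / M)"
  have a: "a = M * 2 powr (t / 2)" using assms M_pos by (simp add: t_def)
  show "L (\<lceil>t\<rceil> - 1) < a" "a \<le> L (\<lceil>t\<rceil> - 1 + 1)"
    unfolding L_def by (auto simp: a M_pos) linarith+
qed

lemma E_cover: "{x. L k < U x} = (\<Union>i. E (k + int i))"
proof (intro antisym subsetI)
  fix x assume "x \<in> {x. L k < U x}"
  then have x: "L k < U x" by simp
  then obtain j where j: "L j < U x" "U x \<le> L (j + 1)"
    by (metis L_exists L_pos order.strict_trans)
  then have "L k < L (j + 1)" using x by linarith
  then have "k \<le> j" by simp
  then have "x \<in> E (k + int (nat (j - k)))" using j by (simp add: E_def)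
  then show "x \<in> (\<Union>i. E (k + int i))" by blast
next
  fix x assume "x \<in> (\<Union>i. E (k + int i))"
  then obtain i where "L (k + int i) < U x" by (auto simp: E_def)
  moreover have "L k \<le> L (k + int i)" by simp
  ultimately show "x \<in> {x. L k < U x}" by (simp del: L_le_iff)
qed

lemma E_disjoint: "disjoint_family E"
proof -
  have "False" if "x \<in> E j" "x \<in> E k" "j < k" for j k x
  proof -
    have "L (j + 1) \<le> L k" using that by simp
    then show False using that(1,2) unfolding E_def mem_Collect_eq by linarith
  qed
  then show ?thesis unfolding disjoint_family_on_def by (metis disjoint_iff linorder_neqE)
qed

lemma E_pos: "x \<in> E k \<Longrightarrow> 0 < x"
  using less_trans[OF L_pos[of k], of "U x"] U_pos[of x] by (simp add: E_def)

lemma X_infinity: "X (L k) = \<infinity> \<Longrightarrow> E k = {}"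
  using le_X_iff[of "L k"] by (auto simp: E_def not_le[symmetric])

text \<open>This is what the choice of M buys. If U never exceeded a, M would be the total mass and
  at most a, so that k \<ge> 0 and \<open>L k\<close> would bound U, against the finiteness of
  \<open>X (L k)\<close>.\<close>

lemma X_finite_level:
  assumes "X (L k) \<noteq> \<infinity>" "a < L (k + 1)"
  obtains y where "a < U y"
proof (rule ccontr)
  assume *: "\<not> thesis"
  then have le: "U y \<le> a" for y using that[of y] by force
  then have bdd: "bdd_above (range U)" by (auto intro!: bdd_aboveI[of _ a])
  then have M: "M = Sup (range U)" by (simp add: M_def)
  also have "\<dots> \<le> a" using le by (auto intro: cSup_least)
  finally have "L 0 < L (k + 1)" using assms by (simp add: L_def)
  then have "0 \<le> k" by simp
  then have "M \<le> L k" using L_le_iff[of 0 k] by (simp add: L_def)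
  then have "U y \<le> L k" for y using cSup_upper[of "U y" "range U"] bdd M by simp
  then have "ereal y \<le> X (L k)" for y using le_X_iff[of "L k"] by simp
  then have "X (L k) = \<infinity>" by (simp add: ereal_top)
  with assms show False by simp
qed

text \<open>As 6/5 < sqrt 2, the value 6/5 * \<open>L k\<close> is strictly below
  \<open>L (k + 1)\<close> and is taken by U even if the total mass is \<open>L (k + 1)\<close> and
  never attained. The part of \<open>E k\<close> up to that point carries mass \<open>L k\<close> /
  5.\<close>

lemma mass_lower:
  assumes "X (L k) \<noteq> \<infinity>"
  shows "ennreal (L k) \<le> 5 * (\<integral>\<^sup>+x\<in>E k. u x \<partial>lebesgue)"
proof -
  have s: "6/5 < (2::real) powr (1/2)"
    using real_less_rsqrt[of "6/5" 2] by (simp add: powr_half_sqrt power2_eq_square)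
  have L1: "L (k + 1) = 2 powr (1/2) * L k" using L_add[of k 1] by simp
  have L': "6/5 * L k < L (k + 1)" unfolding L1 using s by simp
  obtain y1 where y1: "6/5 * L k < U y1" using X_finite_level[OF assms L'] .
  moreover have "0 < y1" using y1 L_pos[of k] by (intro U_pos[of y1, OF less_trans[OF _ y1]]) simp
  ultimately obtain y where y: "0 \<le> y" "U y = 6/5 * L k"
    using IVT'[of U 0 "6/5 * L k" y1] U_continuous[of y1] U_nonpos[of 0] by (auto simp: less_imp_le)
  obtain x where x: "X (L k) = ereal x" "U x = L k" "0 < x"
    by (rule X_cases[OF L_pos[of k]]) (use assms in auto)
  have "cumul u y \<le> (\<integral>\<^sup>+z. u z * indicator {0..x} z + u z * indicator (E k) z \<partial>lebesgue)"
    unfolding cumul_def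
  proof (rule nn_integral_mono)
    fix z
    have "z \<in> E k" if "x < z" "z \<le> y"
    proof -
      have "L k < U z" using that X_less_iff[of "L k" z] x by simp
      moreover have "U z \<le> L (k + 1)" using U_mono[OF that(2)] y L' by simp
      ultimately show ?thesis by (simp add: E_def)
    qed
    then show "u z * indicator {0..y} z \<le> u z * indicator {0..x} z + u z * indicator (E k) z"
      by (auto simp: indicator_def)
  qed
  also have "\<dots> = cumul u x + (\<integral>\<^sup>+x\<in>E k. u x \<partial>lebesgue)"
    unfolding cumul_def using E_pos[of _ k] E_sets[of k]
    by (intro nn_integral_add Mplus_indicator u) (auto intro: less_imp_le)
  finally have "ennreal (6/5 * L k) \<le> ennreal (L k) + (\<integral>\<^sup>+x\<in>E k. u x \<partial>lebesgue)"
    by (simp add: cumul_eq y x)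
  then show ?thesis
  proof (cases "(\<integral>\<^sup>+x\<in>E k. u x \<partial>lebesgue)")
    case (real m)
    have "6/5 * L k \<le> L k + m" 
      using \<open>ennreal (6/5 * L k) \<le> _\<close> real by (simp flip: ennreal_plus)
    then have "L k \<le> 5 * m" by simp
    moreover have "ennreal (5 * m) = 5 * ennreal m" using real by (simp add: ennreal_mult)
    ultimately show ?thesis using real by (metis ennreal_leI)
  next
    case top
    then show ?thesis by (simp add: ennreal_mult_top)
  qed
qed

lemma mass_upper: "(\<integral>\<^sup>+x\<in>E k. u x \<partial>lebesgue) \<le> ennreal (L (k + 1))"
proof -
  have "(\<integral>\<^sup>+x\<in>E k. u x \<partial>lebesgue) \<le> (\<integral>\<^sup>+x\<in>{x. 0 \<le> x \<and> U x \<le> L (k + 1)}. u x \<partial>lebesgue)"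
    using E_pos[of _ k] by (intro nn_integral_mono mult_left_mono) (auto simp: indicator_def E_def intro: less_imp_le)
  also have "\<dots> \<le> ennreal (L (k + 1))" by (rule u_U_le) simp
  finally show ?thesis .
qed

lemma sum_mass:
  "(\<integral>\<^sup>+k. c k * (\<integral>\<^sup>+x\<in>E k. u x \<partial>lebesgue) \<partial>count_space UNIV) = 
   (\<integral>\<^sup>+x. (\<integral>\<^sup>+k. c k * (u x * indicator (E k) x) \<partial>count_space UNIV) \<partial>lebesgue)"
proof -
  have m: "(\<lambda>x. u x * indicator (E k) x) \<in> borel_measurable lebesgue" for k
    using E_pos[of _ k] E_sets[of k] by (intro Mplus_indicator u) (auto intro: less_imp_le)
  have "(\<integral>\<^sup>+x. (\<integral>\<^sup>+k. c k * (u x * indicator (E k) x) \<partial>count_space UNIV) \<partial>lebesgue) =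
     (\<integral>\<^sup>+k. (\<integral>\<^sup>+x. c k * (u x * indicator (E k) x) \<partial>lebesgue) \<partial>count_space UNIV)"
    by (rule nn_integral_count_space_nn_integral) (use m in auto)
  then show ?thesis using m by (simp add: nn_integral_cmult)
qed

lemma integral_le_level_sum:
  assumes "\<And>k x. x \<in> E k \<Longrightarrow> g x \<le> c k"
  shows "(\<integral>\<^sup>+x\<in>{0..}. g x * u x \<partial>lebesgue) \<le> (\<integral>\<^sup>+k. ennreal (L (k + 1)) * c k \<partial>count_space UNIV)"
proof -
  \<comment> \<open>The level sets miss the points where U vanishes; u is zero almost everywhere on
    that set.\<close>
  have Z: "{x. 0 \<le> x \<and> U x \<le> 0} \<in> sets lebesgue"
  proof -
    have "{x. 0 \<le> x \<and> U x \<le> 0} = {0..} \<inter> {x. U x \<le> 0}" by auto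
    then show ?thesis by auto
  qed
  have "(\<integral>\<^sup>+x\<in>{x. 0 \<le> x \<and> U x \<le> 0}. u x \<partial>lebesgue) = 0"
    using u_U_le[of 0] by simp
  then have "AE x in lebesgue. u x * indicator {x. 0 \<le> x \<and> U x \<le> 0} x = 0"
    by (subst (asm) nn_integral_0_iff_AE) (auto intro!: Mplus_indicator u Z)
  then have "AE x in lebesgue. g x * u x * indicator {0..} x \<le> (\<integral>\<^sup>+k. c k * (u x * indicator (E k) x) \<partial>count_space UNIV)"
  proof eventually_elim
    case (elim x)
    consider "x < 0" | "0 \<le> x" "U x \<le> 0" | "0 \<le> x" "0 < U x" by linarith
    then show ?case
    proof cases
      case 3
      then obtain k where "L k < U x" "U x \<le> L (k + 1)" by (auto elim: L_exists)
      then have k: "x \<in> E k" by (simp add: E_def)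
      have "g x * u x * indicator {0..} x \<le> c k * (u x * indicator (E k) x)"
        using 3 k assms[OF k] by (simp add: mult_right_mono)
      also have "\<dots> \<le> (\<integral>\<^sup>+k. c k * (u x * indicator (E k) x) \<partial>count_space UNIV)"
        by (rule nn_integral_ge_point) simp
      finally show ?thesis .
    qed (use elim in auto)
  qed
  then have "(\<integral>\<^sup>+x\<in>{0..}. g x * u x \<partial>lebesgue) \<le> (\<integral>\<^sup>+k. c k * (\<integral>\<^sup>+x\<in>E k. u x \<partial>lebesgue) \<partial>count_space UNIV)"
    unfolding sum_mass by (rule nn_integral_mono_AE)
  also have "\<dots> \<le> (\<integral>\<^sup>+k. ennreal (L (k + 1)) * c k \<partial>count_space UNIV)"
    by (intro nn_integral_mono) (auto simp: mult.commute intro!: mult_left_mono mass_upper)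
  finally show ?thesis .
qed

text \<open>By \<open>mass_lower\<close>, \<open>L k\<close> may be replaced by 5 times the mass of
  \<open>E k\<close>. Where \<open>X (L k)\<close> is infinite, \<open>E k\<close> is empty and has
  no mass to compare with, so c has to vanish there.\<close>

lemma level_sum_le_integral:
  assumes "\<And>k x. x \<in> E k \<Longrightarrow> c k * u x \<le> g x" "\<And>k. X (L k) = \<infinity> \<Longrightarrow> c k = 0"
  shows "(\<integral>\<^sup>+k. ennreal (L k) * c k \<partial>count_space UNIV) \<le> 5 * (\<integral>\<^sup>+x\<in>{0..}. g x \<partial>lebesgue)"
proof -
  have "(\<integral>\<^sup>+k. ennreal (L k) * c k \<partial>count_space UNIV) \<le> 
    (\<integral>\<^sup>+k. 5 * (c k * (\<integral>\<^sup>+x\<in>E k. u x \<partial>lebesgue)) \<partial>count_space UNIV)"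
  proof (rule nn_integral_mono)
    fix k
    show "ennreal (L k) * c k \<le> 5 * (c k * (\<integral>\<^sup>+x\<in>E k. u x \<partial>lebesgue))"
      using mult_right_mono[OF mass_lower[of k], of "c k"] assms(2)[of k]
      by (cases "X (L k) = \<infinity>") (auto simp: mult_ac)
  qed
  also have "\<dots> = 5 * (\<integral>\<^sup>+k. c k * (\<integral>\<^sup>+x\<in>E k. u x \<partial>lebesgue) \<partial>count_space UNIV)"
    by (simp add: nn_integral_cmult)
  also have "\<dots> \<le> 5 * (\<integral>\<^sup>+x\<in>{0..}. g x \<partial>lebesgue)"
    unfolding sum_mass
  proof (intro mult_left_mono nn_integral_mono)
    fix x
    show "(\<integral>\<^sup>+k. c k * (u x * indicator (E k) x) \<partial>count_space UNIV) \<le> g x * indicator {0..} x"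
    proof (cases "\<exists>k. x \<in> E k")
      case True
      then obtain k where k: "x \<in> E k" by auto
      have "j = k" if "x \<in> E j" for j
        using E_disjoint that k by (auto simp: disjoint_family_on_def)
      then have "(\<integral>\<^sup>+j. c j * (u x * indicator (E j) x) \<partial>count_space UNIV) = (\<integral>\<^sup>+j. c k * u x * indicator {k} j \<partial>count_space UNIV)"
      proof (intro nn_integral_cong)
        fix j
        show "c j * (u x * indicator (E j) x) = c k * u x * indicator {k} j"
          using \<open>\<And>j. x \<in> E j \<Longrightarrow> j = k\<close>[of j] k by (cases "j = k") (auto simp: indicator_def)
      qed
      also have "\<dots> = c k * u x" by simp
      also have "\<dots> \<le> g x" by (rule assms(1)[OF k])
      finally show ?thesis using E_pos[OF k] by simp
    qed simp
  qed simp
  finally show ?thesis .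
qed

text \<open>Continuity of U from the right gives U y \<ge> 2 U x; minimality of y and continuity
  from the left give the converse.\<close>

lemma sigma_exact:
  assumes "0 < U x" "sigma u (ereal x) = ereal y"
  shows "U y = 2 * U x"
proof -
  let ?S = "{y. 0 < y \<and> 2 * U x \<le> U y}"
  have "{ereal y |y. 0 < y \<and> 2 * cumul u x \<le> cumul u y} = ereal ` ?S"
    by (auto simp: cumul_eq ennreal_mult[symmetric] simp flip: ennreal_numeral)
  then have s: "Inf (ereal ` ?S) = ereal y"
    using assms(2) by (simp add: sigma_def)
  have pos: "0 \<le> y"
  proof -
    have "0 \<le> Inf (ereal ` ?S)" by (rule Inf_greatest) (auto simp: zero_ereal_def)
    then show ?thesis unfolding s by (simp add: zero_ereal_def)
  qed
  have "2 * U x \<le> U y"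
  proof (rule U_right_le[OF pos])
    fix z assume "y < z"
    then have "Inf (ereal ` ?S) < ereal z" unfolding s by simp
    then obtain t where "t \<in> ?S" "t < z" by (auto simp: Inf_less_iff)
    then show "2 * U x \<le> U z" using U_mono[of t z] by auto
  qed
  moreover have "U y \<le> 2 * U x"
  proof (rule U_left_le)
    show "0 < y" using \<open>2 * U x \<le> U y\<close> assms(1) U_pos[of y] by linarith
    fix z assume z: "0 < z" "z < y"
    show "U z \<le> 2 * U x"
    proof (rule ccontr)
      assume "\<not> U z \<le> 2 * U x"
      then have "Inf (ereal ` ?S) \<le> ereal z" using z by (intro Inf_lower) auto
      then show False unfolding s using z by simp
    qed
  qed
  ultimately show ?thesis by simp
qed

text \<open>The strict inequality matters: sigma is the left end of its level and \<open>X\<close>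
  the right end, so equality would fail on a plateau of U.\<close>

lemma sigma_ge:
  assumes "0 \<le> a" "a < 2 * U x"
  shows "X a \<le> sigma u (ereal x)"
proof -
  have "X a \<le> ereal y" if "2 * cumul u x \<le> cumul u y" for y
  proof -
    have "2 * U x \<le> U y" using that by (simp add: cumul_eq ennreal_mult[symmetric] flip: ennreal_numeral)
    then show ?thesis using X_less_iff[OF assms(1), of y] assms(2) by (intro less_imp_le) auto
  qed
  then show ?thesis by (auto simp: sigma_def intro!: Inf_greatest)
qed

lemma sigma_le:
  assumes "0 < a" "2 * U x \<le> a"
  shows "sigma u (ereal x) \<le> X a"
  using assms(1)
proof (cases rule: X_cases)
  case (1 y)
  then have "2 * cumul u x \<le> cumul u y"
    using assms by (simp add: cumul_eq ennreal_mult[symmetric] flip: ennreal_numeral)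
  then show ?thesis using 1 by (auto simp: sigma_def intro!: Inf_lower)
qed simp

lemma sigma_E: 
  assumes "x \<in> E k"
  shows "X (L (k + 2)) \<le> sigma u (ereal x)" "sigma u (ereal x) \<le> X (L (k + 3))"
proof -
  have "L (k + 3) = 2 * L (k + 1)" using L_add2[of "k + 1"] by (simp add: algebra_simps)
  then show "X (L (k + 2)) \<le> sigma u (ereal x)" "sigma u (ereal x) \<le> X (L (k + 3))"
    using assms L_add2[of k] by (auto simp: E_def intro!: sigma_ge sigma_le)
qed

text \<open>The second application starts from the exact value 2 U x of U, not from the bounds for
  the position of \<open>sigma u x\<close>, so no level is lost in the iteration.\<close>

lemma sigma2_E:
  assumes "x \<in> E k"
  shows "X (L (k + 4)) \<le> sigma2 u x" "sigma2 u x \<le> X (L (k + 5))"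
proof -
  have L4: "L (k + 4) = 4 * L k" "L (k + 5) = 4 * L (k + 1)"
    using L_add2[of k] L_add2[of "k + 2"] L_add2[of "k + 1"] L_add2[of "k + 3"] by (simp_all add: algebra_simps)
  have x: "L k < U x" "U x \<le> L (k + 1)" using assms by (auto simp: E_def)
  have "0 < U x" using x L_pos[of k] by (simp del: L_pos)
  have "X (L (k + 4)) \<le> sigma2 u x \<and> sigma2 u x \<le> X (L (k + 5))"
  proof (cases "sigma u (ereal x)")
    case (real y)
    then have "U y = 2 * U x" using sigma_exact \<open>0 < U x\<close> by blast
    then show ?thesis
      unfolding sigma2_def real using x L4 by (auto intro!: sigma_ge sigma_le)
  next
    \<comment> \<open>Once sigma is infinite, U never exceeds \<open>L (k + 3)\<close>, so the upper
      bound is infinite as well.\<close>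
    case PInf
    then have "X (L (k + 3)) = \<infinity>" using sigma_E(2)[OF assms] by simp
    moreover have "X (L (k + 3)) \<le> X (L (k + 5))" by (intro X_mono) simp
    ultimately have "X (L (k + 5)) = \<infinity>" by simp
    then show ?thesis unfolding sigma2_def PInf by (simp add: sigma_def)
  next
    case MInf
    have "0 \<le> X (L (k + 2))" by (rule X_nonneg) simp
    then show ?thesis using sigma_E(1)[OF assms] MInf by (simp add: zero_ereal_def)
  qed
  then show "X (L (k + 4)) \<le> sigma2 u x" "sigma2 u x \<le> X (L (k + 5))" by auto
qed

text \<open>\<open>X (L k)\<close> is the left end of \<open>E k\<close>: the upper bound puts all
  of \<open>E k\<close> to the right of \<open>sigma_inv u x\<close>, and the lower bound limits how
  far the interval of \<open>Hstar_between\<close> extends to the left.\<close>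

lemma sigma_inv_E:
  assumes "x \<in> E k"
  shows "X (L (k - 2)) \<le> ereal (sigma_inv u x)" "ereal (sigma_inv u x) \<le> X (L k)"
proof -
  have x: "L k < U x" "U x \<le> L (k + 1)" using assms by (auto simp: E_def)
  let ?S = "{y. 0 < y \<and> cumul u x / 2 \<le> cumul u y}"
  have S: "?S = {y. 0 < y \<and> U x / 2 \<le> U y}"
    unfolding cumul_eq ennreal_divide_numeral[OF U_nonneg] by simp
  have xS: "x \<in> ?S" using E_pos[OF assms] unfolding S by simp
  have bdd: "bdd_below ?S" by (rule bdd_belowI[of _ 0]) auto
  have L2: "L k = 2 * L (k - 2)" using L_add2[of "k - 2"] by simp
  have fin: "X (L j) \<noteq> \<infinity>" if "j \<le> k" for j
  proof
    assume "X (L j) = \<infinity>"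
    moreover have "X (L j) \<le> X (L k)" using that by (intro X_mono) simp
    ultimately have "X (L k) = \<infinity>" by simp
    then show False using X_infinity assms by blast
  qed
  obtain a where a: "X (L (k - 2)) = ereal a" "U a = L (k - 2)"
    by (rule X_cases[OF L_pos[of "k - 2"]]) (use fin[of "k - 2"] in auto)
  obtain b where b: "X (L k) = ereal b" "U b = L k" "0 < b"
    by (rule X_cases[OF L_pos[of k]]) (use fin[of k] in auto)
  have "a \<le> Inf ?S"
  proof (rule cInf_greatest)
    fix y assume "y \<in> ?S"
    then have "U x / 2 \<le> U y" unfolding S by simp
    then have "U a < U y" using x a L2 by simp
    then show "a \<le> y" using U_less[of a y] by simp
  qed (use xS in auto)
  then show "X (L (k - 2)) \<le> ereal (sigma_inv u x)" by (simp add: a sigma_inv_def)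
  have "L (k + 1) \<le> L (k + 2)" by simp
  then have "L (k + 1) \<le> 2 * L k" by (simp add: L_add2)
  then have "b \<in> ?S" unfolding S using b x by simp
  then have "Inf ?S \<le> b" using bdd by (rule cInf_lower)
  then show "ereal (sigma_inv u x) \<le> X (L k)" by (simp add: b sigma_inv_def)
qed

end

section \<open>Tools for the comparison of the constants\<close>

lemma least_const_le_mult:
  assumes "\<And>f. f \<in> Mplus \<Longrightarrow> M f < top \<Longrightarrow> N f \<le> ennreal c * N' f" "0 < c"
  shows "least_const N M \<le> ennreal c * least_const N' M"
proof (cases "least_const N' M = top")
  case True
  then show ?thesis using assms(2) by (simp add: ennreal_mult_top)
next
  case False
  show ?thesis
  proof (rule least_constI)
    fix f assume f: "f \<in> Mplus" "M f < top"
    have "N f \<le> ennreal c * N' f" by (rule assms(1)[OF f])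
    also have "\<dots> \<le> ennreal c * (least_const N' M * M f)"
      using False f by (intro mult_left_mono least_constD) (auto simp: less_top)
    finally show "N f \<le> ennreal c * least_const N' M * M f" by (simp add: mult.assoc)
  qed
qed

text \<open>Lets a test function be built from finitely many levels at a time, which keeps the sum
  in question finite.\<close>

lemma nn_integral_count_space_le:
  fixes f :: "int \<Rightarrow> ennreal"
  assumes "\<And>K. finite K \<Longrightarrow> (\<Sum>j\<in>K. f j) \<le> B"
  shows "(\<integral>\<^sup>+j. f j \<partial>count_space UNIV) \<le> B"
proof -
  let ?K = "\<lambda>n. {- int n..int n}"
  have "(\<integral>\<^sup>+j. f j \<partial>count_space UNIV) = (\<integral>\<^sup>+j. (SUP n. f j * indicator (?K n) j) \<partial>count_space UNIV)"
  proof (intro nn_integral_cong antisym SUP_least)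
    fix j
    show "f j \<le> (SUP n. f j * indicator (?K n) j)"
      by (rule SUP_upper2[of "nat \<bar>j\<bar>"]) (auto simp: indicator_def)
  qed (auto simp: indicator_def)
  also have "\<dots> = (SUP n. \<integral>\<^sup>+j. f j * indicator (?K n) j \<partial>count_space UNIV)"
    by (rule nn_integral_monotone_convergence_SUP) (auto simp: incseq_def le_fun_def indicator_def)
  also have "\<dots> = (SUP n. \<Sum>j\<in>?K n. f j)"
    by (simp add: nn_integral_count_space_indicator[symmetric] nn_integral_count_space_finite)
  also have "\<dots> \<le> B" by (intro SUP_least assms) auto
  finally show ?thesis .
qed

lemma borel_measurable_antimono_ennreal:
  fixes f :: "real \<Rightarrow> ennreal"
  assumes "\<And>x y. x \<le> y \<Longrightarrow> f y \<le> f x"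
  shows "f \<in> borel_measurable borel"
proof (rule borel_measurableI_greater)
  fix a
  have "is_interval {x. a < f x}"
    unfolding is_interval_1 using assms by (auto intro: less_le_trans)
  then show "{x \<in> space borel. a < f x} \<in> sets borel"
    by (simp add: real_interval_borel_measurable)
qed

lemma set_nn_integral_Ioi: "(\<integral>\<^sup>+z\<in>{b<..}. g z \<partial>lebesgue) = (\<integral>\<^sup>+z\<in>{b::real..}. g z \<partial>lebesgue)"
proof (rule nn_integral_cong_AE)
  have "AE z in lebesgue. z \<noteq> b" 
    by (rule AE_I'[of "{b}"]) (auto intro!: null_sets_completionI finite_imp_null_set_lborel)
  then show "AE z in lebesgue. g z * indicator {b<..} z = g z * indicator {b..} z"
    by eventually_elim (auto simp: indicator_def)
qed

lemma kernel_op_cmult: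
  assumes "oinarov_kernel D k" "f \<in> Mplus" "0 \<le> y"
  shows "kernel_op k (\<lambda>z. c * f z) y = c * kernel_op k f y"
proof -
  have "kernel_op k (\<lambda>z. c * f z) y = (\<integral>\<^sup>+z. c * (k z y * f z * indicator {y..} z) \<partial>lebesgue)"
    unfolding kernel_op_def by (simp add: mult_ac)
  also have "\<dots> = c * kernel_op k f y"
    unfolding kernel_op_def using assms
    by (intro nn_integral_cmult Mplus_indicator Mplus_mult kernel_Mplus_right[OF assms(1)]) auto
  finally show ?thesis .
qed

lemma wnorm_cmult:
  assumes "0 < p" "v \<in> Mplus" "f \<in> Mplus"
  shows "wnorm (ennreal p) v (\<lambda>x. c * f x) = c * wnorm (ennreal p) v f"
proof -
  have "(\<integral>\<^sup>+x\<in>{0..}. epow (c * f x) p * v x \<partial>lebesgue) = 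
    (\<integral>\<^sup>+x. epow c p * (epow (f x) p * v x * indicator {0..} x) \<partial>lebesgue)"
    by (simp add: epow_mult mult_ac)
  also have "\<dots> = epow c p * (\<integral>\<^sup>+x\<in>{0..}. epow (f x) p * v x \<partial>lebesgue)"
    using assms by (intro nn_integral_cmult Mplus_indicator Mplus_mult Mplus_epow) auto
  finally show ?thesis using assms(1) by (simp add: wnorm_ennreal epow_mult)
qed

lemma sigma_nonneg: "0 \<le> sigma u x"
  by (auto simp: sigma_def zero_ereal_def intro!: Inf_greatest)

lemma wnorm_on_epow:
  "(if q = \<infinity> then epow (esssup (lebesgue_on A) (\<lambda>y. w y * g y)) r
    else epow (\<integral>\<^sup>+z\<in>A. epow (g z) (enn2real q) * w z \<partial>lebesgue) (r / enn2real q)) = epow (wnorm_on q w A g) r"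
  by (simp add: wnorm_on_def epow_epow mult.commute)

lemma trunc_Mplus: "f \<in> Mplus \<Longrightarrow> (\<lambda>z. f z * indicator {z. ereal z < a} z) \<in> Mplus"
  by (intro Mplus_mult Mplus_ind lebesgue_borelI) measurable

text \<open>Collects 10 * 2^r from \<open>finite_level_sum\<close> and 2^(3/2), the ratio of
  \<open>L (j + 1)\<close> to \<open>L (j - 2)\<close>, from the change of levels in
  \<open>A2_le_case2\<close>.\<close>

definition cA2 :: "real \<Rightarrow> real" where "cA2 r = (2 powr (3/2) * (10 * 2 powr r)) powr (1 / r)"

section \<open>Bounds by \<open>C_S\<close>: the constants \<open>A0\<close> and \<open>A1\<close>,
  and \<open>A2\<close> for p \<le> r\<close>

locale setting = weight u for u +
  fixes p r D :: real and q :: ennreal and v w :: "real \<Rightarrow> ennreal" and k :: "real \<Rightarrow> real \<Rightarrow> ennreal"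
  assumes p: "1 \<le> p" and r: "0 < r" and q: "0 < q" and D: "1 \<le> D"
    and v: "v \<in> Mplus" and w: "w \<in> Mplus" and k: "oinarov_kernel D k"
begin

abbreviation nv :: "(real \<Rightarrow> ennreal) \<Rightarrow> ennreal" where "nv \<equiv> wnorm (ennreal p) v"

abbreviation Sf :: "(real \<Rightarrow> ennreal) \<Rightarrow> real \<Rightarrow> ennreal" where "Sf f x \<equiv> wnorm_on q w {x..} (kernel_op k f)"

abbreviation NS :: "(real \<Rightarrow> ennreal) \<Rightarrow> ennreal" where "NS f \<equiv> wnorm (ennreal r) u (S_op q w k f)"

abbreviation CS :: ennreal where "CS \<equiv> C_S p q r u v w k"

lemma NS_eq: "NS f = epow (\<integral>\<^sup>+x\<in>{0..}. epow (Sf f x) r * u x \<partial>lebesgue) (1 / r)"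
  using r by (simp add: wnorm_ennreal S_op_eq)

lemma CS_eq: "CS = least_const NS nv"
  by (simp add: C_S_def)

lemma Sf_antimono:
  assumes "f \<in> Mplus" "0 \<le> x" "x \<le> y"
  shows "Sf f y \<le> Sf f x"
  using assms by (intro wnorm_on_mono[OF q] kernel_op_Mplus[OF k] w) auto

lemma CS_D: "CS < top \<Longrightarrow> f \<in> Mplus \<Longrightarrow> nv f < top \<Longrightarrow> NS f \<le> CS * nv f"
  unfolding CS_eq by (rule least_constD)

lemma kernel_op_lower1:
  assumes "f \<in> Mplus" "0 \<le> y" "y \<le> b"
  shows "kernel_op k f b \<le> ennreal D * kernel_op k f y"
proof -
  have "kernel_op k f b \<le> kernel_op k (\<lambda>z. ennreal D * f z) y"
    unfolding kernel_op_def
  proof (rule nn_integral_mono)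
    fix z
    show "k z b * f z * indicator {b..} z \<le> k z y * (ennreal D * f z) * indicator {y..} z"
      using kernel_lower1[OF k D assms(2,3), of z] mult_right_mono[of "k z b" "ennreal D * k z y" "f z"] assms(3)
      by (auto simp: indicator_def mult_ac)
  qed
  then show ?thesis using kernel_op_cmult[OF k assms(1,2)] by simp
qed

lemma kernel_op_lower2:
  assumes "f \<in> Mplus" "0 \<le> y" "y \<le> b"
  shows "(\<integral>\<^sup>+z\<in>{b..}. f z \<partial>lebesgue) * k b y \<le> ennreal D * kernel_op k f y"
proof -
  have "(\<integral>\<^sup>+z\<in>{b..}. f z \<partial>lebesgue) * k b y = (\<integral>\<^sup>+z. f z * indicator {b..} z * k b y \<partial>lebesgue)"
    using assms by (intro nn_integral_multc[symmetric] Mplus_indicator) auto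
  also have "\<dots> \<le> kernel_op k (\<lambda>z. ennreal D * f z) y"
    unfolding kernel_op_def
  proof (rule nn_integral_mono)
    fix z
    show "f z * indicator {b..} z * k b y \<le> k z y * (ennreal D * f z) * indicator {y..} z"
      using kernel_lower2[OF k D assms(2,3), of z] mult_right_mono[of "k b y" "ennreal D * k z y" "f z"] assms(3)
      by (auto simp: indicator_def mult_ac)
  qed
  finally show ?thesis using kernel_op_cmult[OF k assms(1,2)] by simp
qed

text \<open>Common to \<open>A0\<close> and \<open>A1\<close>: P b * g b y is one of the two terms
  of the split kernel, integrated against f from b on. The operator dominates it for all y in (x,
  b), and a norm over that interval is at most the one over [x, \<infinity>).\<close>

lemma A_lhs_le:
  assumes f: "f \<in> Mplus" and g: "\<And>b. 0 \<le> b \<Longrightarrow> g b \<in> Mplus"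
    and le: "\<And>b y. 0 \<le> y \<Longrightarrow> y \<le> b \<Longrightarrow> P b * g b y \<le> ennreal D * kernel_op k f y"
  shows "epow (\<integral>\<^sup>+x\<in>{0..}. (if sigma2 u x = \<infinity> then 0 else let b = real_of_ereal (sigma2 u x) in
      u x * epow (wnorm_on q w {x<..<b} (g b)) r * epow (P b) r) \<partial>lebesgue) (1 / r) \<le> ennreal D * NS f"
    (is "epow ?I _ \<le> _")
proof -
  have pt: "(if sigma2 u x = \<infinity> then 0 else let b = real_of_ereal (sigma2 u x) in
      u x * epow (wnorm_on q w {x<..<b} (g b)) r * epow (P b) r) \<le> ennreal (D powr r) * (epow (Sf f x) r * u x)"
    if x: "0 \<le> x" for x
  proof (cases "sigma2 u x = \<infinity>")
    case False
    define b where "b = real_of_ereal (sigma2 u x)"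
    have b: "0 \<le> b" unfolding b_def sigma2_def by (intro real_of_ereal_pos sigma_nonneg)
    have "P b * wnorm_on q w {x<..<b} (g b) = wnorm_on q w {x<..<b} (\<lambda>y. P b * g b y)"
      using x by (intro wnorm_on_cmult[symmetric] q w g[OF b]) auto
    also have "\<dots> \<le> wnorm_on q w {x..} (\<lambda>y. ennreal D * kernel_op k f y)"
      using x by (intro wnorm_on_mono[OF q] w Mplus_mult Mplus_const g[OF b] le) auto
    also have "\<dots> = ennreal D * Sf f x"
      using x by (intro wnorm_on_cmult q w kernel_op_Mplus[OF k f]) auto
    finally have "epow (P b * wnorm_on q w {x<..<b} (g b)) r \<le> epow (ennreal D * Sf f x) r"
      by (rule epow_mono[OF r])
    then have "u x * epow (P b * wnorm_on q w {x<..<b} (g b)) r \<le> u x * epow (ennreal D * Sf f x) r"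
      by (rule mult_left_mono) auto
    then show ?thesis
      using False D by (simp add: b_def[symmetric] Let_def epow_mult epow_ennreal mult_ac)
  qed simp
  have "?I \<le> (\<integral>\<^sup>+x. ennreal (D powr r) * (epow (Sf f x) r * u x * indicator {0..} x) \<partial>lebesgue)"
  proof (intro nn_integral_mono)
    fix x
    show "(if sigma2 u x = \<infinity> then 0 else let b = real_of_ereal (sigma2 u x) in
      u x * epow (wnorm_on q w {x<..<b} (g b)) r * epow (P b) r) * indicator {0..} x \<le> ennreal (D powr r) * (epow (Sf f x) r * u x * indicator {0..} x)"
      using pt[of x] by (cases "0 \<le> x") (simp_all only: indicator_simps atLeast_iff mult_1_right mult_zero_right order_refl simp_thms)
  qed
  also have "\<dots> = ennreal (D powr r) * (\<integral>\<^sup>+x\<in>{0..}. epow (Sf f x) r * u x \<partial>lebesgue)"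
  proof (rule nn_integral_cmult)
    \<comment> \<open>\<open>Sf f\<close> is known to be nonincreasing on [0, \<infinity>) only;
      freezing it to the left of 0 makes measurability of monotone functions applicable.\<close>
    have "(\<lambda>x. Sf f (max 0 x)) \<in> borel_measurable borel"
      by (rule borel_measurable_antimono_ennreal) (intro Sf_antimono f, auto)
    then have "(\<lambda>x. Sf f (max 0 x)) \<in> Mplus"
      unfolding Mplus_def by (auto intro!: measurable_restrict_space1 measurable_completion)
    then have "(\<lambda>x. epow (Sf f (max 0 x)) r * u x * indicator {0..} x) \<in> borel_measurable lebesgue"
      by (intro Mplus_indicator Mplus_mult Mplus_epow u) auto
    also have "(\<lambda>x. epow (Sf f (max 0 x)) r * u x * indicator {0..} x) = (\<lambda>x. epow (Sf f x) r * u x * indicator {0..} x)"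
      by (auto simp: indicator_def)
    finally show "(\<lambda>x. epow (Sf f x) r * u x * indicator {0..} x) \<in> borel_measurable lebesgue" .
  qed
  finally have "epow ?I (1 / r) \<le> epow (ennreal (D powr r) * (\<integral>\<^sup>+x\<in>{0..}. epow (Sf f x) r * u x \<partial>lebesgue)) (1 / r)"
    by (rule epow_mono[rotated]) (use r in auto)
  also have "\<dots> = ennreal D * NS f"
    using D r unfolding NS_eq by (simp add: epow_mult epow_ennreal powr_powr)
  finally show ?thesis .
qed

lemma A0_lhs_eq:
  "A0_lhs q r u w k f = epow (\<integral>\<^sup>+x\<in>{0..}. (if sigma2 u x = \<infinity> then 0 else let b = real_of_ereal (sigma2 u x) in
      u x * epow (wnorm_on q w {x<..<b} (\<lambda>y. 1)) r * epow (kernel_op k f b) r) \<partial>lebesgue) (1 / r)"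
  unfolding A0_lhs_def set_nn_integral_Ioi kernel_op_def wnorm_on_epow[symmetric] by (simp cong: if_cong add: Let_def)

lemma A1_lhs_eq:
  "A1_lhs q r u w k f = epow (\<integral>\<^sup>+x\<in>{0..}. (if sigma2 u x = \<infinity> then 0 else let b = real_of_ereal (sigma2 u x) in
      u x * epow (wnorm_on q w {x<..<b} (k b)) r * epow (\<integral>\<^sup>+z\<in>{b..}. f z \<partial>lebesgue) r) \<partial>lebesgue) (1 / r)"
  unfolding A1_lhs_def set_nn_integral_Ioi wnorm_on_epow[symmetric] by simp

lemma A0_le: "A0 p q r u v w k \<le> ennreal D * CS"
  unfolding A0_def CS_eq A0_lhs_eq using D kernel_op_lower1
  by (intro least_const_le_mult A_lhs_le[where g="\<lambda>b y. 1"]) (auto intro: Mplus_const)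

lemma A1_le: "A1 p q r u v w k \<le> ennreal D * CS"
  unfolding A1_def CS_eq A1_lhs_eq using D kernel_op_lower2
  by (intro least_const_le_mult A_lhs_le[where g="k"]) (auto intro: kernel_Mplus_left[OF k])

lemma wnorm_Hstar_from: "0 \<le> t \<Longrightarrow> f \<in> Mplus \<Longrightarrow> wnorm q w (Hstar_from k t f) = Sf f t"
  unfolding Hstar_from_eq by (intro wnorm_indicator w kernel_op_Mplus[OF k]) auto

text \<open>As \<open>Sf f\<close> is nonincreasing, it is at least \<open>Sf f t\<close> on [0, t],
  where u has mass U t.\<close>

lemma opnorm_from_le:
  assumes "0 < t"
  shows "epow (cumul u t) (1 / r) * opnorm (ennreal p) v q w (Hstar_from k t) \<le> CS"
proof (cases "U t = 0")
  case True
  then show ?thesis by (simp add: cumul_eq)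
next
  case False
  then have Ut: "0 < U t" using U_nonneg[of t] by linarith
  define a where "a = U t powr (1 / r)"
  have a: "0 < a" using Ut by (simp add: a_def)
  have Sf_le: "Sf f t \<le> ennreal (1 / a) * NS f" if f: "f \<in> Mplus" for f
  proof -
    have "epow (Sf f t) r * cumul u t = (\<integral>\<^sup>+x. epow (Sf f t) r * (u x * indicator {0..t} x) \<partial>lebesgue)"
      unfolding cumul_def by (intro nn_integral_cmult[symmetric] Mplus_indicator u) auto
    also have "\<dots> \<le> (\<integral>\<^sup>+x\<in>{0..}. epow (Sf f x) r * u x \<partial>lebesgue)"
      by (intro nn_integral_mono) (auto simp: indicator_def intro!: mult_right_mono epow_mono[OF r] Sf_antimono f)
    finally have "epow (epow (Sf f t) r * cumul u t) (1 / r) \<le> NS f"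
      unfolding NS_eq by (rule epow_mono[rotated]) (use r in auto)
    then have "Sf f t * ennreal a \<le> NS f"
      using r by (simp add: epow_mult cumul_eq epow_ennreal a_def)
    then have "ennreal (1 / a) * (Sf f t * ennreal a) \<le> ennreal (1 / a) * NS f"
      by (rule mult_left_mono) auto
    moreover have "ennreal (1 / a) * (Sf f t * ennreal a) = (ennreal (1 / a) * ennreal a) * Sf f t"
      by (simp only: mult_ac)
    moreover have "ennreal (1 / a) * ennreal a = 1" using a by (simp flip: ennreal_mult)
    ultimately show ?thesis by simp
  qed
  have "opnorm (ennreal p) v q w (Hstar_from k t) \<le> ennreal (1 / a) * CS"
    unfolding opnorm_def CS_eq using a assms by (intro least_const_le_mult) (auto simp: wnorm_Hstar_from Sf_le)
  then have "ennreal a * opnorm (ennreal p) v q w (Hstar_from k t) \<le> ennreal a * (ennreal (1 / a) * CS)"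
    by (rule mult_left_mono) auto
  also have "\<dots> = (ennreal a * ennreal (1 / a)) * CS" by (simp only: mult_ac)
  also have "ennreal a * ennreal (1 / a) = 1" using a by (simp flip: ennreal_mult)
  finally show ?thesis by (simp add: cumul_eq epow_ennreal a_def)
qed

lemma A2_le_case1:
  assumes "p \<le> r"
  shows "A2 p q r u v w k \<le> CS"
  unfolding A2_def using assms opnorm_from_le by (auto intro!: SUP_least)

text \<open>The upper limit of integration becomes a truncation of f, so that the operator is again
  \<open>kernel_op\<close>.\<close>

lemma wnorm_Hstar_between:
  assumes "0 \<le> c" "f \<in> Mplus"
  shows "wnorm q w (Hstar_between u k c d f) = 
    wnorm_on q w {y. c \<le> y \<and> ereal y < d} (kernel_op k (\<lambda>z. f z * indicator {z. ereal z < sigma u d} z))"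
proof -
  let ?B = "{y. c \<le> y \<and> ereal y < d}" and ?f = "\<lambda>z. f z * indicator {z. ereal z < sigma u d} z"
  have B: "?B \<in> sets borel" by measurable
  have "Hstar_between u k c d f = (\<lambda>y. indicator ?B y * kernel_op k ?f y)"
  proof
    fix y
    have "(\<integral>\<^sup>+z\<in>{z. y \<le> z \<and> ereal z < sigma u d}. k z y * f z \<partial>lebesgue) = kernel_op k ?f y"
      unfolding kernel_op_def by (intro nn_integral_cong) (auto simp: indicator_def)
    then show "Hstar_between u k c d f y = indicator ?B y * kernel_op k ?f y"
      by (simp add: Hstar_between_def)
  qed
  then show ?thesis
    using B assms by (simp add: wnorm_indicator w kernel_op_Mplus[OF k trunc_Mplus] subset_eq)
qed

lemma Hstar_between_le:
  assumes "0 \<le> t" "t \<le> c" "f \<in> Mplus"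
  shows "wnorm q w (Hstar_between u k c d f) \<le> Sf f t"
proof -
  have B: "{y. c \<le> y \<and> ereal y < d} \<in> sets borel" by measurable
  have "wnorm_on q w {y. c \<le> y \<and> ereal y < d} (kernel_op k (\<lambda>z. f z * indicator {z. ereal z < sigma u d} z)) \<le> Sf f t"
    using assms B by (intro wnorm_on_mono[OF q] w kernel_op_Mplus[OF k trunc_Mplus] kernel_op_mono) (auto simp: indicator_def)
  then show ?thesis using assms by (simp add: wnorm_Hstar_between)
qed

end

section \<open>The bound for \<open>A2\<close> by \<open>C_S\<close> when r < p\<close>

locale pos_setting = setting u p r D q v w k + pos_weight u y0 for u p r D q v w k y0
begin

definition xr :: "int \<Rightarrow> real" where "xr j = real_of_ereal (X (L j))"

lemma xr: "X (L j) \<noteq> \<infinity> \<Longrightarrow> X (L j) = ereal (xr j) \<and> U (xr j) = L j \<and> 0 < xr j"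
  unfolding xr_def by (rule X_cases[OF L_pos[of j]]) auto

lemma X_infinity_mono: "X (L i) = \<infinity> \<Longrightarrow> i \<le> j \<Longrightarrow> X (L j) = \<infinity>"
  using X_mono[of "L i" "L j"] by simp

text \<open>The term of index j + n is compared with points x of the lower set \<open>E j\<close>,
  so that \<open>E (j + n)\<close> can lie between x and \<open>sigma2 u x\<close>. Raising the
  level by at most two steps costs a factor 2, and 10 = 2 * 5.\<close>

lemma level_sum_shift:
  assumes n: "n \<in> {0..2}" and le: "\<And>j x. x \<in> E j \<Longrightarrow> e (j + n) * u x \<le> g x"
    and "\<And>j. X (L j) = \<infinity> \<Longrightarrow> e j = 0"
  shows "(\<integral>\<^sup>+j. ennreal (L j) * e j \<partial>count_space UNIV) \<le> 10 * (\<integral>\<^sup>+x\<in>{0..}. g x \<partial>lebesgue)"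
proof -
  have "(\<integral>\<^sup>+j. ennreal (L j) * e j \<partial>count_space UNIV) = (\<integral>\<^sup>+j. ennreal (L (j + n)) * e (j + n) \<partial>count_space UNIV)"
    by (rule nn_integral_count_space_shift[symmetric])
  also have "\<dots> \<le> (\<integral>\<^sup>+j. 2 * (ennreal (L j) * e (j + n)) \<partial>count_space UNIV)"
  proof (rule nn_integral_mono)
    fix j
    have "L (j + n) \<le> 2 * L j" unfolding L_add2[symmetric] using n by simp
    then have "ennreal (L (j + n)) \<le> 2 * ennreal (L j)"
      using ennreal_leI[of "L (j + n)" "2 * L j"] by (simp add: ennreal_mult)
    from mult_right_mono[OF this, of "e (j + n)"]
    show "ennreal (L (j + n)) * e (j + n) \<le> 2 * (ennreal (L j) * e (j + n))" by (simp add: mult.assoc)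
  qed
  also have "\<dots> = 2 * (\<integral>\<^sup>+j. ennreal (L j) * e (j + n) \<partial>count_space UNIV)"
    by (simp add: nn_integral_cmult)
  also have "\<dots> \<le> 2 * (5 * (\<integral>\<^sup>+x\<in>{0..}. g x \<partial>lebesgue))"
  proof (intro mult_left_mono level_sum_le_integral le assms(3))
    fix j assume "X (L j) = \<infinity>"
    then show "X (L (j + n)) = \<infinity>" using X_infinity_mono[of j "j + n"] n by simp
  qed auto
  finally show ?thesis by (simp add: mult.assoc[symmetric])
qed

text \<open>\<open>xr (j + 1)\<close> is not to the left of any point of \<open>E j\<close>, so the
  value of \<phi> there is below its values on \<open>E j\<close>.\<close>

lemma antimono_level_sum:
  assumes "\<And>x y. 0 \<le> x \<Longrightarrow> x \<le> y \<Longrightarrow> \<phi> y \<le> \<phi> x"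
  shows "(\<integral>\<^sup>+j. ennreal (L j) * (if X (L j) = \<infinity> then 0 else \<phi> (xr j)) \<partial>count_space UNIV) \<le> 10 * (\<integral>\<^sup>+x\<in>{0..}. \<phi> x * u x \<partial>lebesgue)"
proof (rule level_sum_shift[of 1])
  fix j x assume x: "x \<in> E j"
  show "(if X (L (j + 1)) = \<infinity> then 0 else \<phi> (xr (j + 1))) * u x \<le> \<phi> x * u x"
  proof (cases "X (L (j + 1)) = \<infinity>")
    case False
    have "ereal x \<le> X (L (j + 1))" using x le_X_iff[of "L (j + 1)"] by (auto simp: E_def)
    then have "x \<le> xr (j + 1)" using xr[OF False] by simp
    then show ?thesis using False assms E_pos[OF x] by (auto intro!: mult_right_mono)
  qed simp
qed auto

definition Hn :: "int \<Rightarrow> ennreal" where "Hn j = opnorm (ennreal p) v q w (Hstar_from k (xr j))"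

lemma Hn_bound:
  assumes "X (L j) \<noteq> \<infinity>"
  shows "epow (ennreal (L j)) (1 / r) * Hn j \<le> CS"
  using opnorm_from_le[of "xr j"] xr[OF assms] by (simp add: Hn_def cumul_eq)

lemma Hn_finite:
  assumes "X (L j) \<noteq> \<infinity>" "CS < top"
  shows "Hn j < top"
proof (rule ccontr)
  assume "\<not> Hn j < top"
  then have "epow (ennreal (L j)) (1 / r) * Hn j = top"
    using less_imp_neq[OF L_pos[of j]] by (simp add: less_top[symmetric] ennreal_mult_top epow_ennreal)
  then show False using Hn_bound[OF assms(1)] assms(2) by (simp add: top_unique)
qed

text \<open>Take f that does better than half of \<open>Hn j\<close> and normalise it. Its norm is
  finite by the strict inequality, and nonzero because \<open>Hn j\<close> is finite.\<close>

lemma test_function: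
  assumes "X (L j) \<noteq> \<infinity>" "CS < top"
  obtains g where "g \<in> Mplus" "nv g \<le> 1" "Hn j \<le> 2 * Sf g (xr j)"
proof (cases "Hn j = 0")
  case True
  have "nv (\<lambda>x. 0) = 0" using p by (simp add: wnorm_ennreal)
  then show ?thesis using that[of "\<lambda>x. 0"] True by (simp add: Mplus_const)
next
  case False
  have Hfin: "Hn j < top" by (rule Hn_finite[OF assms])
  then obtain h where h: "Hn j = ennreal h" "0 < h"
    using False by (cases "Hn j") (auto simp: less_le)
  have xj: "0 \<le> xr j" using xr[OF assms(1)] by simp
  have Heq: "Hn j = least_const (\<lambda>f. wnorm q w (Hstar_from k (xr j) f)) nv"
    by (simp add: Hn_def opnorm_def)
  have "ennreal (h / 2) < least_const (\<lambda>f. wnorm q w (Hstar_from k (xr j) f)) nv"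
    unfolding Heq[symmetric] h using h by (simp add: ennreal_less_iff)
  then obtain f where f: "f \<in> Mplus" and "ennreal (h / 2) * nv f < wnorm q w (Hstar_from k (xr j) f)"
    by (rule less_least_constE)
  then have fN: "ennreal (h / 2) * nv f < Sf f (xr j)" by (simp add: wnorm_Hstar_from[OF xj])
  have fin: "nv f < top"
    using fN h by (auto simp: less_top[symmetric] ennreal_mult_top)
  have "wnorm q w (Hstar_from k (xr j) f) \<le> Hn j * nv f"
    using Hfin f fin unfolding Heq by (intro least_constD) auto
  then have "Sf f (xr j) \<le> Hn j * nv f" by (simp add: wnorm_Hstar_from[OF xj f])
  then have "nv f \<noteq> 0" using fN by auto
  with fin obtain m where m: "nv f = ennreal m" "0 < m"
    by (cases "nv f") (auto simp: less_le)
  define g where "g = (\<lambda>x. ennreal (1 / m) * f x)"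
  have g: "g \<in> Mplus" unfolding g_def by (intro Mplus_mult Mplus_const f)
  have "nv g = ennreal (1 / m) * nv f" unfolding g_def using p v f by (intro wnorm_cmult) auto
  also have "\<dots> = 1" using m by (simp flip: ennreal_mult)
  finally have "nv g \<le> 1" by simp
  moreover have "Hn j \<le> 2 * Sf g (xr j)"
  proof -
    have "wnorm_on q w {xr j..} (\<lambda>y. ennreal (1 / m) * kernel_op k f y) \<le> wnorm_on q w {xr j..} (kernel_op k g)"
      using xj by (intro wnorm_on_mono[OF q] w Mplus_mult Mplus_const kernel_op_Mplus[OF k f]) (auto simp: g_def kernel_op_cmult[OF k f])
    then have *: "ennreal (1 / m) * Sf f (xr j) \<le> Sf g (xr j)"
      using xj by (subst (asm) wnorm_on_cmult[OF q]) (auto intro!: w kernel_op_Mplus[OF k f])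
    have "Hn j = 2 * (ennreal (1 / m) * (ennreal (h / 2) * nv f))"
      using m h by (simp add: ennreal_mult[symmetric] flip: ennreal_numeral)
    also have "\<dots> \<le> 2 * (ennreal (1 / m) * Sf f (xr j))"
      using fN by (intro mult_left_mono) auto
    also have "\<dots> \<le> 2 * Sf g (xr j)" using * by (intro mult_left_mono) auto
    finally show ?thesis .
  qed
  ultimately show ?thesis using that g by blast
qed

lemma s_exp_facts:
  assumes "r < p"
  shows "0 < s_exp p r" "s_exp p r / r = 1 + s_exp p r / p" "r + s_exp p r / p * r = s_exp p r" "1 = r / p + r / s_exp p r"
proof -
  have "1 / p < 1 / r" using assms r by (intro divide_strict_left_mono) auto
  then have s: "1 / s_exp p r = 1 / r - 1 / p" and "0 < s_exp p r" by (auto simp: s_exp_def)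
  then show "0 < s_exp p r" by simp
  define s where "s = s_exp p r"
  have s0: "0 < s" "1 / s = 1 / r - 1 / p" using s \<open>0 < s_exp p r\<close> by (auto simp: s_def)
  then have *: "1 / r = 1 / s + 1 / p" by simp
  have "s * (1 / r) = s * (1 / s + 1 / p)" unfolding * by simp
  also have "\<dots> = 1 + s / p" using s0(1) by (simp add: distrib_left)
  finally have A: "s / r = 1 + s / p" by simp
  then show "s_exp p r / r = 1 + s_exp p r / p" by (simp add: s_def)
  have "r * (s / r) = r * (1 + s / p)" using A by simp
  then have B: "s = r + s / p * r" using r by (simp add: distrib_left mult.commute)
  then show "r + s_exp p r / p * r = s_exp p r" by (simp add: s_def)
  have "s / s = (r + s / p * r) / s" using B by simp
  also have "\<dots> = r / s + r / p" using s0 by (simp add: add_divide_distrib)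
  finally show "1 = r / p + r / s_exp p r" using s0 by (simp add: s_def)
qed

text \<open>The pieces of the test function are glued together by a maximum rather than a sum:
  \<open>S\<close> of the maximum still dominates \<open>S\<close> of every piece, and overlaps of the pieces do no harm to the
  \<open>L\<^sup>p\<close> norm.\<close>

lemma finite_level_sum:
  assumes rp: "r < p" and CS: "CS < top" and K: "finite K" "\<And>j. j \<in> K \<Longrightarrow> X (L j) \<noteq> \<infinity>"
  shows "(\<Sum>j\<in>K. epow (ennreal (L j)) (s_exp p r / r) * epow (Hn j) (s_exp p r)) 
    \<le> epow (ennreal (10 * 2 powr r) * epow CS r) (s_exp p r / r)"
    (is "?T \<le> _")
proof -
  define s where "s = s_exp p r"
  note s = s_exp_facts[OF rp, folded s_def]
  define t where "t = (\<lambda>j. epow (ennreal (L j)) (s / r) * epow (Hn j) s)"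
  have T: "?T = sum t K" by (simp add: t_def s_def)
  have "\<forall>j\<in>K. \<exists>g. g \<in> Mplus \<and> nv g \<le> 1 \<and> Hn j \<le> 2 * Sf g (xr j)"
    using K(2) test_function[OF _ CS] by metis
  then obtain g where g: "\<And>j. j \<in> K \<Longrightarrow> g j \<in> Mplus" "\<And>j. j \<in> K \<Longrightarrow> nv (g j) \<le> 1" 
      "\<And>j. j \<in> K \<Longrightarrow> Hn j \<le> 2 * Sf (g j) (xr j)"
    by metis
  \<comment> \<open>The equality case of Hoelder's inequality: with these weights, both the p-th
    power of a j and \<open>L j\<close> times the r-th power of a j * \<open>Hn j\<close> are equal
    to t j.\<close>
  define a where "a = (\<lambda>j. epow (ennreal (L j)) (s / (r * p)) * epow (Hn j) (s / p))"
  have ap: "epow (a j) p = t j" for j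
    using p by (simp add: a_def t_def epow_mult epow_epow)
  have tfin: "t j < top" if "j \<in> K" for j
    using Hn_finite[OF K(2)[OF that] CS] by (simp add: t_def ennreal_mult_less_top)
  then have Tfin: "sum t K < top" using K by simp
  define f where "f = (\<lambda>x. SUP j\<in>K. a j * g j x)"
  have ag: "(\<lambda>x. a j * g j x) \<in> Mplus" if "j \<in> K" for j
    by (intro Mplus_mult Mplus_const g that)
  have f: "f \<in> Mplus" unfolding f_def by (intro Mplus_SUP K ag)
  have p0: "0 < p" using p by simp
  have nvf: "nv f \<le> epow (sum t K) (1 / p)"
  proof -
    have "(\<integral>\<^sup>+x\<in>{0..}. epow (f x) p * v x \<partial>lebesgue) \<le> 
      (\<integral>\<^sup>+x. (\<Sum>j\<in>K. epow (a j * g j x) p * v x * indicator {0..} x) \<partial>lebesgue)"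
    proof (rule nn_integral_mono)
      fix x
      have "epow (f x) p \<le> (\<Sum>j\<in>K. epow (a j * g j x) p)"
        unfolding f_def epow_SUP[OF p0] using K(1) by (auto intro!: SUP_least member_le_sum)
      then have "epow (f x) p * (v x * indicator {0..} x) \<le> (\<Sum>j\<in>K. epow (a j * g j x) p) * (v x * indicator {0..} x)"
        by (rule mult_right_mono) auto
      then show "epow (f x) p * v x * indicator {0..} x \<le> (\<Sum>j\<in>K. epow (a j * g j x) p * v x * indicator {0..} x)"
        by (simp add: sum_distrib_right mult.assoc)
    qed
    also have "\<dots> = (\<Sum>j\<in>K. (\<integral>\<^sup>+x\<in>{0..}. epow (a j * g j x) p * v x \<partial>lebesgue))"
      by (intro nn_integral_sum Mplus_indicator Mplus_mult[OF Mplus_epow] ag v) auto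
    also have "\<dots> = (\<Sum>j\<in>K. epow (nv (\<lambda>x. a j * g j x)) p)"
      using p0 by (simp add: wnorm_ennreal)
    also have "\<dots> \<le> (\<Sum>j\<in>K. t j)"
    proof (rule sum_mono)
      fix j assume j: "j \<in> K"
      have "epow (nv (\<lambda>x. a j * g j x)) p = t j * epow (nv (g j)) p"
        using wnorm_cmult[OF p0 v g(1)[OF j]] by (simp add: epow_mult ap)
      also have "\<dots> \<le> t j * epow 1 p" using g(2)[OF j] p0 by (intro mult_left_mono epow_mono) auto
      finally show "epow (nv (\<lambda>x. a j * g j x)) p \<le> t j" by simp
    qed
    finally show ?thesis using p0 unfolding wnorm_ennreal[OF p0] by (intro epow_mono) auto
  qed
  then have nvfin: "nv f < top" using Tfin by (auto intro: le_less_trans)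
  have tS: "t j \<le> ennreal (2 powr r) * (ennreal (L j) * epow (Sf f (xr j)) r)" if j: "j \<in> K" for j
  proof -
    have xj: "0 \<le> xr j" using xr[OF K(2)[OF j]] by simp
    have "a j * Hn j \<le> a j * (2 * Sf (g j) (xr j))" by (intro mult_left_mono g j) auto
    also have "\<dots> = 2 * wnorm_on q w {xr j..} (\<lambda>y. a j * kernel_op k (g j) y)"
      using xj by (subst wnorm_on_cmult[OF q _ _ w kernel_op_Mplus[OF k g(1)[OF j]]]) (auto simp: mult_ac)
    also have "\<dots> \<le> 2 * Sf f (xr j)"
    proof (intro mult_left_mono wnorm_on_mono[OF q] w Mplus_mult Mplus_const kernel_op_Mplus[OF k] g j)
      fix y assume "y \<in> {xr j..}"
      then have "a j * kernel_op k (g j) y = kernel_op k (\<lambda>z. a j * g j z) y"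
        using xj by (intro kernel_op_cmult[symmetric, OF k g(1)[OF j]]) auto
      also have "\<dots> \<le> kernel_op k f y"
        unfolding f_def using j by (intro kernel_op_mono SUP_upper)
      finally show "a j * kernel_op k (g j) y \<le> kernel_op k f y" .
    qed (use xj in auto)
    finally have "epow (a j * Hn j) r \<le> epow (2 * Sf f (xr j)) r" by (rule epow_mono[OF r])
    then have "ennreal (L j) * epow (a j * Hn j) r \<le> ennreal (L j) * epow (2 * Sf f (xr j)) r"
      by (rule mult_left_mono) auto
    moreover have "ennreal (L j) * epow (a j * Hn j) r = t j"
    proof -
      have "s / (r * p) * r = s / p" using r by simp
      then have "ennreal (L j) * epow (a j * Hn j) r = 
        (epow (ennreal (L j)) 1 * epow (ennreal (L j)) (s / p)) * (epow (Hn j) (s / p * r) * epow (Hn j) r)"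
        by (simp add: a_def epow_mult epow_epow mult_ac)
      also have "\<dots> = t j"
        unfolding epow_add_exp[symmetric] using s by (simp add: t_def add.commute)
      finally show ?thesis .
    qed
    moreover have "epow (2 * Sf f (xr j)) r = ennreal (2 powr r) * epow (Sf f (xr j)) r"
      using epow_ennreal[of 2 r] by (simp add: epow_mult)
    ultimately show ?thesis by (simp add: mult_ac)
  qed
  have "sum t K \<le> (\<Sum>j\<in>K. ennreal (2 powr r) * (ennreal (L j) * epow (Sf f (xr j)) r))"
    by (rule sum_mono[OF tS])
  also have "\<dots> = ennreal (2 powr r) * (\<Sum>j\<in>K. ennreal (L j) * epow (Sf f (xr j)) r)"
    by (simp add: sum_distrib_left)
  finally have sum_t: "sum t K \<le> ennreal (2 powr r) * (\<Sum>j\<in>K. ennreal (L j) * epow (Sf f (xr j)) r)" .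
  have "(\<Sum>j\<in>K. ennreal (L j) * epow (Sf f (xr j)) r) = 
     (\<integral>\<^sup>+j\<in>K. ennreal (L j) * epow (Sf f (xr j)) r \<partial>count_space UNIV)"
    using K(1) by (simp add: nn_integral_count_space_indicator[symmetric] nn_integral_count_space_finite)
  also have "\<dots> \<le> (\<integral>\<^sup>+j. ennreal (L j) * (if X (L j) = \<infinity> then 0 else epow (Sf f (xr j)) r) \<partial>count_space UNIV)"
    using K(2) by (intro nn_integral_mono) (auto simp: indicator_def)
  also have "\<dots> \<le> 10 * (\<integral>\<^sup>+x\<in>{0..}. epow (Sf f x) r * u x \<partial>lebesgue)"
    by (intro antimono_level_sum[of "\<lambda>x. epow (Sf f x) r"] epow_mono[OF r] Sf_antimono f)
  also have "\<dots> = 10 * epow (NS f) r" using r by (simp add: NS_eq)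
  also have "\<dots> \<le> 10 * epow (CS * epow (sum t K) (1 / p)) r"
    using CS_D[OF CS f nvfin] mult_left_mono[OF nvf, of CS] by (intro mult_left_mono epow_mono[OF r]) (auto intro: order_trans)
  finally have "ennreal (2 powr r) * (\<Sum>j\<in>K. ennreal (L j) * epow (Sf f (xr j)) r) \<le>
      ennreal (2 powr r) * (10 * epow (CS * epow (sum t K) (1 / p)) r)"
    by (rule mult_left_mono) auto
  with sum_t have "sum t K \<le> ennreal (2 powr r) * (10 * epow (CS * epow (sum t K) (1 / p)) r)"
    by (rule order_trans)
  then have main: "sum t K \<le> (ennreal (10 * 2 powr r) * epow CS r) * epow (sum t K) (r / p)"
    by (simp add: epow_mult epow_epow ennreal_mult mult_ac)
  \<comment> \<open>A positive sum T is finite by \<open>Tfin\<close>, so \<open>main\<close> can be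
    divided by the power r / p of T. There remains T to the power 1 - r / p = r / s.\<close>
  show ?thesis
  proof (cases "sum t K = 0")
    case True
    then show ?thesis unfolding T by simp
  next
    case False
    then obtain T where T': "sum t K = ennreal T" "0 < T" using Tfin by (cases "sum t K") (auto simp: less_le)
    have "epow (ennreal T) (r / s) = ennreal (T powr (- (r / p))) * sum t K"
    proof -
      have "r / s = - (r / p) + 1" using s(4) by simp
      then have "T powr (r / s) = T powr (- (r / p) + 1)" by (simp only:)
      also have "\<dots> = T powr (- (r / p)) * T" unfolding powr_add using T' by simp
      finally show ?thesis using T' by (simp add: epow_ennreal ennreal_mult)
    qed
    also have "\<dots> \<le> ennreal (T powr (- (r / p))) * ((ennreal (10 * 2 powr r) * epow CS r) * epow (sum t K) (r / p))"
      by (rule mult_left_mono[OF main]) auto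
    also have "\<dots> = (ennreal (T powr (- (r / p))) * ennreal (T powr (r / p))) * (ennreal (10 * 2 powr r) * epow CS r)"
      using T' by (simp add: epow_ennreal mult_ac)
    also have "ennreal (T powr (- (r / p))) * ennreal (T powr (r / p)) = 1"
      using T' by (simp add: powr_add[symmetric] flip: ennreal_mult)
    finally have "epow (ennreal T) (r / s) \<le> ennreal (10 * 2 powr r) * epow CS r" by simp
    then have "ennreal T \<le> epow (ennreal (10 * 2 powr r) * epow CS r) (s / r)"
      using r s by (subst (asm) epow_le_iff) auto
    then show ?thesis using T T' by (simp add: s_def)
  qed
qed

lemma A2_le_case2:
  assumes rp: "r < p"
  shows "A2 p q r u v w k \<le> ennreal (cA2 r) * CS"
proof (cases "CS < top")
  case False
  have "0 < cA2 r" by (simp add: cA2_def)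
  then show ?thesis using False by (simp add: less_top[symmetric] ennreal_mult_top)
next
  case CS: True
  define s where "s = s_exp p r"
  note s = s_exp_facts[OF rp, folded s_def]
  define t where "t = (\<lambda>j. if X (L j) = \<infinity> then 0 else epow (ennreal (L j)) (s / r) * epow (Hn j) s)"
  define B where "B = epow (ennreal (10 * 2 powr r) * epow CS r) (s / r)"
  have tB: "(\<integral>\<^sup>+j. t j \<partial>count_space UNIV) \<le> B"
  proof (rule nn_integral_count_space_le)
    fix K :: "int set" assume K: "finite K"
    have "sum t K = (\<Sum>j\<in>{j\<in>K. X (L j) \<noteq> \<infinity>}. epow (ennreal (L j)) (s / r) * epow (Hn j) s)"
      using K by (intro sum.mono_neutral_cong_right) (auto simp: t_def)
    also have "\<dots> \<le> B"
      unfolding B_def s_def using K by (intro finite_level_sum rp CS) auto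
    finally show "sum t K \<le> B" .
  qed
  define c where "c = (\<lambda>j. if X (L j) = \<infinity> then 0 else epow (ennreal (L (j + 1))) (s / p) * epow (Hn (j - 2)) s)"
  define op where "op = (\<lambda>x. opnorm (ennreal p) v q w (Hstar_between u k (sigma_inv u x) (sigma u (ereal x))))"
  define G where "G = (\<lambda>x. if cumul u x = 0 then 0 else epow (cumul u x) (s / p) * epow (op x) s)"
  have A2: "A2 p q r u v w k = epow (\<integral>\<^sup>+x\<in>{0..}. G x * u x \<partial>lebesgue) (1 / s)"
  proof -
    have "(\<integral>\<^sup>+x\<in>{0..}. (if cumul u x = 0 then 0 else u x * epow (cumul u x) (s / p) * epow (op x) s) \<partial>lebesgue) =
       (\<integral>\<^sup>+x\<in>{0..}. G x * u x \<partial>lebesgue)"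
      by (intro nn_integral_cong) (simp add: G_def mult_ac)
    then show ?thesis using rp unfolding A2_def s_def op_def Let_def by simp
  qed
  have "(\<integral>\<^sup>+x\<in>{0..}. G x * u x \<partial>lebesgue) \<le> (\<integral>\<^sup>+j. ennreal (L (j + 1)) * c j \<partial>count_space UNIV)"
  proof (rule integral_le_level_sum)
    fix j x assume x: "x \<in> E j"
    then have Xj: "X (L j) \<noteq> \<infinity>" using X_infinity by auto
    then have Xj2: "X (L (j - 2)) \<noteq> \<infinity>" using X_infinity_mono[of "j - 2" j] by auto
    have "op x \<le> Hn (j - 2)"
      unfolding op_def Hn_def opnorm_def
    proof (rule least_const_mono)
      fix f assume f: "f \<in> Mplus"
      \<comment> \<open>The interval of \<open>Hstar_between\<close> starts at or to the right of
        \<open>xr (j - 2)\<close>, so the one-sided operator from that point dominates.\<close>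
      have "xr (j - 2) \<le> sigma_inv u x" using sigma_inv_E(1)[OF x] xr[OF Xj2] by simp
      then show "wnorm q w (Hstar_between u k (sigma_inv u x) (sigma u (ereal x)) f) \<le> wnorm q w (Hstar_from k (xr (j - 2)) f)"
        using xr[OF Xj2] f by (simp add: wnorm_Hstar_from Hstar_between_le)
    qed
    moreover have "cumul u x \<le> ennreal (L (j + 1))" using x by (auto simp: E_def cumul_eq intro: ennreal_leI)
    moreover have "0 < s / p" using s p by simp
    ultimately show "G x \<le> c j"
      using Xj s by (auto simp: G_def c_def intro!: mult_mono epow_mono)
  qed
  also have "\<dots> \<le> (\<integral>\<^sup>+j. epow (ennreal (2 powr (3/2))) (s / r) * t (j - 2) \<partial>count_space UNIV)"
  proof (rule nn_integral_mono)
    fix j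
    show "ennreal (L (j + 1)) * c j \<le> epow (ennreal (2 powr (3/2))) (s / r) * t (j - 2)"
    proof (cases "X (L j) = \<infinity>")
      case False
      then have Xj2: "X (L (j - 2)) \<noteq> \<infinity>" using X_infinity_mono[of "j - 2" j] by auto
      have L3: "L (j + 1) = 2 powr (3/2) * L (j - 2)" using L_add[of "j - 2" 3] by (simp add: algebra_simps)
      have "ennreal (L (j + 1)) * c j = epow (ennreal (L (j + 1))) (1 + s / p) * epow (Hn (j - 2)) s"
        unfolding epow_add_exp using False by (simp add: c_def mult.assoc)
      also have "\<dots> = epow (ennreal (2 powr (3/2))) (s / r) * t (j - 2)"
        unfolding s(2)[symmetric] L3 using Xj2 by (simp add: ennreal_mult epow_mult t_def mult.assoc)
      finally show ?thesis by simp
    qed (simp add: c_def)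
  qed
  also have "\<dots> = epow (ennreal (2 powr (3/2))) (s / r) * (\<integral>\<^sup>+j. t (j - 2) \<partial>count_space UNIV)"
    by (simp add: nn_integral_cmult)
  also have "(\<integral>\<^sup>+j. t (j - 2) \<partial>count_space UNIV) = (\<integral>\<^sup>+j. t j \<partial>count_space UNIV)"
    using nn_integral_count_space_shift[of t "-2"] by simp
  also have "epow (ennreal (2 powr (3/2))) (s / r) * (\<integral>\<^sup>+j. t j \<partial>count_space UNIV) \<le> epow (ennreal (2 powr (3/2))) (s / r) * B"
    by (rule mult_left_mono[OF tB]) simp
  finally have "A2 p q r u v w k \<le> epow (epow (ennreal (2 powr (3/2))) (s / r) * B) (1 / s)"
    unfolding A2 by (rule epow_mono[rotated]) (use s in auto)
  also have "\<dots> = ennreal (cA2 r) * CS"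
  proof -
    have e: "s / r * (1 / s) = 1 / r" using s(1) by simp
    have "ennreal (2 powr (3/2)) * ennreal (10 * 2 powr r) = ennreal (2 powr (3/2) * (10 * 2 powr r))"
      by (rule ennreal_mult[symmetric]) auto
    then show ?thesis
      using r unfolding B_def epow_mult[symmetric] epow_epow e mult.assoc[symmetric]
      by (simp add: epow_mult[of "ennreal _"] epow_ennreal cA2_def mult.assoc)
  qed
  finally show ?thesis .
qed

end

section \<open>The bound for \<open>C_S\<close>: local part and two tails on each level set\<close>

lemma wnorm_on_empty: "w \<in> Mplus \<Longrightarrow> g \<in> Mplus \<Longrightarrow> wnorm_on q w {} g = 0"
  using wnorm_on_infinityI[of "{}" w g 0] by (cases "q = \<infinity>") (auto simp: wnorm_on_def)

text \<open>2^(1/2) is the ratio of \<open>L (j + 1)\<close> to \<open>L j\<close>; the rest is the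
  geometric series with ratio 2^(-1/4).\<close>

definition cG :: real where "cG = 2 powr (1/2) / (1 - 2 powr (- (1/4)))"

text \<open>Factors from \<open>Hoelder_crude\<close>, from \<open>tau_case2\<close> and from the
  overlap in \<open>sum_nv_F\<close>. For p \<le> r, division by zero gives \<open>s_exp p r\<close>
  = 0 and r / 0 = 0, so the middle factor is 1.\<close>

definition cb :: "real \<Rightarrow> real \<Rightarrow> real" where
  "cb p r = 2 * 5 powr (r / s_exp p r) * 4 powr (r / p)"

text \<open>In order: summation over levels, splitting of the norm on \<open>E j\<close>, the r-th
  power of a sum of three terms, and 10 * D^r for each of the two tails plus \<open>cb\<close> for
  the local part.\<close>

definition cU :: "real \<Rightarrow> real \<Rightarrow> real \<Rightarrow> ennreal \<Rightarrow> real" where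
  "cU p r D q = (hc q r * cG * ((cq q * cq q * D) powr r * (2 powr r * 2 powr r)) * (20 * D powr r + cb p r)) powr (1 / r)"

lemma cG_pos: "0 < cG"
  by (simp add: cG_def powr_less_one)

lemma cb_pos: "0 < cb p r"
  by (simp add: cb_def)

lemma cU_pos:
  assumes "0 < q" "0 < r" "1 \<le> D"
  shows "0 < cU p r D q"
proof -
  have "0 < hc q r"
  proof (cases "q = top")
    case False
    then have "0 < enn2real q" using enn2real_pos[OF assms(1)] by simp
    then show ?thesis using assms(2) False by (simp add: hc_def powr_less_one)
  qed (simp add: hc_def)
  moreover have "0 < 20 * D powr r + cb p r" by (intro add_nonneg_pos cb_pos) simp
  ultimately show ?thesis using cq_ge_1[of q] assms(3) cG_pos unfolding cU_def by simp
qed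

context pos_setting
begin

lemma E_subset: "E j \<subseteq> {0..}"
  using E_pos by (auto intro: less_imp_le)

lemma E_leb: "E j \<in> sets lebesgue"
  using E_sets by auto

text \<open>On \<open>E j\<close>, \<open>Sf f\<close> is bounded by the norm over everything above
  level \<open>L j\<close>, which is cut into the sets \<open>E (j + i)\<close>. The weights 2^(i/4)
  of \<open>wnorm_on_UN_le\<close> grow more slowly than the levels, so the double sum is a
  convergent geometric series in i times a single sum over levels.\<close>

lemma NS_le_level_sum:
  assumes f: "f \<in> Mplus"
  shows "epow (NS f) r \<le> ennreal (hc q r * cG) * (\<integral>\<^sup>+j. ennreal (L j) * epow (wnorm_on q w (E j) (kernel_op k f)) r \<partial>count_space UNIV)"
    (is "_ \<le> _ * ?Q")
proof -
  define a where "a = (\<lambda>j. epow (wnorm_on q w (E j) (kernel_op k f)) r)"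
  have G: "kernel_op k f \<in> Mplus" by (rule kernel_op_Mplus[OF k f])
  have sub: "{x. L j < U x} \<subseteq> {0..}" for j
    unfolding E_cover using E_subset by auto
  have "epow (NS f) r = (\<integral>\<^sup>+x\<in>{0..}. epow (Sf f x) r * u x \<partial>lebesgue)"
    using r by (simp add: NS_eq)
  also have "\<dots> \<le> (\<integral>\<^sup>+j. ennreal (L (j + 1)) * epow (wnorm_on q w {x. L j < U x} (kernel_op k f)) r \<partial>count_space UNIV)"
  proof (intro integral_le_level_sum epow_mono[OF r])
    fix j x assume x: "x \<in> E j"
    then have "{x..} \<subseteq> {x. L j < U x}" using U_mono[of x] by (auto simp: E_def intro: less_le_trans)
    then show "Sf f x \<le> wnorm_on q w {x. L j < U x} (kernel_op k f)"
      using E_pos[OF x] sets_U(2)[of "L j"] by (intro wnorm_on_mono[OF q] w G) auto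
  qed
  also have "\<dots> \<le> (\<integral>\<^sup>+j. ennreal (L (j + 1)) * (ennreal (hc q r) * (\<Sum>i. ennreal (2 powr (real i / 4)) * a (j + int i))) \<partial>count_space UNIV)"
    unfolding a_def using sets_U(2) sub
    by (intro nn_integral_mono mult_left_mono wnorm_on_UN_le[OF q r] E_leb E_subset w G equalityD1[OF E_cover]) auto
  also have "\<dots> = (\<integral>\<^sup>+j. (\<Sum>i. ennreal (hc q r) * ennreal (2 powr (1/2)) * ennreal ((2 powr (- (1/4))) ^ i) * (ennreal (L (j + int i)) * a (j + int i))) \<partial>count_space UNIV)"
  proof (intro nn_integral_cong)
    fix j
    have "ennreal (L (j + 1)) * (ennreal (hc q r) * (\<Sum>i. ennreal (2 powr (real i / 4)) * a (j + int i))) =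
      (\<Sum>i. ennreal (L (j + 1)) * (ennreal (hc q r) * (ennreal (2 powr (real i / 4)) * a (j + int i))))"
      by simp
    also have "\<dots> = (\<Sum>i. ennreal (hc q r) * ennreal (2 powr (1/2)) * ennreal ((2 powr (- (1/4))) ^ i) * (ennreal (L (j + int i)) * a (j + int i)))"
    proof (intro suminf_cong)
      fix i :: nat
      \<comment> \<open>Of the growth 2^(i/2) of the levels, one half pays for the weight 2^(i/4)
        and the other half is left as the decay 2^(-i/4).\<close>
      have "2 powr (1/2) * (2 powr (- (1/4))) ^ i * L (j + int i) = (2 powr (1/2) * 2 powr (- (real i / 4)) * 2 powr (real i / 2)) * L j"
        by (simp add: L_add powr_power mult.commute)
      also have "2 powr (1/2) * 2 powr (- (real i / 4)) * 2 powr (real i / 2) = (2 powr (1/2) * 2 powr (real i / 4) :: real)"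
        unfolding powr_add[symmetric] by (simp add: field_simps)
      also have "\<dots> * L j = L (j + 1) * 2 powr (real i / 4)"
        using L_add[of j 1] by simp
      finally have e: "ennreal (2 powr (1/2)) * ennreal ((2 powr (- (1/4))) ^ i) * ennreal (L (j + int i)) = ennreal (L (j + 1)) * ennreal (2 powr (real i / 4))"
        by (simp flip: ennreal_mult)
      have "ennreal (L (j + 1)) * (ennreal (hc q r) * (ennreal (2 powr (real i / 4)) * a (j + int i))) =
        ennreal (hc q r) * (ennreal (L (j + 1)) * ennreal (2 powr (real i / 4))) * a (j + int i)"
        by (simp only: mult_ac)
      also have "\<dots> = ennreal (hc q r) * ennreal (2 powr (1/2)) * ennreal ((2 powr (- (1/4))) ^ i) * (ennreal (L (j + int i)) * a (j + int i))"
        unfolding e[symmetric] by (simp only: mult_ac)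
      finally show "ennreal (L (j + 1)) * (ennreal (hc q r) * (ennreal (2 powr (real i / 4)) * a (j + int i))) =
        ennreal (hc q r) * ennreal (2 powr (1/2)) * ennreal ((2 powr (- (1/4))) ^ i) * (ennreal (L (j + int i)) * a (j + int i))" .
    qed
    finally show "ennreal (L (j + 1)) * (ennreal (hc q r) * (\<Sum>i. ennreal (2 powr (real i / 4)) * a (j + int i))) =
      (\<Sum>i. ennreal (hc q r) * ennreal (2 powr (1/2)) * ennreal ((2 powr (- (1/4))) ^ i) * (ennreal (L (j + int i)) * a (j + int i)))" .
  qed
  also have "\<dots> = (\<Sum>i. \<integral>\<^sup>+j. ennreal (hc q r) * ennreal (2 powr (1/2)) * ennreal ((2 powr (- (1/4))) ^ i) * (ennreal (L (j + int i)) * a (j + int i)) \<partial>count_space UNIV)"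
    by (rule nn_integral_suminf) simp
  also have "\<dots> = (\<Sum>i. ennreal (hc q r) * ennreal (2 powr (1/2)) * ennreal ((2 powr (- (1/4))) ^ i) * ?Q)"
    using nn_integral_count_space_shift[of "\<lambda>j. ennreal (L j) * a j"]
    by (simp add: nn_integral_cmult a_def)
  also have "\<dots> = ennreal (hc q r) * ennreal (2 powr (1/2)) * (\<Sum>i. ennreal ((2 powr (- (1/4))) ^ i)) * ?Q"
    by simp
  also have "(\<Sum>i. ennreal ((2 powr (- (1/4))) ^ i)) = ennreal (1 / (1 - 2 powr (- (1/4))))"
    by (rule suminf_ennreal_eq) (auto intro!: geometric_sums simp: powr_less_one)
  also have "ennreal (hc q r) * ennreal (2 powr (1/2)) * ennreal (1 / (1 - 2 powr (- (1/4)))) = ennreal (hc q r * cG)"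
    by (simp add: cG_def hc_nonneg powr_less_one less_imp_le flip: ennreal_mult)
  finally show ?thesis .
qed

lemma xr_mono: "X (L j) \<noteq> \<infinity> \<Longrightarrow> i \<le> j \<Longrightarrow> X (L i) \<noteq> \<infinity> \<and> xr i \<le> xr j"
proof -
  assume a: "X (L j) \<noteq> \<infinity>" "i \<le> j"
  then have b: "X (L i) \<noteq> \<infinity>" using X_infinity_mono by blast
  have "X (L i) \<le> X (L j)" using a(2) by (intro X_mono) simp
  then show ?thesis using b xr[OF b] xr[OF a(1)] by simp
qed

lemma E_less_xr: "X (L j) \<noteq> \<infinity> \<Longrightarrow> y \<in> E i \<Longrightarrow> i < j \<Longrightarrow> y \<le> xr j"
  using le_X_iff[of "L j" y] xr[of j] L_le_iff[of "i + 1" j] by (auto simp: E_def simp del: L_le_iff)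

lemma E_strict_less_xr:
  assumes "X (L j) \<noteq> \<infinity>" "y \<in> E i" "i + 1 < j"
  shows "y < xr j"
proof -
  have "U y \<le> L (i + 1)" "L (i + 1) < L j" using assms by (auto simp: E_def)
  then show ?thesis using xr[OF assms(1)] U_less[of y "xr j"] by linarith
qed

text \<open>This truncation is within the reach of \<open>A2\<close>: for x in \<open>E j\<close>,
  \<open>X (L (j + 4))\<close> does not exceed \<open>sigma2 u x\<close>.\<close>

definition bpart :: "(real \<Rightarrow> ennreal) \<Rightarrow> int \<Rightarrow> ennreal" where
  "bpart f j = wnorm_on q w (E j) (kernel_op k (\<lambda>z. f z * indicator {z. ereal z < X (L (j + 4))} z))"

text \<open>For x in \<open>E (j - 2)\<close>, \<open>sigma2 u x\<close> is at most
  \<open>xr (j + 3)\<close>, so by \<open>kernel_op_lower1\<close> the first factor is at most D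
  times the one in \<open>A0\<close>. If \<open>X (L (j + 4))\<close> is infinite, there is no
  tail.\<close>

definition cpart :: "(real \<Rightarrow> ennreal) \<Rightarrow> int \<Rightarrow> ennreal" where
  "cpart f j = (if X (L (j + 4)) = \<infinity> then 0 else kernel_op k f (xr (j + 3)) * wnorm_on q w (E j) (\<lambda>y. 1))"

text \<open>For x in \<open>E (j - 1)\<close>, \<open>sigma2 u x\<close> lies between the two points
  used here: the kernel is taken below it and the tail above it, as the comparison with
  \<open>A1\<close> requires.\<close>

definition dpart :: "(real \<Rightarrow> ennreal) \<Rightarrow> int \<Rightarrow> ennreal" where
  "dpart f j = (if X (L (j + 4)) = \<infinity> then 0 else 
    (\<integral>\<^sup>+z\<in>{xr (j + 4)..}. f z \<partial>lebesgue) * wnorm_on q w (E j) (k (xr (j + 3))))"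

text \<open>Only z beyond \<open>xr (j + 4)\<close> calls for the Oinarov condition, with
  \<open>xr (j + 3)\<close> as intermediate point; the integral of the first resulting term is then
  enlarged to start at that point.\<close>

lemma kernel_op_split:
  assumes f: "f \<in> Mplus" and y: "y \<in> E j" and fin: "X (L (j + 4)) \<noteq> \<infinity>"
  shows "kernel_op k f y \<le> kernel_op k (\<lambda>z. f z * indicator {z. ereal z < X (L (j + 4))} z) y + 
    ennreal D * (kernel_op k f (xr (j + 3)) * 1 + (\<integral>\<^sup>+z\<in>{xr (j + 4)..}. f z \<partial>lebesgue) * k (xr (j + 3)) y)"
proof -
  define b where "b = xr (j + 3)"
  define c where "c = xr (j + 4)"
  have Xc: "X (L (j + 4)) = ereal c" using xr[OF fin] by (simp add: c_def)
  have bc: "b \<le> c" and Xb: "X (L (j + 3)) \<noteq> \<infinity>" using xr_mono[OF fin, of "j + 3"] by (auto simp: b_def c_def)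
  have yb: "y \<le> b" using E_less_xr[OF Xb y] by (simp add: b_def)
  have y0: "0 \<le> y" using E_pos[OF y] by simp
  have b0: "0 \<le> b" using yb y0 by simp
  let ?f = "\<lambda>z. f z * indicator {z. ereal z < ereal c} z"
  let ?F = "\<integral>\<^sup>+z\<in>{c..}. f z \<partial>lebesgue"
  have mf: "(\<lambda>z. k z y * ?f z * indicator {y..} z) \<in> borel_measurable lebesgue"
    using y0 by (intro Mplus_indicator Mplus_mult[OF kernel_Mplus_right[OF k y0]] trunc_Mplus f) auto
  have mb: "(\<lambda>z. k z b * f z * indicator {b..} z) \<in> borel_measurable lebesgue"
    using b0 by (intro Mplus_indicator Mplus_mult[OF kernel_Mplus_right[OF k b0]] f) auto
  have mc: "(\<lambda>z. f z * indicator {c..} z) \<in> borel_measurable lebesgue"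
    using b0 bc by (intro Mplus_indicator f) auto
  have "kernel_op k f y \<le> (\<integral>\<^sup>+z. k z y * ?f z * indicator {y..} z + ennreal D * (k z b * f z * indicator {b..} z + f z * indicator {c..} z * k b y) \<partial>lebesgue)"
    unfolding kernel_op_def
  proof (rule nn_integral_mono)
    fix z
    consider "z < y" | "y \<le> z" "z < c" | "c \<le> z" by linarith
    then show "k z y * f z * indicator {y..} z \<le> k z y * ?f z * indicator {y..} z + ennreal D * (k z b * f z * indicator {b..} z + f z * indicator {c..} z * k b y)"
    proof cases
      case 3
      then have "k z y \<le> ennreal D * (k z b + k b y)"
        using kernel_upper[OF k D y0 yb] bc by simp
      then have "k z y * f z \<le> ennreal D * (k z b + k b y) * f z" by (rule mult_right_mono) auto
      then show ?thesis using 3 bc yb by (simp add: distrib_left distrib_right mult_ac add_increasing)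
    qed auto
  qed
  also have "\<dots> = kernel_op k ?f y + ennreal D * (kernel_op k f b + ?F * k b y)"
    unfolding kernel_op_def using mf mb mc
    by (subst nn_integral_add, simp, simp, subst nn_integral_cmult, simp, subst nn_integral_add, simp, simp, subst nn_integral_multc, simp, simp)
  finally show ?thesis by (simp add: Xc b_def c_def)
qed

text \<open>One application of \<open>wnorm_on_add\<close> for each of the two plus signs, hence the
  square of \<open>cq q\<close>.\<close>

lemma wnorm_on_E_le:
  assumes f: "f \<in> Mplus"
  shows "wnorm_on q w (E j) (kernel_op k f) \<le> ennreal (cq q * cq q * D) * (bpart f j + (cpart f j + dpart f j))"
proof (cases "X (L (j + 4)) = \<infinity>")
  case True
  have "1 * 1 * 1 \<le> cq q * cq q * D" using cq_ge_1[of q] D by (intro mult_mono) auto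
  then have "1 * bpart f j \<le> ennreal (cq q * cq q * D) * bpart f j"
    by (intro mult_right_mono) auto
  then show ?thesis using True by (simp add: bpart_def cpart_def dpart_def)
next
  case False
  let ?f = "\<lambda>z. f z * indicator {z. ereal z < X (L (j + 4))} z"
  let ?P = "kernel_op k f (xr (j + 3))" and ?F = "\<integral>\<^sup>+z\<in>{xr (j + 4)..}. f z \<partial>lebesgue"
  let ?k = "k (xr (j + 3))"
  have "0 \<le> xr (j + 3)" using xr_mono[OF False, of "j + 3"] xr[of "j + 3"] by simp
  then have km: "?k \<in> Mplus" by (rule kernel_Mplus_left[OF k])
  note m = kernel_op_Mplus[OF k trunc_Mplus[OF f]] Mplus_add Mplus_mult[OF Mplus_const] Mplus_const km w
  have "wnorm_on q w (E j) (kernel_op k f) \<le> wnorm_on q w (E j) (\<lambda>y. kernel_op k ?f y + ennreal D * (?P * 1 + ?F * ?k y))"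
    by (intro wnorm_on_mono[OF q] E_leb E_subset order_refl w kernel_op_Mplus[OF k f] kernel_op_split f False)
  also have "\<dots> \<le> ennreal (cq q) * (bpart f j + wnorm_on q w (E j) (\<lambda>y. ennreal D * (?P * 1 + ?F * ?k y)))"
    unfolding bpart_def by (intro wnorm_on_add q E_leb E_subset m)
  also have "wnorm_on q w (E j) (\<lambda>y. ennreal D * (?P * 1 + ?F * ?k y)) = ennreal D * wnorm_on q w (E j) (\<lambda>y. ?P * 1 + ?F * ?k y)"
    by (intro wnorm_on_cmult q E_leb E_subset m)
  also have "wnorm_on q w (E j) (\<lambda>y. ?P * 1 + ?F * ?k y) \<le> ennreal (cq q) * (wnorm_on q w (E j) (\<lambda>y. ?P * 1) + wnorm_on q w (E j) (\<lambda>y. ?F * ?k y))"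
    by (intro wnorm_on_add q E_leb E_subset m)
  also have "wnorm_on q w (E j) (\<lambda>y. ?P * 1) = cpart f j"
    unfolding cpart_def wnorm_on_cmult[OF q E_leb E_subset w Mplus_const] using False by simp
  also have "wnorm_on q w (E j) (\<lambda>y. ?F * ?k y) = dpart f j"
    unfolding dpart_def wnorm_on_cmult[OF q E_leb E_subset w km] using False by simp
  also have "bpart f j + ennreal D * (ennreal (cq q) * (cpart f j + dpart f j)) \<le> 
     ennreal (cq q * D) * (bpart f j + (cpart f j + dpart f j))"
  proof -
    have "1 * 1 \<le> cq q * D" using cq_ge_1[of q] D by (intro mult_mono) auto
    then have "1 * bpart f j \<le> ennreal (cq q * D) * bpart f j" by (intro mult_right_mono) auto
    moreover have "ennreal D * (ennreal (cq q) * (cpart f j + dpart f j)) = ennreal (cq q * D) * (cpart f j + dpart f j)"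
      using cq_ge_1[of q] D by (simp add: ennreal_mult mult_ac)
    ultimately show ?thesis by (simp add: distrib_left add_right_mono)
  qed
  finally have "wnorm_on q w (E j) (kernel_op k f) \<le> ennreal (cq q) * (ennreal (cq q * D) * (bpart f j + (cpart f j + dpart f j)))"
    by (simp add: add_left_mono mult_left_mono)
  then show ?thesis
    using cq_ge_1[of q] D by (simp add: ennreal_mult mult.assoc)
qed

lemma sum_cpart:
  assumes f: "f \<in> Mplus"
  shows "(\<integral>\<^sup>+j. ennreal (L j) * epow (cpart f j) r \<partial>count_space UNIV) \<le> ennreal (10 * D powr r) * epow (A0_lhs q r u w k f) r"
proof -
  \<comment> \<open>The factor 1 / D is kept inside so that \<open>level_sum_shift\<close> applies
    without a constant; it is restored at the end.\<close>
  define e where "e = (\<lambda>j. epow (ennreal (1 / D) * cpart f j) r)"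
  define g where "g = (\<lambda>x. if sigma2 u x = \<infinity> then 0 else let b = real_of_ereal (sigma2 u x) in
      u x * epow (wnorm_on q w {x<..<b} (\<lambda>y. 1)) r * epow (kernel_op k f b) r)"
  have inv: "ennreal D * ennreal (1 / D) = 1" using D by (simp flip: ennreal_mult)
  have "(\<integral>\<^sup>+j. ennreal (L j) * e j \<partial>count_space UNIV) \<le> 10 * (\<integral>\<^sup>+x\<in>{0..}. g x \<partial>lebesgue)"
  \<comment> \<open>Shift 2 rather than 1, because \<open>sigma2 u x\<close> must not exceed the
    splitting point \<open>xr (j + 5)\<close> of \<open>cpart f (j + 2)\<close>.\<close>
  proof (rule level_sum_shift[of 2])
    fix j x assume x: "x \<in> E j"
    show "e (j + 2) * u x \<le> g x"
    proof (cases "X (L (j + 6)) = \<infinity>")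
      case False
      have X5: "X (L (j + 5)) \<noteq> \<infinity>" and X4: "X (L (j + 4)) \<noteq> \<infinity>" using xr_mono[OF False] by simp_all
      define b where "b = real_of_ereal (sigma2 u x)"
      have s: "ereal (xr (j + 4)) \<le> sigma2 u x" "sigma2 u x \<le> ereal (xr (j + 5))"
        using sigma2_E[OF x] xr[OF X4] xr[OF X5] by auto
      then have sb: "sigma2 u x = ereal b" unfolding b_def by (cases "sigma2 u x") auto
      then have b: "xr (j + 4) \<le> b" "b \<le> xr (j + 5)" using s by auto
      have b0: "0 \<le> b" using b xr[OF X4] by linarith
      have sub: "E (j + 2) \<subseteq> {x<..<b}"
      proof
        fix y assume y: "y \<in> E (j + 2)"
        have "L (j + 1) < L (j + 2)" by simp
        then have "U x < U y" using x y by (auto simp: E_def simp del: L_less_iff)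
        moreover have "y < xr (j + 4)" using E_strict_less_xr[OF X4 y] by simp
        ultimately show "y \<in> {x<..<b}" using b U_less by auto
      qed
      have "ennreal (1 / D) * cpart f (j + 2) = ennreal (1 / D) * kernel_op k f (xr (j + 5)) * wnorm_on q w (E (j + 2)) (\<lambda>y. 1)"
      proof -
        have "j + 2 + 4 = j + 6" "j + 2 + 3 = j + 5" by simp_all
        then show ?thesis unfolding cpart_def using False by (simp only: if_False mult.assoc)
      qed
      also have "\<dots> \<le> ennreal (1 / D) * (ennreal D * kernel_op k f b) * wnorm_on q w {x<..<b} (\<lambda>y. 1)"
        using kernel_op_lower1[OF f b0 b(2)] sub E_pos[OF x] E_subset[of "j + 2"]
        by (intro mult_mono wnorm_on_mono[OF q] E_leb w Mplus_const) auto
      also have "\<dots> = kernel_op k f b * wnorm_on q w {x<..<b} (\<lambda>y. 1)"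
        using inv by (simp add: mult.assoc[symmetric] mult.commute[of "ennreal (1 / D)"])
      finally have "e (j + 2) \<le> epow (kernel_op k f b * wnorm_on q w {x<..<b} (\<lambda>y. 1)) r"
        unfolding e_def by (rule epow_mono[OF r])
      then have "e (j + 2) * u x \<le> epow (kernel_op k f b * wnorm_on q w {x<..<b} (\<lambda>y. 1)) r * u x" 
        by (rule mult_right_mono) auto
      then show ?thesis
        unfolding g_def sb by (simp add: Let_def epow_mult mult_ac)
    qed (simp add: e_def cpart_def add.commute)
  next
    fix j assume "X (L j) = \<infinity>"
    then have "X (L (j + 4)) = \<infinity>" using X_infinity_mono[of j "j + 4"] by simp
    then show "e j = 0" by (simp add: e_def cpart_def)
  qed simp
  also have "(\<integral>\<^sup>+x\<in>{0..}. g x \<partial>lebesgue) = epow (A0_lhs q r u w k f) r"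
    using r unfolding A0_lhs_eq g_def by simp
  finally have *: "(\<integral>\<^sup>+j. ennreal (L j) * e j \<partial>count_space UNIV) \<le> 10 * epow (A0_lhs q r u w k f) r" .
  have "ennreal (L j) * epow (cpart f j) r = ennreal (D powr r) * (ennreal (L j) * e j)" for j
  proof -
    have "epow (cpart f j) r = epow (ennreal D * (ennreal (1 / D) * cpart f j)) r"
      unfolding mult.assoc[symmetric] inv by simp
    also have "\<dots> = epow (ennreal D) r * e j" unfolding e_def epow_mult[of "ennreal D"] ..
    finally have "epow (cpart f j) r = epow (ennreal D) r * e j" .
    then show ?thesis using D epow_ennreal[of D r] by (simp add: mult.left_commute)
  qed
  then have "(\<integral>\<^sup>+j. ennreal (L j) * epow (cpart f j) r \<partial>count_space UNIV) = ennreal (D powr r) * (\<integral>\<^sup>+j. ennreal (L j) * e j \<partial>count_space UNIV)"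
    by (simp add: nn_integral_cmult)
  also have "\<dots> \<le> ennreal (D powr r) * (10 * epow (A0_lhs q r u w k f) r)"
    by (rule mult_left_mono[OF *]) simp
  finally show ?thesis by (simp add: ennreal_mult mult_ac)
qed

lemma sum_dpart:
  assumes f: "f \<in> Mplus"
  shows "(\<integral>\<^sup>+j. ennreal (L j) * epow (dpart f j) r \<partial>count_space UNIV) \<le> ennreal (10 * D powr r) * epow (A1_lhs q r u w k f) r"
proof -
  define e where "e = (\<lambda>j. epow (ennreal (1 / D) * dpart f j) r)"
  define g where "g = (\<lambda>x. if sigma2 u x = \<infinity> then 0 else let b = real_of_ereal (sigma2 u x) in
      u x * epow (wnorm_on q w {x<..<b} (k b)) r * epow (\<integral>\<^sup>+z\<in>{b..}. f z \<partial>lebesgue) r)"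
  have inv: "ennreal D * ennreal (1 / D) = 1" using D by (simp flip: ennreal_mult)
  have "(\<integral>\<^sup>+j. ennreal (L j) * e j \<partial>count_space UNIV) \<le> 10 * (\<integral>\<^sup>+x\<in>{0..}. g x \<partial>lebesgue)"
  \<comment> \<open>Shift 1, because the splitting point \<open>xr (j + 4)\<close> of
    \<open>dpart f (j + 1)\<close> must not exceed \<open>sigma2 u x\<close>.\<close>
  proof (rule level_sum_shift[of 1])
    fix j x assume x: "x \<in> E j"
    show "e (j + 1) * u x \<le> g x"
    proof (cases "X (L (j + 5)) = \<infinity>")
      case X5: False
      have X4: "X (L (j + 4)) \<noteq> \<infinity>" using xr_mono[OF X5] by simp
      define b where "b = real_of_ereal (sigma2 u x)"
      have s: "ereal (xr (j + 4)) \<le> sigma2 u x" "sigma2 u x \<le> ereal (xr (j + 5))"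
        using sigma2_E[OF x] xr[OF X4] xr[OF X5] by auto
      then have sb: "sigma2 u x = ereal b" unfolding b_def by (cases "sigma2 u x") auto
      then have b: "xr (j + 4) \<le> b" "b \<le> xr (j + 5)" using s by auto
      have c0: "0 \<le> xr (j + 4)" using xr[OF X4] by simp
      then have b0: "0 \<le> b" using b by linarith
      have lt: "y < xr (j + 4)" if "y \<in> E (j + 1)" for y using E_strict_less_xr[OF X4 that] by simp
      have sub: "E (j + 1) \<subseteq> {x<..<b}"
      proof
        fix y assume y: "y \<in> E (j + 1)"
        have "U x < U y" using x y by (auto simp: E_def)
        then show "y \<in> {x<..<b}" using b lt[OF y] U_less by auto
      qed
      have "wnorm_on q w (E (j + 1)) (k (xr (j + 4))) \<le> wnorm_on q w {x<..<b} (\<lambda>y. ennreal D * k b y)"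
      proof (intro wnorm_on_mono[OF q] E_leb E_subset w kernel_Mplus_left[OF k] c0 sub)
        fix y assume y: "y \<in> E (j + 1)"
        then show "k (xr (j + 4)) y \<le> ennreal D * k b y"
          using kernel_lower2[OF k D _ _ b(1), of y] lt[OF y] E_pos[OF y] by simp
      qed auto
      also have "\<dots> = ennreal D * wnorm_on q w {x<..<b} (k b)"
        using E_pos[OF x] by (intro wnorm_on_cmult q w kernel_Mplus_left[OF k b0]) auto
      finally have wle: "wnorm_on q w (E (j + 1)) (k (xr (j + 4))) \<le> ennreal D * wnorm_on q w {x<..<b} (k b)" .
      have Fle: "(\<integral>\<^sup>+z\<in>{xr (j + 5)..}. f z \<partial>lebesgue) \<le> (\<integral>\<^sup>+z\<in>{b..}. f z \<partial>lebesgue)"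
        using b by (intro nn_integral_mono mult_left_mono) (auto simp: indicator_def)
      have "ennreal (1 / D) * dpart f (j + 1) = (\<integral>\<^sup>+z\<in>{xr (j + 5)..}. f z \<partial>lebesgue) * (ennreal (1 / D) * wnorm_on q w (E (j + 1)) (k (xr (j + 4))))"
      proof -
        have "j + 1 + 4 = j + 5" "j + 1 + 3 = j + 4" by simp_all
        then show ?thesis unfolding dpart_def using X5 by (simp only: if_False mult_ac)
      qed
      also have "\<dots> \<le> (\<integral>\<^sup>+z\<in>{b..}. f z \<partial>lebesgue) * (ennreal (1 / D) * (ennreal D * wnorm_on q w {x<..<b} (k b)))"
        by (intro mult_mono Fle wle) auto
      also have "\<dots> = (\<integral>\<^sup>+z\<in>{b..}. f z \<partial>lebesgue) * wnorm_on q w {x<..<b} (k b)"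
        using inv by (simp add: mult.assoc[symmetric] mult.commute[of "ennreal (1 / D)"])
      finally have "e (j + 1) \<le> epow ((\<integral>\<^sup>+z\<in>{b..}. f z \<partial>lebesgue) * wnorm_on q w {x<..<b} (k b)) r"
        unfolding e_def by (rule epow_mono[OF r])
      then have "e (j + 1) * u x \<le> epow ((\<integral>\<^sup>+z\<in>{b..}. f z \<partial>lebesgue) * wnorm_on q w {x<..<b} (k b)) r * u x" 
        by (rule mult_right_mono) auto
      then show ?thesis
        unfolding g_def sb by (simp add: Let_def epow_mult mult_ac)
    qed (simp add: e_def dpart_def add.commute)
  next
    fix j assume "X (L j) = \<infinity>"
    then have "X (L (j + 4)) = \<infinity>" using X_infinity_mono[of j "j + 4"] by simp
    then show "e j = 0" by (simp add: e_def dpart_def)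
  qed simp
  also have "(\<integral>\<^sup>+x\<in>{0..}. g x \<partial>lebesgue) = epow (A1_lhs q r u w k f) r"
    using r unfolding A1_lhs_eq g_def by simp
  finally have *: "(\<integral>\<^sup>+j. ennreal (L j) * e j \<partial>count_space UNIV) \<le> 10 * epow (A1_lhs q r u w k f) r" .
  have "ennreal (L j) * epow (dpart f j) r = ennreal (D powr r) * (ennreal (L j) * e j)" for j
  proof -
    have "epow (dpart f j) r = epow (ennreal D * (ennreal (1 / D) * dpart f j)) r"
      unfolding mult.assoc[symmetric] inv by simp
    also have "\<dots> = epow (ennreal D) r * e j" unfolding e_def epow_mult[of "ennreal D"] ..
    finally have "epow (dpart f j) r = epow (ennreal D) r * e j" .
    then show ?thesis using D epow_ennreal[of D r] by (simp add: mult.left_commute)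
  qed
  then have "(\<integral>\<^sup>+j. ennreal (L j) * epow (dpart f j) r \<partial>count_space UNIV) = ennreal (D powr r) * (\<integral>\<^sup>+j. ennreal (L j) * e j \<partial>count_space UNIV)"
    by (simp add: nn_integral_cmult)
  also have "\<dots> \<le> ennreal (D powr r) * (10 * epow (A1_lhs q r u w k f) r)"
    by (rule mult_left_mono[OF *]) simp
  finally show ?thesis by (simp add: ennreal_mult mult_ac)
qed

text \<open>The window of four consecutive level sets that contains all values of f seen by
  \<open>bpart f j\<close>.\<close>

definition F :: "int \<Rightarrow> real set" where "F j = {z. L j < U z \<and> U z \<le> L (j + 4)}"

lemma F_sets: "F j \<in> sets lebesgue" "F j \<subseteq> {0..}"
proof -
  have "F j = {z. L j < U z} \<inter> {z. U z \<le> L (j + 4)}" by (auto simp: F_def)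
  then show "F j \<in> sets lebesgue" using sets_U by auto
  show "F j \<subseteq> {0..}"
  proof
    fix z assume "z \<in> F j"
    then have "0 < U z" using less_trans[OF L_pos[of j], of "U z"] by (simp add: F_def)
    then show "z \<in> {0..}" using U_pos[of z] by simp
  qed
qed

lemma F_Un: "z \<in> F j \<Longrightarrow> \<exists>i\<in>{0..3}. z \<in> E (j + i)"
proof -
  assume z: "z \<in> F j"
  then have "z \<in> (\<Union>i. E (j + int i))" unfolding E_cover[symmetric] by (simp add: F_def)
  then obtain i where i: "z \<in> E (j + int i)" by auto
  then have "L (j + int i) < L (j + 4)" using z by (auto simp: E_def F_def simp del: L_less_iff)
  then have "int i \<in> {0..3}" by simp
  with i show ?thesis by blast
qed

text \<open>Each window is covered by four level sets, and the level sets are disjoint.\<close>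

lemma sum_nv_F:
  assumes f: "f \<in> Mplus"
  shows "(\<integral>\<^sup>+j. epow (nv (\<lambda>z. f z * indicator (F j) z)) p \<partial>count_space UNIV) \<le> 4 * epow (nv f) p"
proof -
  have p0: "0 < p" using p by simp
  define g where "g = (\<lambda>z. epow (f z) p * v z * indicator {0..} z)"
  have g: "g \<in> borel_measurable lebesgue" unfolding g_def
    by (intro Mplus_indicator Mplus_mult Mplus_epow f v) auto
  have gE: "(\<lambda>z. g z * indicator (E j) z) \<in> borel_measurable lebesgue" for j
    using g E_leb[of j] by measurable
  have "(\<integral>\<^sup>+j. epow (nv (\<lambda>z. f z * indicator (F j) z)) p \<partial>count_space UNIV) \<le>
    (\<integral>\<^sup>+j. (\<Sum>i\<in>{0..3}. \<integral>\<^sup>+z\<in>E (j + i). g z \<partial>lebesgue) \<partial>count_space UNIV)"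
  proof (rule nn_integral_mono)
    fix j
    have "epow (nv (\<lambda>z. f z * indicator (F j) z)) p = (\<integral>\<^sup>+z\<in>{0..}. epow (f z * indicator (F j) z) p * v z \<partial>lebesgue)"
      using p0 by (simp add: wnorm_ennreal)
    also have "\<dots> \<le> (\<integral>\<^sup>+z. (\<Sum>i\<in>{0..3}. g z * indicator (E (j + i)) z) \<partial>lebesgue)"
    proof (rule nn_integral_mono)
      fix z
      show "epow (f z * indicator (F j) z) p * v z * indicator {0..} z \<le> (\<Sum>i\<in>{0..3}. g z * indicator (E (j + i)) z)"
      proof (cases "z \<in> F j")
        case True
        then obtain i where i: "i \<in> {0..3}" "z \<in> E (j + i)" using F_Un by blast
        have "g z * indicator (E (j + i)) z \<le> (\<Sum>i\<in>{0..3}. g z * indicator (E (j + i)) z)"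
          using i by (intro member_le_sum) auto
        then show ?thesis using True i by (simp add: g_def)
      qed simp
    qed
    also have "\<dots> = (\<Sum>i\<in>{0..3}. \<integral>\<^sup>+z\<in>E (j + i). g z \<partial>lebesgue)"
      by (rule nn_integral_sum[OF gE])
    finally show "epow (nv (\<lambda>z. f z * indicator (F j) z)) p \<le> (\<Sum>i\<in>{0..3}. \<integral>\<^sup>+z\<in>E (j + i). g z \<partial>lebesgue)" .
  qed
  also have "\<dots> = (\<Sum>i\<in>{0..3::int}. \<integral>\<^sup>+j. (\<integral>\<^sup>+z\<in>E (j + i). g z \<partial>lebesgue) \<partial>count_space UNIV)"
    by (rule nn_integral_sum) simp
  also have "\<dots> = (\<Sum>i\<in>{0..3::int}. \<integral>\<^sup>+z\<in>(\<Union>j. E j). g z \<partial>lebesgue)"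
    using nn_integral_count_space_shift[of "\<lambda>j. \<integral>\<^sup>+z\<in>E j. g z \<partial>lebesgue"]
      nn_integral_count_space_disjoint[OF E_leb E_disjoint g] by simp
  also have "\<dots> = 4 * (\<integral>\<^sup>+z\<in>(\<Union>j. E j). g z \<partial>lebesgue)" by simp
  also have "\<dots> \<le> 4 * epow (nv f) p"
    using p0 by (intro mult_left_mono) (auto simp: wnorm_ennreal g_def indicator_def intro!: nn_integral_mono)
  finally show ?thesis .
qed

definition \<kappa> :: "int \<Rightarrow> ennreal" where "\<kappa> j = least_const (\<lambda>f. bpart f j) nv"

lemma bpart_F:
  assumes f: "f \<in> Mplus"
  shows "bpart f j \<le> bpart (\<lambda>z. f z * indicator (F j) z) j"
  unfolding bpart_def
proof (intro wnorm_on_mono[OF q] E_leb E_subset order_refl w kernel_op_Mplus[OF k] trunc_Mplus f kernel_op_mono)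
  fix y z assume y: "y \<in> E j" and z: "y \<le> z"
  show "f z * indicator {z. ereal z < X (L (j + 4))} z \<le> f z * indicator (F j) z * indicator {z. ereal z < X (L (j + 4))} z"
  proof (cases "ereal z < X (L (j + 4))")
    case True
    then have "U z \<le> L (j + 4)" using le_X_iff[of "L (j + 4)" z] less_imp_le by auto
    moreover have "L j < U z" using y U_mono[OF z] by (auto simp: E_def)
    ultimately show ?thesis by (simp add: F_def)
  qed simp
qed

lemma bpart_le:
  assumes f: "f \<in> Mplus" "nv f < top" and \<kappa>: "\<kappa> j < top"
  shows "bpart f j \<le> \<kappa> j * nv (\<lambda>z. f z * indicator (F j) z)"
proof -
  have fF: "(\<lambda>z. f z * indicator (F j) z) \<in> Mplus"
    by (intro Mplus_mult Mplus_ind f F_sets)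
  have "nv (\<lambda>z. f z * indicator (F j) z) \<le> nv f"
    using p by (auto simp: wnorm_ennreal indicator_def intro!: epow_mono nn_integral_mono)
  then have "nv (\<lambda>z. f z * indicator (F j) z) < top" using f(2) by (rule le_less_trans)
  then have "bpart (\<lambda>z. f z * indicator (F j) z) j \<le> \<kappa> j * nv (\<lambda>z. f z * indicator (F j) z)"
    using \<kappa> fF unfolding \<kappa>_def by (intro least_constD) auto
  with bpart_F[OF f(1)] show ?thesis by (rule order_trans)
qed

lemma bpart_infinity: "f \<in> Mplus \<Longrightarrow> X (L j) = \<infinity> \<Longrightarrow> bpart f j = 0"
  unfolding bpart_def by (simp add: X_infinity wnorm_on_empty w kernel_op_Mplus[OF k] trunc_Mplus)

text \<open>After localisation the operator is diagonal in j: what matters is boundedness of \<tau>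
  for p \<le> r, and summability of its powers with exponent \<open>s_exp p r\<close> for r <
  p.\<close>

definition \<tau> :: "int \<Rightarrow> ennreal" where
  "\<tau> j = (if X (L j) = \<infinity> then 0 else epow (ennreal (L j)) (1 / r) * \<kappa> j)"

lemma \<kappa>_finite: "X (L j) \<noteq> \<infinity> \<Longrightarrow> \<tau> j < top \<Longrightarrow> \<kappa> j < top"
  using less_imp_neq[OF L_pos[of j]] by (cases "\<kappa> j") (auto simp: \<tau>_def ennreal_mult_top)

lemma bpart_tau:
  assumes f: "f \<in> Mplus" "nv f < top" and \<tau>: "\<tau> j < top"
  shows "ennreal (L j) * epow (bpart f j) r \<le> epow (\<tau> j) r * epow (nv (\<lambda>z. f z * indicator (F j) z)) r"
proof (cases "X (L j) = \<infinity>")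
  case True
  then show ?thesis using bpart_infinity[OF f(1)] by simp
next
  case False
  have "ennreal (L j) * epow (bpart f j) r = epow (epow (ennreal (L j)) (1 / r) * bpart f j) r"
    using r by (simp add: epow_mult)
  also have "\<dots> \<le> epow (epow (ennreal (L j)) (1 / r) * (\<kappa> j * nv (\<lambda>z. f z * indicator (F j) z))) r"
    by (intro epow_mono[OF r] mult_left_mono bpart_le f \<kappa>_finite False \<tau>) auto
  also have "\<dots> = epow (\<tau> j) r * epow (nv (\<lambda>z. f z * indicator (F j) z)) r"
    using False by (simp add: \<tau>_def epow_mult mult.assoc)
  finally show ?thesis .
qed

lemma tau_case1:
  assumes "p \<le> r"
  shows "\<tau> j \<le> A2 p q r u v w k"
proof (cases "X (L j) = \<infinity>")
  case False
  note xj = xr[OF False]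
  have "\<kappa> j \<le> opnorm (ennreal p) v q w (Hstar_from k (xr j))"
    unfolding \<kappa>_def opnorm_def
  proof (rule least_const_mono)
    fix f assume f: "f \<in> Mplus"
    have "E j \<subseteq> {xr j..}"
      using xj by (auto simp: E_def intro!: less_imp_le[OF U_less])
    then have "bpart f j \<le> Sf f (xr j)"
      unfolding bpart_def using xj E_subset[of j]
      by (intro wnorm_on_mono[OF q] E_leb w kernel_op_Mplus[OF k] trunc_Mplus f kernel_op_mono) (auto simp: indicator_def)
    then show "bpart f j \<le> wnorm q w (Hstar_from k (xr j) f)"
      using xj f by (simp add: wnorm_Hstar_from)
  qed
  then have "\<tau> j \<le> epow (cumul u (xr j)) (1 / r) * opnorm (ennreal p) v q w (Hstar_from k (xr j))"
    using False xj by (simp add: \<tau>_def cumul_eq mult_left_mono)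
  also have "\<dots> \<le> A2 p q r u v w k"
    unfolding A2_def using assms xj by (auto intro!: SUP_upper2[of "xr j"])
  finally show ?thesis .
qed (simp add: \<tau>_def)

text \<open>The reverse of the comparison in \<open>A2_le_case2\<close>: for x in
  \<open>E j\<close>, the interval from \<open>sigma_inv u x\<close> to \<open>sigma u x\<close>
  contains \<open>E j\<close>, and \<open>sigma2 u x\<close> is at or beyond
  \<open>X (L (j + 4))\<close>. So \<kappa> j is at most the operator norm in the integrand of
  \<open>A2\<close>.\<close>

lemma tau_case2:
  assumes rp: "r < p"
  shows "(\<integral>\<^sup>+j. epow (\<tau> j) (s_exp p r) \<partial>count_space UNIV) \<le> 5 * epow (A2 p q r u v w k) (s_exp p r)"
proof -
  define s where "s = s_exp p r"
  note s = s_exp_facts[OF rp, folded s_def]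
  define c where "c = (\<lambda>j. if X (L j) = \<infinity> then 0 else epow (ennreal (L j)) (s / p) * epow (\<kappa> j) s)"
  define op where "op = (\<lambda>x. opnorm (ennreal p) v q w (Hstar_between u k (sigma_inv u x) (sigma u (ereal x))))"
  define G where "G = (\<lambda>x. if cumul u x = 0 then 0 else u x * epow (cumul u x) (s / p) * epow (op x) s)"
  have "epow (\<tau> j) s = ennreal (L j) * c j" for j
  proof (cases "X (L j) = \<infinity>")
    case False
    have "epow (\<tau> j) s = epow (ennreal (L j)) (1 + s / p) * epow (\<kappa> j) s"
      using False unfolding s(2)[symmetric] by (simp add: \<tau>_def epow_mult epow_epow)
    then show ?thesis using False by (simp add: c_def epow_add_exp mult.assoc)
  qed (simp add: \<tau>_def c_def)
  then have "(\<integral>\<^sup>+j. epow (\<tau> j) s \<partial>count_space UNIV) = (\<integral>\<^sup>+j. ennreal (L j) * c j \<partial>count_space UNIV)"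
    by simp
  also have "\<dots> \<le> 5 * (\<integral>\<^sup>+x\<in>{0..}. G x \<partial>lebesgue)"
  proof (rule level_sum_le_integral)
    fix j x assume x: "x \<in> E j"
    then have Xj: "X (L j) \<noteq> \<infinity>" using X_infinity by auto
    have Ux: "L j < U x" using x by (simp add: E_def)
    have "\<kappa> j \<le> op x"
      unfolding \<kappa>_def op_def opnorm_def
    proof (rule least_const_mono)
      fix f assume f: "f \<in> Mplus"
      let ?c = "sigma_inv u x" and ?d = "sigma u (ereal x)"
      have "0 \<le> X (L (j - 2))" by (rule X_nonneg) simp
      then have "0 \<le> ereal ?c" using sigma_inv_E(1)[OF x] by (rule order_trans)
      then have c0: "0 \<le> ?c" by (simp add: zero_ereal_def)
      have sub: "E j \<subseteq> {y. ?c \<le> y \<and> ereal y < ?d}"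
      proof
        fix y assume y: "y \<in> E j"
        have "ereal ?c \<le> X (L j)" by (rule sigma_inv_E(2)[OF x])
        also have "X (L j) < ereal y" using y X_less_iff[of "L j" y] by (simp add: E_def)
        finally have "?c \<le> y" by simp
        moreover have "ereal y < ?d"
        \<comment> \<open>A finite right end \<open>X (L (j + 1))\<close> belongs to
          \<open>E j\<close>, while the interval excludes \<open>sigma u x\<close>; the gap up to
          level \<open>L (j + 2)\<close> supplies the strict inequality.\<close>
        proof (cases "X (L (j + 1)) = \<infinity>")
          case True
          then have "X (L (j + 2)) = \<infinity>" using X_infinity_mono[of "j + 1" "j + 2"] by simp
          then show ?thesis using sigma_E(1)[OF x] by simp
        next
          case False
          have "ereal y \<le> X (L (j + 1))" using y le_X_iff[of "L (j + 1)" y] by (simp add: E_def)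
          also have "\<dots> < X (L (j + 2))" using False by (intro X_strict_mono) auto
          also have "\<dots> \<le> ?d" by (rule sigma_E(1)[OF x])
          finally show ?thesis .
        qed
        ultimately show "y \<in> {y. ?c \<le> y \<and> ereal y < ?d}" by simp
      qed
      have B: "{y. ?c \<le> y \<and> ereal y < ?d} \<in> sets borel" by measurable
      have "bpart f j \<le> wnorm_on q w {y. ?c \<le> y \<and> ereal y < ?d} (kernel_op k (\<lambda>z. f z * indicator {z. ereal z < sigma u ?d} z))"
        unfolding bpart_def using sigma2_E(1)[OF x] sub B
        by (intro wnorm_on_mono[OF q] E_leb E_subset w kernel_op_Mplus[OF k] trunc_Mplus f kernel_op_mono)
           (auto simp: indicator_def sigma2_def)
      then show "bpart f j \<le> wnorm q w (Hstar_between u k ?c ?d f)"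
        by (simp add: wnorm_Hstar_between[OF c0 f])
    qed
    moreover have "0 < U x" using Ux L_pos[of j] by linarith
    moreover have "ennreal (L j) \<le> cumul u x" using Ux by (simp add: cumul_eq)
    moreover have "0 < s / p" using s p by simp
    ultimately have "c j \<le> epow (cumul u x) (s / p) * epow (op x) s"
      using Xj s by (auto simp: c_def intro!: mult_mono epow_mono)
    then have "c j * u x \<le> epow (cumul u x) (s / p) * epow (op x) s * u x" by (rule mult_right_mono) auto
    then show "c j * u x \<le> G x"
      using \<open>0 < U x\<close> by (simp add: G_def cumul_eq mult_ac)
  qed (simp add: c_def)
  also have "(\<integral>\<^sup>+x\<in>{0..}. G x \<partial>lebesgue) = epow (A2 p q r u v w k) s"
    using rp s unfolding A2_def G_def op_def s_def Let_def by simp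
  finally show ?thesis by (simp add: s_def)
qed

lemma sum_bpart:
  assumes f: "f \<in> Mplus" "nv f < top" and A2: "A2 p q r u v w k < top"
  shows "(\<integral>\<^sup>+j. ennreal (L j) * epow (bpart f j) r \<partial>count_space UNIV) \<le> ennreal (cb p r) * epow (A2 p q r u v w k * nv f) r"
proof -
  define \<phi> where "\<phi> = (\<lambda>j. nv (\<lambda>z. f z * indicator (F j) z))"
  have p0: "0 < p" using p by simp
  have \<phi>: "(\<integral>\<^sup>+j. epow (\<phi> j) p \<partial>count_space UNIV) \<le> 4 * epow (nv f) p"
    unfolding \<phi>_def by (rule sum_nv_F[OF f(1)])
  have \<phi>r: "epow (\<integral>\<^sup>+j. epow (\<phi> j) p \<partial>count_space UNIV) (r / p) \<le> ennreal (4 powr (r / p)) * epow (nv f) r"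
  proof -
    have "epow (\<integral>\<^sup>+j. epow (\<phi> j) p \<partial>count_space UNIV) (r / p) \<le> epow (4 * epow (nv f) p) (r / p)"
      by (rule epow_mono[OF _ \<phi>]) (use p0 r in auto)
    also have "\<dots> = ennreal (4 powr (r / p)) * epow (nv f) r"
      using epow_ennreal[of 4 "r / p"] p0 by (simp add: epow_mult epow_epow)
    finally show ?thesis .
  qed
  show ?thesis
  proof (cases "p \<le> r")
    case True
    have "(\<integral>\<^sup>+j. ennreal (L j) * epow (bpart f j) r \<partial>count_space UNIV) \<le> (\<integral>\<^sup>+j. epow (A2 p q r u v w k) r * epow (\<phi> j) r \<partial>count_space UNIV)"
    proof (rule nn_integral_mono)
      fix j
      have "\<tau> j < top" using tau_case1[OF True] A2 by (rule le_less_trans)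
      then have "ennreal (L j) * epow (bpart f j) r \<le> epow (\<tau> j) r * epow (\<phi> j) r"
        unfolding \<phi>_def by (rule bpart_tau[OF f])
      also have "\<dots> \<le> epow (A2 p q r u v w k) r * epow (\<phi> j) r"
        by (intro mult_right_mono epow_mono[OF r] tau_case1[OF True]) simp
      finally show "ennreal (L j) * epow (bpart f j) r \<le> epow (A2 p q r u v w k) r * epow (\<phi> j) r" .
    qed
    also have "\<dots> = epow (A2 p q r u v w k) r * (\<integral>\<^sup>+j. epow (\<phi> j) r \<partial>count_space UNIV)"
      by (simp add: nn_integral_cmult)
    also have "\<dots> \<le> epow (A2 p q r u v w k) r * (ennreal (4 powr (r / p)) * epow (nv f) r)"
      by (intro mult_left_mono order_trans[OF nn_integral_epow_le[OF p0 True] \<phi>r]) simp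
    also have "\<dots> = ennreal (1 * 4 powr (r / p)) * epow (A2 p q r u v w k * nv f) r"
      by (simp add: epow_mult mult_ac)
    also have "\<dots> \<le> ennreal (cb p r) * epow (A2 p q r u v w k * nv f) r"
    proof (intro mult_right_mono ennreal_leI)
      have "0 \<le> s_exp p r" by (simp add: s_exp_def)
      then have "1 \<le> 5 powr (r / s_exp p r)" using r by (intro ge_one_powr_ge_zero) auto
      then show "1 * 4 powr (r / p) \<le> (cb p r)" unfolding cb_def by (intro mult_right_mono) auto
    qed simp
    finally show ?thesis .
  next
    case False
    then have rp: "r < p" by simp
    define s where "s = s_exp p r"
    note s = s_exp_facts[OF rp, folded s_def]
    note \<tau>s = tau_case2[OF rp, folded s_def]
    have \<tau>fin: "\<tau> j < top" for j
    proof -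
      have "epow (\<tau> j) s \<le> (\<integral>\<^sup>+j. epow (\<tau> j) s \<partial>count_space UNIV)"
        by (rule nn_integral_ge_point) simp
      also have "\<dots> \<le> 5 * epow (A2 p q r u v w k) s" by (rule \<tau>s)
      also have "\<dots> < top" using A2 by (simp add: ennreal_mult_less_top)
      finally show ?thesis by simp
    qed
    have "(\<integral>\<^sup>+j. ennreal (L j) * epow (bpart f j) r \<partial>count_space UNIV) \<le> (\<integral>\<^sup>+j. epow (\<tau> j) r * epow (\<phi> j) r \<partial>count_space UNIV)"
      unfolding \<phi>_def by (intro nn_integral_mono bpart_tau f \<tau>fin)
    also have "\<dots> \<le> 2 * epow (\<integral>\<^sup>+j. epow (epow (\<tau> j) r) (s / r) \<partial>count_space UNIV) (1 / (s / r)) 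
      * epow (\<integral>\<^sup>+j. epow (epow (\<phi> j) r) (p / r) \<partial>count_space UNIV) (1 / (p / r))"
    \<comment> \<open>The exponents s / r and p / r are conjugate because r / s + r / p = 1.\<close>
    proof (rule Hoelder_crude)
      show "0 < s / r" "0 < p / r" using s(1) p0 r by (auto intro: divide_pos_pos)
      show "1 / (s / r) + 1 / (p / r) = 1" using s(4) by (simp add: add.commute)
    qed
    also have "\<dots> = 2 * epow (\<integral>\<^sup>+j. epow (\<tau> j) s \<partial>count_space UNIV) (r / s) * epow (\<integral>\<^sup>+j. epow (\<phi> j) p \<partial>count_space UNIV) (r / p)"
      using r by (simp add: epow_epow)
    also have "\<dots> \<le> 2 * epow (5 * epow (A2 p q r u v w k) s) (r / s) * (ennreal (4 powr (r / p)) * epow (nv f) r)"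
      by (intro mult_mono \<phi>r epow_mono \<tau>s) (use s r in auto)
    also have "\<dots> = ennreal (cb p r) * epow (A2 p q r u v w k * nv f) r"
      using epow_ennreal[of 5 "r / s"] s(1) by (simp add: epow_mult epow_epow cb_def s_def[symmetric] ennreal_mult mult_ac)
    finally show ?thesis .
  qed
qed

lemma CS_le: "CS \<le> ennreal (cU p r D q) * (A0 p q r u v w k + A1 p q r u v w k + A2 p q r u v w k)"
proof (cases "A0 p q r u v w k + A1 p q r u v w k + A2 p q r u v w k < top")
  case False
  have top: "A0 p q r u v w k + A1 p q r u v w k + A2 p q r u v w k = top"
    using False unfolding less_top[symmetric] by blast
  show ?thesis unfolding top using cU_pos[OF q r D, of p] by (simp add: ennreal_mult_top)
next
  case True
  let ?A0 = "A0 p q r u v w k" and ?A1 = "A1 p q r u v w k" and ?A2 = "A2 p q r u v w k"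
  have fin: "?A0 < top" "?A1 < top" "?A2 < top" using True unfolding less_top[symmetric] by (simp_all del: not_less)
  show ?thesis
    unfolding CS_eq
  proof (rule least_constI)
    fix f assume f: "f \<in> Mplus" "nv f < top"
    let ?S = "epow ((?A0 + ?A1 + ?A2) * nv f) r"
    let ?c1 = "(cq q * cq q * D) powr r * (2 powr r * 2 powr r)"
    have A0f: "A0_lhs q r u w k f \<le> ?A0 * nv f"
      using least_constD[of "A0_lhs q r u w k" nv f] fin f by (simp add: A0_def)
    have A1f: "A1_lhs q r u w k f \<le> ?A1 * nv f"
      using least_constD[of "A1_lhs q r u w k" nv f] fin f by (simp add: A1_def)
    have le: "epow (?A0 * nv f) r \<le> ?S" "epow (?A1 * nv f) r \<le> ?S" "epow (?A2 * nv f) r \<le> ?S"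
      by (auto intro!: epow_mono[OF r] mult_right_mono simp: add.assoc add_increasing)
    have c1: "epow (wnorm_on q w (E j) (kernel_op k f)) r \<le> ennreal ?c1 * (epow (bpart f j) r + (epow (cpart f j) r + epow (dpart f j) r))" for j
    proof -
      have pos: "0 \<le> cq q * cq q * D" using cq_ge_1[of q] D by simp
      have "epow (wnorm_on q w (E j) (kernel_op k f)) r \<le> epow (ennreal (cq q * cq q * D) * (bpart f j + (cpart f j + dpart f j))) r"
        by (intro epow_mono[OF r] wnorm_on_E_le f)
      also have "\<dots> = ennreal ((cq q * cq q * D) powr r) * epow (bpart f j + (cpart f j + dpart f j)) r"
        by (simp only: epow_mult epow_ennreal[OF pos])
      also have "epow (bpart f j + (cpart f j + dpart f j)) r \<le> ennreal (2 powr r) * (epow (bpart f j) r + epow (cpart f j + dpart f j) r)"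
        by (rule epow_add_le[OF r])
      also have "\<dots> \<le> ennreal (2 powr r) * (ennreal (2 powr r) * epow (bpart f j) r + ennreal (2 powr r) * (epow (cpart f j) r + epow (dpart f j) r))"
      proof (intro mult_left_mono add_mono epow_add_le r)
        have "1 \<le> 2 powr r" using r by (intro ge_one_powr_ge_zero) auto
        then have "1 * epow (bpart f j) r \<le> ennreal (2 powr r) * epow (bpart f j) r" by (intro mult_right_mono) auto
        then show "epow (bpart f j) r \<le> ennreal (2 powr r) * epow (bpart f j) r" by simp
      qed simp
      also have "\<dots> = ennreal (2 powr r * 2 powr r) * (epow (bpart f j) r + (epow (cpart f j) r + epow (dpart f j) r))"
        by (simp add: ennreal_mult distrib_left mult.assoc)
      finally have "epow (wnorm_on q w (E j) (kernel_op k f)) r \<le> ennreal ((cq q * cq q * D) powr r) * (ennreal (2 powr r * 2 powr r) * (epow (bpart f j) r + (epow (cpart f j) r + epow (dpart f j) r)))"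
        by (simp add: mult_left_mono)
      then show ?thesis by (simp add: ennreal_mult mult.assoc)
    qed
    have "(\<integral>\<^sup>+j. ennreal (L j) * epow (wnorm_on q w (E j) (kernel_op k f)) r \<partial>count_space UNIV) \<le>
      (\<integral>\<^sup>+j. ennreal ?c1 * (ennreal (L j) * epow (bpart f j) r + (ennreal (L j) * epow (cpart f j) r + ennreal (L j) * epow (dpart f j) r)) \<partial>count_space UNIV)"
    proof (rule nn_integral_mono)
      fix j
      have "ennreal (L j) * epow (wnorm_on q w (E j) (kernel_op k f)) r \<le> ennreal (L j) * (ennreal ?c1 * (epow (bpart f j) r + (epow (cpart f j) r + epow (dpart f j) r)))"
        by (rule mult_left_mono[OF c1]) simp
      then show "ennreal (L j) * epow (wnorm_on q w (E j) (kernel_op k f)) r \<le> ennreal ?c1 * (ennreal (L j) * epow (bpart f j) r + (ennreal (L j) * epow (cpart f j) r + ennreal (L j) * epow (dpart f j) r))"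
        unfolding distrib_left[symmetric] by (simp only: mult.left_commute)
    qed
    also have "\<dots> = ennreal ?c1 * ((\<integral>\<^sup>+j. ennreal (L j) * epow (bpart f j) r \<partial>count_space UNIV) + 
       ((\<integral>\<^sup>+j. ennreal (L j) * epow (cpart f j) r \<partial>count_space UNIV) + (\<integral>\<^sup>+j. ennreal (L j) * epow (dpart f j) r \<partial>count_space UNIV)))"
      by (simp add: nn_integral_cmult nn_integral_add)
    also have "\<dots> \<le> ennreal ?c1 * (ennreal (cb p r) * ?S + (ennreal (10 * D powr r) * ?S + ennreal (10 * D powr r) * ?S))"
    proof (intro mult_left_mono add_mono)
      show "(\<integral>\<^sup>+j. ennreal (L j) * epow (bpart f j) r \<partial>count_space UNIV) \<le> ennreal (cb p r) * ?S"
        by (rule order_trans[OF sum_bpart[OF f fin(3)] mult_left_mono[OF le(3)]]) simp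
      show "(\<integral>\<^sup>+j. ennreal (L j) * epow (cpart f j) r \<partial>count_space UNIV) \<le> ennreal (10 * D powr r) * ?S"
        by (intro order_trans[OF sum_cpart[OF f(1)]] mult_left_mono order_trans[OF epow_mono[OF r A0f] le(1)]) simp
      show "(\<integral>\<^sup>+j. ennreal (L j) * epow (dpart f j) r \<partial>count_space UNIV) \<le> ennreal (10 * D powr r) * ?S"
        by (intro order_trans[OF sum_dpart[OF f(1)]] mult_left_mono order_trans[OF epow_mono[OF r A1f] le(2)]) simp
    qed simp
    also have "\<dots> = ennreal (?c1 * (20 * D powr r + (cb p r))) * ?S"
    proof -
      have "0 \<le> (cb p r)" by (simp add: cb_def)
      then have "ennreal (20 * D powr r + (cb p r)) = ennreal (cb p r) + (ennreal (10 * D powr r) + ennreal (10 * D powr r))"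
        by (simp add: add.commute flip: ennreal_plus)
      then have "ennreal (cb p r) * ?S + (ennreal (10 * D powr r) * ?S + ennreal (10 * D powr r) * ?S) = ennreal (20 * D powr r + (cb p r)) * ?S"
        by (simp only: distrib_right)
      moreover have "ennreal (?c1 * (20 * D powr r + (cb p r))) = ennreal ?c1 * ennreal (20 * D powr r + (cb p r))"
        using \<open>0 \<le> (cb p r)\<close> by (intro ennreal_mult) auto
      ultimately show ?thesis by (simp only: mult.assoc)
    qed
    finally have "ennreal (hc q r * cG) * (\<integral>\<^sup>+j. ennreal (L j) * epow (wnorm_on q w (E j) (kernel_op k f)) r \<partial>count_space UNIV) 
      \<le> ennreal (hc q r * cG) * (ennreal (?c1 * (20 * D powr r + (cb p r))) * ?S)"
      by (rule mult_left_mono) simp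
    with NS_le_level_sum[OF f(1)] have "epow (NS f) r \<le> ennreal (hc q r * cG) * (ennreal (?c1 * (20 * D powr r + (cb p r))) * ?S)"
      by (rule order_trans)
    also have "\<dots> = ennreal (hc q r * cG * ?c1 * (20 * D powr r + (cb p r))) * ?S"
    proof -
      have "0 \<le> cb p r" "0 \<le> cG" using cb_pos[of p r] cG_pos by simp_all
      then show ?thesis using hc_nonneg[of q r] by (simp add: ennreal_mult[symmetric] mult.assoc[symmetric])
    qed
    finally have "NS f \<le> epow (ennreal (hc q r * cG * ?c1 * (20 * D powr r + (cb p r))) * ?S) (1 / r)"
      using r by (subst (asm) epow_le_iff) auto
    also have "\<dots> = ennreal (cU p r D q) * ((?A0 + ?A1 + ?A2) * nv f)"
    proof -
      have "0 \<le> cb p r" "0 \<le> cG" using cb_pos[of p r] cG_pos by simp_all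
      then have "0 \<le> hc q r * cG * ?c1 * (20 * D powr r + (cb p r))" using hc_nonneg[of q r] by simp
      then show ?thesis using r unfolding cU_def epow_mult[of _ ?S] by (simp add: epow_ennreal)
    qed
    finally show "NS f \<le> ennreal (cU p r D q) * (?A0 + ?A1 + ?A2) * nv f" by (simp only: mult.assoc)
  qed
qed

end

section \<open>Weights without mass, and the equivalence\<close>

context setting
begin

lemma A2_le: "A2 p q r u v w k \<le> ennreal (1 + cA2 r) * CS"
proof (cases "p \<le> r")
  case True
  have "A2 p q r u v w k \<le> 1 * CS" using A2_le_case1[OF True] by simp
  also have "\<dots> \<le> ennreal (1 + cA2 r) * CS"
    by (intro mult_right_mono) (auto simp: cA2_def)
  finally show ?thesis .
next
  case False
  show ?thesis
  proof (cases "\<exists>y0. 0 < U y0")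
    case True
    then obtain y0 where "0 < U y0" ..
    then interpret pos_setting u p r D q v w k y0 by unfold_locales
    have "A2 p q r u v w k \<le> ennreal (cA2 r) * CS" using False by (intro A2_le_case2) simp
    also have "\<dots> \<le> ennreal (1 + cA2 r) * CS" by (intro mult_right_mono ennreal_leI) auto
    finally show ?thesis .
  next
    case False
    then have "U x = 0" for x using U_nonneg[of x] by (intro antisym) (auto simp: not_less)
    then have "cumul u x = 0" for x by (simp add: cumul_eq)
    then show ?thesis using \<open>\<not> p \<le> r\<close> by (simp add: A2_def)
  qed
qed

text \<open>Without mass M is 0 and the levels degenerate, but then u vanishes almost everywhere and
  \<open>CS\<close> is 0.\<close>

lemma C_S_le: "CS \<le> ennreal (cU p r D q) * (A0 p q r u v w k + A1 p q r u v w k + A2 p q r u v w k)"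
proof (cases "\<exists>y0. 0 < U y0")
  case True
  then obtain y0 where "0 < U y0" ..
  then interpret pos_setting u p r D q v w k y0 by unfold_locales
  show ?thesis by (rule CS_le)
next
  case False
  then have "{x. 0 \<le> x \<and> U x \<le> 0} = {0..}" by (auto simp: not_less)
  then have "(\<integral>\<^sup>+x\<in>{0..}. u x \<partial>lebesgue) = 0" using u_U_le[of 0] by simp
  then have u0: "AE x in lebesgue. u x * indicator {0..} x = 0"
    by (subst (asm) nn_integral_0_iff_AE) (auto intro!: Mplus_indicator u)
  have "NS f = 0" for f
  proof -
    have "(\<integral>\<^sup>+x\<in>{0..}. epow (Sf f x) r * u x \<partial>lebesgue) = (\<integral>\<^sup>+(x::real). 0 \<partial>lebesgue)"
      by (rule nn_integral_cong_AE) (use u0 in \<open>auto elim!: eventually_mono simp: indicator_def\<close>)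
    then show ?thesis by (simp add: NS_eq)
  qed
  then have "CS \<le> 0" unfolding CS_eq by (intro least_constI) simp
  then show ?thesis by simp
qed

end

theorem theorem2p3:
  fixes p r D :: real and q :: ennreal
  assumes "1 \<le> p" and "0 < r" and "0 < q" and "1 \<le> D"
  shows "\<exists>K::real. K > 0 \<and>
    (\<forall>(u::real \<Rightarrow> ennreal) (v::real \<Rightarrow> ennreal) (w::real \<Rightarrow> ennreal) (k::real \<Rightarrow> real \<Rightarrow> ennreal).
       u \<in> Mplus \<and> v \<in> Mplus \<and> w \<in> Mplus \<and> (\<forall>t>0. cumul u t < \<infinity>) \<and> oinarov_kernel D k \<longrightarrow>
       (C_S p q r u v w k < \<infinity> \<longleftrightarrow>
          A0 p q r u v w k < \<infinity> \<and> A1 p q r u v w k < \<infinity> \<and> A2 p q r u v w k < \<infinity>) \<and>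
       C_S p q r u v w k \<le> ennreal K * (A0 p q r u v w k + A1 p q r u v w k + A2 p q r u v w k) \<and>
       A0 p q r u v w k + A1 p q r u v w k + A2 p q r u v w k \<le> ennreal K * C_S p q r u v w k)"
proof -
  define K where "K = cU p r D q + (D + D + (1 + cA2 r))"
  have pos: "0 < cU p r D q" "0 \<le> cA2 r" using cU_pos[OF assms(3,2,4)] by (simp_all add: cA2_def)
  have "0 < K" using pos assms(4) by (simp add: K_def)
  moreover have "(C_S p q r u v w k < \<infinity> \<longleftrightarrow>
          A0 p q r u v w k < \<infinity> \<and> A1 p q r u v w k < \<infinity> \<and> A2 p q r u v w k < \<infinity>) \<and>
       C_S p q r u v w k \<le> ennreal K * (A0 p q r u v w k + A1 p q r u v w k + A2 p q r u v w k) \<and>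
       A0 p q r u v w k + A1 p q r u v w k + A2 p q r u v w k \<le> ennreal K * C_S p q r u v w k"
    if h: "u \<in> Mplus \<and> v \<in> Mplus \<and> w \<in> Mplus \<and> (\<forall>t>0. cumul u t < \<infinity>) \<and> oinarov_kernel D k" for u v w k
  proof -
    interpret setting u p r D q v w k using h assms by unfold_locales auto
    let ?A = "A0 p q r u v w k + A1 p q r u v w k + A2 p q r u v w k"
    have upper: "CS \<le> ennreal K * ?A"
      by (rule order_trans[OF C_S_le]) (intro mult_right_mono ennreal_leI, use pos assms(4) in \<open>auto simp: K_def\<close>)
    have "?A \<le> ennreal D * CS + ennreal D * CS + ennreal (1 + cA2 r) * CS"
      by (intro add_mono A0_le A1_le A2_le)
    also have "\<dots> = ennreal (D + D + (1 + cA2 r)) * CS"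
    proof -
      have "ennreal (D + D + (1 + cA2 r)) = ennreal D + ennreal D + ennreal (1 + cA2 r)"
        using ennreal_plus[of "D + D" "1 + cA2 r"] ennreal_plus[of D D] assms(4) pos(2) by simp
      then show ?thesis by (simp only: distrib_right)
    qed
    also have "\<dots> \<le> ennreal K * CS"
      by (intro mult_right_mono ennreal_leI) (use pos in \<open>auto simp: K_def\<close>)
    finally have lower: "?A \<le> ennreal K * CS" .
    have "CS < top" if "?A < top"
      using upper that by (auto intro: le_less_trans simp: ennreal_mult_less_top)
    moreover have "?A < top" if "CS < top"
      by (rule le_less_trans[OF lower]) (use that in \<open>simp add: ennreal_mult_less_top\<close>)
    ultimately have "CS < top \<longleftrightarrow> ?A < top" by blast
    then show ?thesis using upper lower by simp
  qed
  ultimately show ?thesis by blast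
qed

end
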